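(* Let $k\ge 2$ be an integer, $a<b$ real numbers, and let $X_0$ be a nonconstant random variable with $P(X_0\in[a,b])=1$. Let $F:[a,b]^k\to[a,b]$ be twice continuously differentiable, and let the sequence of random variables $X_n$ be given by $X_{n+1}=F(\mathbf{X}_n)$, $n\ge 0$, where $\mathbf{X}_n=(X_{n,1},\ldots,X_{n,k})^{\mathsf T}$ with $X_{n,1},\ldots,X_{n,k}$ independent, each with the distribution of $X_n$. Suppose $F$ is averaging, or scaled averaging and homogeneous, and that $X_n\to c$ in probability for a constant $c$, with $\boldsymbol{\alpha}=F'(\mathbf{c})$ not a scalar multiple of a standard basis vector, where $F'$ is the gradient of $F$ and $\mathbf{c}=(c,\ldots,c)^{\mathsf T}\in\mathbb{R}^k$. Let $c_n=EX_n$, $W_n=(X_n-c_n)/\sqrt{\mathrm{Var}(X_n)}$, let $\mathcal{N}$ be a standard normal variable, and let $d$ denote the Wasserstein distance. Then for all $\gamma\in(\varphi,1)$ there exists $C$ such that for all $n\ge 0$ $$d(W_n,\mathcal{N})\le C\gamma^n,$$ where $$\varphi=\frac{\sum_{i=1}^k|\alpha_i|^3}{\left(\sum_{i=1}^k|\alpha_i|^2\right)^{3/2}},$$ a positive number strictly less than $1$. The value $\varphi$ achieves a minimum of $1/\sqrt{k}$ if and only if the components of $\boldsymbol{\alpha}$ are equal.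
   Context: Averaging: for $\mathcal{D}\subset\mathbb{R}$, a function $F:\mathcal{D}^k\to\mathcal{D}$ is averaging if on its domain: (1) $\min_i x_i\le F(\mathbf{x})\le\max_i x_i$; (2) $F(\mathbf{x})\le F(\mathbf{y})$ whenever $x_i\le y_i$ for all $i$; (3) for all $x<y$ (in $\mathcal{D}$) and any two distinct indices $i_1\ne i_2$, there exist $x_i\in\{x,y\}$, $i=1,\ldots,k$, such that $x_{i_1}=x$, $x_{i_2}=y$ and $x<F(\mathbf{x})<y$. Scaled averaging: $F$ is scaled averaging if $F(\mathbf{x})/F(\mathbf{1}_k)$ is averaging, where $\mathbf{1}_k\in\mathbb{R}^k$ is the vector of all ones (so $F(\mathbf{1}_k)$ is defined and nonzero). Homogeneous means homogeneous of degree one: $F(t\mathbf{x})=tF(\mathbf{x})$ whenever $\mathbf{x}$ and $t\mathbf{x}$ lie in the domain. Wasserstein distance: $d(Y,X)=\sup_{h\in\mathcal{L}}|E(h(Y)-h(X))|$, where $\mathcal{L}=\{h:\mathbb{R}\to\mathbb{R}: |h(y)-h(x)|\le|y-x| \text{ for all } x,y\}$. *)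

theory Defs
  imports "HOL-Probability.Probability"
begin

definition cube :: "real set \<Rightarrow> (real ^ 'k) set" where
  "cube D = {x. \<forall>i. x $ i \<in> D}"

definition averaging :: "real set \<Rightarrow> (real ^ 'k \<Rightarrow> real) \<Rightarrow> bool" where
  "averaging D F \<longleftrightarrow>
     F \<in> cube D \<rightarrow> D \<and>
     (\<forall>x\<in>cube D. Min (range (($) x)) \<le> F x \<and> F x \<le> Max (range (($) x))) \<and>
     (\<forall>x\<in>cube D. \<forall>y\<in>cube D. (\<forall>i. x $ i \<le> y $ i) \<longrightarrow> F x \<le> F y) \<and>
     (\<forall>x\<in>D. \<forall>y\<in>D. x < y \<longrightarrow>
        (\<forall>i1 i2. i1 \<noteq> i2 \<longrightarrow>
           (\<exists>z. (\<forall>i. z $ i \<in> {x, y}) \<and> z $ i1 = x \<and> z $ i2 = y \<and> x < F z \<and> F z < y)))"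

text \<open>The condition \<open>1 \<in> D\<close> expresses that \<open>F\<close> is defined at the all-ones vector.\<close>

definition scaled_averaging :: "real set \<Rightarrow> (real ^ 'k \<Rightarrow> real) \<Rightarrow> bool" where
  "scaled_averaging D F \<longleftrightarrow>
     1 \<in> D \<and> F (vec 1) \<noteq> 0 \<and> averaging D (\<lambda>x. F x / F (vec 1))"

definition homogeneous :: "real set \<Rightarrow> (real ^ 'k \<Rightarrow> real) \<Rightarrow> bool" where
  "homogeneous D F \<longleftrightarrow>
     (\<forall>x t. x \<in> cube D \<longrightarrow> t *\<^sub>R x \<in> cube D \<longrightarrow> F (t *\<^sub>R x) = t * F x)"

text \<open>
  Derivatives are taken within \<open>S\<close>, hence one-sided at boundary points; \<open>G\<close> is the gradient
  and \<open>H\<close> the Hessian. They are unique when \<open>S\<close> is a nondegenerate closed cube.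
\<close>

definition twice_continuously_differentiable_on ::
    "(real ^ 'k \<Rightarrow> real) \<Rightarrow> (real ^ 'k) set \<Rightarrow> bool" where
  "twice_continuously_differentiable_on F S \<longleftrightarrow>
     (\<exists>(G :: real ^ 'k \<Rightarrow> real ^ 'k) (H :: real ^ 'k \<Rightarrow> real ^ 'k ^ 'k).
        (\<forall>x\<in>S. (F has_derivative (\<lambda>h. G x \<bullet> h)) (at x within S)) \<and>
        (\<forall>x\<in>S. (G has_derivative (\<lambda>h. H x *v h)) (at x within S)) \<and>
        continuous_on S H)"

definition converges_in_probability ::
    "'a measure \<Rightarrow> (nat \<Rightarrow> 'a \<Rightarrow> real) \<Rightarrow> real \<Rightarrow> bool" where
  "converges_in_probability M X c \<longleftrightarrow>
     (\<forall>e>0. (\<lambda>n. \<P>(\<omega> in M. \<bar>X n \<omega> - c\<bar> > e)) \<longlonglongrightarrow> 0)"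

definition standardized :: "'a measure \<Rightarrow> ('a \<Rightarrow> real) \<Rightarrow> 'a \<Rightarrow> real" where
  "standardized M X = (\<lambda>\<omega>. (X \<omega> - prob_space.expectation M X) / sqrt (prob_space.variance M X))"

text \<open>
  The distance depends on the two random variables only through their laws, so it is defined on
  laws. The supremum is taken in the extended reals, where it always exists.
\<close>

definition wasserstein_dist :: "real measure \<Rightarrow> real measure \<Rightarrow> ereal" where
  "wasserstein_dist \<mu> \<nu> =
     (SUP h\<in>{h :: real \<Rightarrow> real. 1-lipschitz_on UNIV h}.
        ereal \<bar>integral\<^sup>L \<mu> h - integral\<^sup>L \<nu> h\<bar>)"

definition contraction_rate :: "real ^ 'k \<Rightarrow> real" where
  "contraction_rate \<alpha> =
     (\<Sum>i\<in>UNIV. \<bar>\<alpha> $ i\<bar> ^ 3) / (\<Sum>i\<in>UNIV. \<bar>\<alpha> $ i\<bar> ^ 2) powr (3 / 2)"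

end

theory Submission
  imports Defs
begin

text \<open>
  The distance to the normal law is controlled by a discrepancy attached to Stein's equation. Say
  that \<open>d\<close> bounds the discrepancy of a centred variable \<open>V\<close> if
  \<open>\<bar>E[V f(V)] - E[V\<^sup>2] E[f'(V)]\<bar> \<le> L d\<close> for all \<open>f\<close> with \<open>L\<close>-Lipschitz derivative; the left side
  vanishes for all such \<open>f\<close> exactly when \<open>V\<close> is normal or zero. Three facts carry the proof.

  \<^item> If \<open>V\<close> has standard deviation \<open>\<sigma>\<close>, then the standardized \<open>V\<close> is within \<open>C d / \<sigma>\<^sup>3\<close> of the
  standard normal law, because for Lipschitz \<open>h\<close> the equation \<open>f'(x) - x f(x) = h(x) - E h(N)\<close> has
  a solution whose derivative is Lipschitz with a universal constant
  (\<open>wasserstein_le_stein_bound\<close>).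

  \<^item> If \<open>d\<close> bounds the discrepancy of \<open>V\<close> and \<open>V\<^sub>i\<close> are independent copies, then \<open>(\<Sum>\<bar>\<alpha>\<^sub>i\<bar>\<^sup>3) d\<close>
  bounds that of \<open>\<Sum> \<alpha>\<^sub>i V\<^sub>i\<close> (\<open>stein_bounded_linear_combination\<close>). The standard deviation is
  multiplied by \<open>\<bar>\<alpha>\<bar>\<close> at the same time, so \<open>d / \<sigma>\<^sup>3\<close> contracts by exactly the rate \<open>\<phi>\<close> of the
  theorem.

  \<^item> Replacing \<open>V\<close> by \<open>V + R\<close> costs at most a constant times \<open>E R\<^sup>2\<close> plus fourth moments
  (\<open>stein_bounded_perturbation\<close>).

  For averaging \<open>F\<close>, expanding around the mean \<open>c\<^sub>n\<close> writes \<open>X\<^sub>n\<^sub>+\<^sub>1 - c\<^sub>n\<^sub>+\<^sub>1\<close> as a linear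
  combination of independent copies of \<open>X\<^sub>n - c\<^sub>n\<close> plus a quadratic remainder, so the error in the
  third fact is of the order of \<open>E (X\<^sub>n - c\<^sub>n)\<^sup>4\<close>. It remains to see that this moment is of order
  \<open>\<bar>\<alpha>\<bar>\<^sup>4\<^sup>n\<close> up to factors arbitrarily close to \<open>1\<close> per step, and that \<open>\<bar>\<alpha>\<bar>\<^sup>4 \<le> \<Sum>\<bar>\<alpha>\<^sub>i\<bar>\<^sup>3\<close>, which
  holds because the \<open>\<alpha>\<^sub>i\<close> are nonnegative with sum \<open>1\<close> (\<open>norm_power4_le_sum_cubes\<close>).

  The difficulty is that convergence in probability alone does not prevent rare large values of
  \<open>X\<^sub>n - c\<close> from dominating the moments. Strict averaging does. A single outlying argument is
  pulled towards \<open>c\<close> by a fixed amount, while two outlying arguments have the product of two small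
  probabilities; hence \<open>P(\<bar>X\<^sub>n - c\<bar> > \<eta>)\<close> decays faster than any geometric sequence
  (\<open>tail_geometric\<close>). The variance decays at most geometrically
  (\<open>variance_decays_at_most_geometrically\<close>). So the tails are negligible, higher moments are of
  smaller order than lower ones (\<open>higher_moment_negligible\<close>), and moments follow the linear
  recursion to first order.

  If instead \<open>F\<close> is homogeneous and \<open>F / s\<close> is averaging with \<open>s = F(1,\<dots>,1)\<close>, then
  \<open>c = F(c,\<dots>,c) = s c\<close>. Either \<open>s = 1\<close> and \<open>F\<close> itself is averaging, or \<open>c = 0\<close>; in the latter case
  a homogeneous function that is differentiable at \<open>0\<close> is linear, and there is no remainder at all
  (\<open>linear_wasserstein_rate\<close>).
\<close>

section \<open>The contraction rate\<close>

lemma sum_cubes_pos: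
  fixes \<alpha> :: "real ^ 'k"
  assumes "\<alpha> \<noteq> 0"
  shows "0 < (\<Sum>i\<in>UNIV. \<bar>\<alpha> $ i\<bar> ^ 3)"
proof -
  obtain i where "\<alpha> $ i \<noteq> 0" using assms by (metis vec_eq_iff zero_index)
  then show ?thesis by (intro sum_pos2[of _ i]) auto
qed

lemma contraction_rate_norm:
  fixes \<alpha> :: "real ^ 'k"
  assumes "\<alpha> \<noteq> 0"
  shows "contraction_rate \<alpha> = (\<Sum>i\<in>UNIV. \<bar>\<alpha> $ i\<bar> ^ 3) / norm \<alpha> ^ 3"
proof -
  have "(\<Sum>i\<in>UNIV. \<bar>\<alpha> $ i\<bar> ^ 2) = norm \<alpha> ^ 2"
    by (simp add: norm_vec_def L2_set_def sum_nonneg)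
  moreover have "(norm \<alpha> ^ 2) powr (3 / 2) = norm \<alpha> ^ 3"
    using assms powr_powr[of "norm \<alpha>" 2 "3 / 2"] powr_realpow[of "norm \<alpha>" 2] powr_realpow[of "norm \<alpha>" 3] by simp
  ultimately show ?thesis by (simp add: contraction_rate_def)
qed

lemma norm_sq_sum: fixes \<alpha> :: "real ^ 'k" shows "(norm \<alpha>)\<^sup>2 = (\<Sum>i\<in>UNIV. (\<alpha> $ i)\<^sup>2)"
  by (simp add: norm_vec_def L2_set_def sum_nonneg)

lemma contraction_rate_pos:
  fixes \<alpha> :: "real ^ 'k"
  assumes "\<alpha> \<noteq> 0"
  shows "0 < contraction_rate \<alpha>"
  using sum_cubes_pos[OF assms] assms by (simp add: contraction_rate_norm)

lemma abs_cube: "\<bar>t\<bar> ^ 3 = \<bar>t\<bar> * t\<^sup>2" for t :: real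
  by (metis power3_eq_cube power2_eq_square power2_abs mult.assoc)

text \<open>
  Each \<open>\<bar>\<alpha>\<^sub>i\<bar>\<^sup>3\<close> is at most \<open>\<bar>\<alpha>\<bar> \<alpha>\<^sub>i\<^sup>2\<close>, and these bounds sum to \<open>\<bar>\<alpha>\<bar>\<^sup>3\<close>. One of them is strict,
  because two components are nonzero and so each of the two is smaller than the norm.
\<close>

lemma contraction_rate_less_one:
  fixes \<alpha> :: "real ^ 'k"
  assumes "\<not> (\<exists>t i. \<alpha> = t *\<^sub>R axis i 1)"
  shows "contraction_rate \<alpha> < 1"
proof -
  have nz: "\<alpha> \<noteq> 0" using assms[simplified, rule_format, of 0] by auto
  then obtain i where i: "\<alpha> $ i \<noteq> 0" by (metis vec_eq_iff zero_index)
  have "\<alpha> \<noteq> (\<alpha> $ i) *\<^sub>R axis i 1" using assms by blast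
  then obtain j where "\<alpha> $ j \<noteq> ((\<alpha> $ i) *\<^sub>R axis i 1) $ j" by (meson vec_eq_iff)
  then have j: "\<alpha> $ j \<noteq> 0" "j \<noteq> i" by (auto simp: axis_def split: if_splits)
  have *: "\<bar>\<alpha> $ l\<bar> ^ 3 \<le> norm \<alpha> * (\<alpha> $ l)\<^sup>2" for l
  proof -
    have "\<bar>\<alpha> $ l\<bar> * (\<alpha> $ l)\<^sup>2 \<le> norm \<alpha> * (\<alpha> $ l)\<^sup>2"
      by (intro mult_right_mono component_le_norm_cart) auto
    then show ?thesis by (simp add: abs_cube)
  qed
  have "(\<alpha> $ i)\<^sup>2 + (\<alpha> $ j)\<^sup>2 = (\<Sum>l\<in>{i,j}. (\<alpha> $ l)\<^sup>2)" using j by simp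
  also have "\<dots> \<le> (\<Sum>l\<in>UNIV. (\<alpha> $ l)\<^sup>2)" by (intro sum_mono2) auto
  finally have "(\<alpha> $ i)\<^sup>2 < (norm \<alpha>)\<^sup>2" using j unfolding norm_sq_sum
    by (smt (verit) zero_less_power2)
  then have "\<bar>\<alpha> $ i\<bar> < norm \<alpha>" by (metis norm_ge_zero power2_abs power_less_imp_less_base)
  then have "\<bar>\<alpha> $ i\<bar> * (\<alpha> $ i)\<^sup>2 < norm \<alpha> * (\<alpha> $ i)\<^sup>2" using i by simp
  then have s: "\<bar>\<alpha> $ i\<bar> ^ 3 < norm \<alpha> * (\<alpha> $ i)\<^sup>2"
    by (simp add: abs_cube)
  have "(\<Sum>l\<in>UNIV. \<bar>\<alpha> $ l\<bar> ^ 3) < (\<Sum>l\<in>UNIV. norm \<alpha> * (\<alpha> $ l)\<^sup>2)"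
    by (rule sum_strict_mono_ex1) (use * s in auto)
  also have "\<dots> = norm \<alpha> * (norm \<alpha>)\<^sup>2" by (simp add: norm_sq_sum sum_distrib_left)
  finally show ?thesis using nz by (simp add: contraction_rate_norm power3_eq_cube power2_eq_square)
qed

text \<open>
  The quadratic in \<open>t\<^sup>2\<close> subtracted on the left touches the cubic at \<open>t = m\<close>. Taken at
  \<open>m = \<bar>\<beta>\<bar> / \<surd>k\<close> and summed over the components it gives both the lower bound \<open>1 / \<surd>k\<close> and its
  equality case.
\<close>

lemma cubic_tangent:
  fixes t m :: real
  shows "t ^ 3 - (3 / 2 * m * t\<^sup>2 - m ^ 3 / 2) = (t - m)\<^sup>2 * (t + m / 2)"
  by (simp add: power3_eq_cube power2_eq_square field_simps)

lemma contraction_rate_excess: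
  fixes \<beta> :: "real ^ 'k"
  assumes "\<beta> \<noteq> 0"
  defines "m \<equiv> norm \<beta> / sqrt (real CARD('k))"
  shows "contraction_rate \<beta> - 1 / sqrt (real CARD('k)) =
     (\<Sum>i\<in>UNIV. (\<bar>\<beta> $ i\<bar> - m)\<^sup>2 * (\<bar>\<beta> $ i\<bar> + m / 2)) / norm \<beta> ^ 3"
proof -
  define k where "k = real CARD('k)"
  have k: "k > 0" by (simp add: k_def)
  have km: "k * m ^ 3 = m * (norm \<beta>)\<^sup>2"
    using k unfolding m_def k_def by (simp add: power3_eq_cube power2_eq_square field_simps)
  have "(\<Sum>i\<in>UNIV. (\<bar>\<beta> $ i\<bar> - m)\<^sup>2 * (\<bar>\<beta> $ i\<bar> + m / 2))
      = (\<Sum>i\<in>UNIV. \<bar>\<beta> $ i\<bar> ^ 3) - 3 / 2 * m * (norm \<beta>)\<^sup>2 + k * m ^ 3 / 2"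
    unfolding cubic_tangent[symmetric] norm_sq_sum k_def
    by (simp add: sum_subtractf sum_distrib_left sum.distrib)
  also have "\<dots> = (\<Sum>i\<in>UNIV. \<bar>\<beta> $ i\<bar> ^ 3) - m * (norm \<beta>)\<^sup>2"
    using km by simp
  also have "m * (norm \<beta>)\<^sup>2 = norm \<beta> ^ 3 / sqrt k"
    by (simp add: m_def k_def power3_eq_cube power2_eq_square)
  finally show ?thesis using assms(1) 
    by (simp add: contraction_rate_norm k_def diff_divide_distrib)
qed

lemma contraction_rate_lower:
  fixes \<beta> :: "real ^ 'k"
  assumes "\<beta> \<noteq> 0"
  shows "1 / sqrt (real CARD('k)) \<le> contraction_rate \<beta>"
proof -
  have "0 \<le> contraction_rate \<beta> - 1 / sqrt (real CARD('k))"
    unfolding contraction_rate_excess[OF assms]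
    by (intro divide_nonneg_nonneg sum_nonneg mult_nonneg_nonneg add_nonneg_nonneg) auto
  then show ?thesis by simp
qed

lemma contraction_rate_eq_iff:
  fixes \<beta> :: "real ^ 'k"
  assumes "\<beta> \<noteq> 0"
  shows "contraction_rate \<beta> = 1 / sqrt (real CARD('k)) \<longleftrightarrow> (\<forall>i j. \<bar>\<beta> $ i\<bar> = \<bar>\<beta> $ j\<bar>)"
proof
  define m where "m = norm \<beta> / sqrt (real CARD('k))"
  have m: "m > 0" using assms by (simp add: m_def)
  assume "contraction_rate \<beta> = 1 / sqrt (real CARD('k))"
  then have "(\<Sum>i\<in>UNIV. (\<bar>\<beta> $ i\<bar> - m)\<^sup>2 * (\<bar>\<beta> $ i\<bar> + m / 2)) = 0"
    using contraction_rate_excess[OF assms] assms by (simp add: m_def)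
  then have "(\<bar>\<beta> $ i\<bar> - m)\<^sup>2 * (\<bar>\<beta> $ i\<bar> + m / 2) = 0" for i
    using m by (subst (asm) sum_nonneg_eq_0_iff) auto
  moreover have "\<bar>\<beta> $ i\<bar> + m / 2 \<noteq> 0" for i
    using m by (smt (verit) divide_pos_pos)
  ultimately show "\<forall>i j. \<bar>\<beta> $ i\<bar> = \<bar>\<beta> $ j\<bar>" by auto
next
  assume eq: "\<forall>i j. \<bar>\<beta> $ i\<bar> = \<bar>\<beta> $ j\<bar>"
  obtain t where t: "\<And>i. \<bar>\<beta> $ i\<bar> = t" using eq by blast
  then have "(\<beta> $ i)\<^sup>2 = t\<^sup>2" for i by (metis power2_abs)
  then have "(norm \<beta>)\<^sup>2 = real CARD('k) * t\<^sup>2" by (simp add: norm_sq_sum)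
  moreover have "t \<ge> 0" using t by (metis abs_ge_zero)
  ultimately have "norm \<beta> = sqrt (real CARD('k)) * t"
    by (metis norm_ge_zero real_sqrt_mult real_sqrt_unique)
  then have "norm \<beta> / sqrt (real CARD('k)) = t" by simp
  then show "contraction_rate \<beta> = 1 / sqrt (real CARD('k))"
    using contraction_rate_excess[OF assms] t by simp
qed

text \<open>
  Expanding \<open>\<Sum> \<bar>\<alpha>\<^sub>i\<bar> (\<bar>\<alpha>\<^sub>i\<bar> - \<bar>\<alpha>\<bar>\<^sup>2)\<^sup>2 \<ge> 0\<close> is the Cauchy--Schwarz inequality here. It is what
  lets the quadratic Taylor remainder decay at least as fast as the discrepancy.
\<close>

lemma norm_power4_le_sum_cubes:
  fixes \<alpha> :: "real ^ 'k"
  assumes "(\<Sum>i\<in>UNIV. \<bar>\<alpha> $ i\<bar>) \<le> 1"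
  shows "norm \<alpha> ^ 4 \<le> (\<Sum>i\<in>UNIV. \<bar>\<alpha> $ i\<bar> ^ 3)"
proof -
  let ?l = "(norm \<alpha>)\<^sup>2"
  have "0 \<le> (\<Sum>i\<in>UNIV. \<bar>\<alpha> $ i\<bar> * (\<bar>\<alpha> $ i\<bar> - ?l)\<^sup>2)" by (intro sum_nonneg) auto
  also have "\<dots> = (\<Sum>i\<in>UNIV. \<bar>\<alpha> $ i\<bar> ^ 3 - 2 * ?l * (\<alpha> $ i)\<^sup>2 + ?l\<^sup>2 * \<bar>\<alpha> $ i\<bar>)"
    by (intro sum.cong refl) (simp add: abs_cube power2_diff algebra_simps power2_eq_square)
  also have "\<dots> = (\<Sum>i\<in>UNIV. \<bar>\<alpha> $ i\<bar> ^ 3) - 2 * ?l * ?l + ?l\<^sup>2 * (\<Sum>i\<in>UNIV. \<bar>\<alpha> $ i\<bar>)"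
    by (simp add: sum.distrib sum_subtractf norm_sq_sum flip: sum_distrib_left)
  also have "\<dots> \<le> (\<Sum>i\<in>UNIV. \<bar>\<alpha> $ i\<bar> ^ 3) - 2 * ?l * ?l + ?l\<^sup>2 * 1"
    using assms by (intro add_left_mono mult_left_mono) auto
  finally show ?thesis by (simp add: power2_eq_square power4_eq_xxxx mult.assoc)
qed

section \<open>Stein's equation for the normal law\<close>

lemma has_real_derivative_gauss:
  "((\<lambda>t. exp (- t\<^sup>2 / 2)) has_real_derivative - t * exp (- t\<^sup>2 / 2)) (at t)"
  by (auto intro!: derivative_eq_intros)

lemma tendsto_gauss_at_top: "((\<lambda>t::real. exp (- t\<^sup>2 / 2)) \<longlongrightarrow> 0) at_top"
  by (intro filterlim_compose[OF exp_at_bot] filterlim_tendsto_pos_mult_at_bot) real_asymp+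

text \<open>
  The function \<open>B exp(-t\<^sup>2/2)\<close> has derivative \<open>-B t exp(-t\<^sup>2/2)\<close>, so \<open>\<plusminus>Q - B exp(-t\<^sup>2/2)\<close> is
  nondecreasing beyond \<open>x\<close> and tends to \<open>0\<close>. This takes the place of Mills ratio estimates, for
  the Stein solution and for difference quotients of it.
\<close>

lemma gaussian_tail_comparison:
  fixes Q q :: "real \<Rightarrow> real"
  assumes Q: "\<And>t. (Q has_real_derivative q t) (at t)"
    and q: "\<And>t. t \<ge> x \<Longrightarrow> \<bar>q t\<bar> \<le> B * t * exp (- t\<^sup>2 / 2)"
    and lim: "(Q \<longlongrightarrow> 0) at_top"
  shows "\<bar>Q x\<bar> \<le> B * exp (- x\<^sup>2 / 2)"
proof -
  have *: "P x \<le> B * exp (- x\<^sup>2 / 2)" 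
    if P: "\<And>t. (P has_real_derivative p t) (at t)" 
      and p: "\<And>t. t \<ge> x \<Longrightarrow> \<bar>p t\<bar> \<le> B * t * exp (- t\<^sup>2 / 2)"
      and lim: "(P \<longlongrightarrow> 0) at_top" for P p
  proof -
    define D where "D t = P t - B * exp (- t\<^sup>2 / 2)" for t
    have "D x \<le> D t" if "x \<le> t" for t
    proof (rule DERIV_nonneg_imp_nondecreasing[OF that])
      fix s assume "x \<le> s"
      show "\<exists>y. (D has_real_derivative y) (at s) \<and> 0 \<le> y"
        using p[OF \<open>x \<le> s\<close>] unfolding D_def
        by (intro exI[of _ "p s - B * (- s * exp (- s\<^sup>2 / 2))"] conjI DERIV_diff P 
            DERIV_cmult has_real_derivative_gauss) (auto simp: abs_le_iff algebra_simps)
    qed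
    then have "eventually (\<lambda>t. D x \<le> D t) at_top"
      by (auto intro: eventually_at_top_linorderI)
    moreover have "(D \<longlongrightarrow> 0 - B * 0) at_top"
      unfolding D_def by (intro tendsto_intros lim tendsto_gauss_at_top)
    ultimately have "D x \<le> 0"
      by (intro tendsto_le[OF _ _ tendsto_const, of at_top D 0 "D x"]) auto
    then show ?thesis by (simp add: D_def)
  qed
  have "Q x \<le> B * exp (- x\<^sup>2 / 2)" by (rule *[OF Q q lim])
  moreover have "- Q x \<le> B * exp (- x\<^sup>2 / 2)"
    by (rule *[of "\<lambda>t. - Q t" "\<lambda>t. - q t"]) (use Q q tendsto_minus[OF lim] in \<open>auto intro: DERIV_minus\<close>)
  ultimately show ?thesis by (simp add: abs_le_iff)
qed

text \<open>
  A bounded solution of \<open>u' = t u + r\<close> satisfies \<open>(u exp(-t\<^sup>2/2))' = r exp(-t\<^sup>2/2)\<close>, and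
  boundedness forces the product to vanish at infinity, so the comparison above applies with
  \<open>B / x\<close> in place of \<open>B\<close>. Reflection treats negative \<open>x\<close>.
\<close>

lemma bounded_stein_solution_bound:
  fixes u r :: "real \<Rightarrow> real"
  assumes u: "\<And>t. (u has_real_derivative t * u t + r t) (at t)"
    and r: "\<And>t. \<bar>r t\<bar> \<le> B" and bdd: "\<And>t. \<bar>u t\<bar> \<le> A"
  shows "\<bar>x * u x\<bar> \<le> B"
proof -
  have *: "\<bar>x * v x\<bar> \<le> B"
    if v: "\<And>t. (v has_real_derivative t * v t + s t) (at t)"
      and s: "\<And>t. \<bar>s t\<bar> \<le> B" and bdd: "\<And>t. \<bar>v t\<bar> \<le> A" and x: "x > 0" for v s x
  proof -
    let ?w = "\<lambda>t::real. exp (- t\<^sup>2 / 2)"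
    have "B \<ge> 0" using s[of 0] by simp
    have "\<bar>v x * ?w x\<bar> \<le> (B / x) * ?w x"
    proof (rule gaussian_tail_comparison[where q = "\<lambda>t. s t * ?w t"])
      show "((\<lambda>t. v t * ?w t) has_real_derivative s t * ?w t) (at t)" for t
        by (rule derivative_eq_intros v has_real_derivative_gauss)+ (simp add: algebra_simps)
      show "\<bar>s t * ?w t\<bar> \<le> B / x * t * ?w t" if "x \<le> t" for t
      proof -
        have "\<bar>s t\<bar> \<le> B * 1" using s by simp
        also have "\<dots> \<le> B * (t / x)" using that x \<open>B \<ge> 0\<close> by (intro mult_left_mono) auto
        finally have "\<bar>s t\<bar> \<le> B / x * t" by simp
        from mult_right_mono[OF this, of "?w t"] show ?thesis by (simp add: abs_mult)
      qed
      show "((\<lambda>t. v t * ?w t) \<longlongrightarrow> 0) at_top"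
      proof (rule Lim_null_comparison)
        show "\<forall>\<^sub>F t in at_top. norm (v t * ?w t) \<le> A * ?w t"
          using bdd by (auto simp: abs_mult)
        show "((\<lambda>t. A * ?w t) \<longlongrightarrow> 0) at_top"
          using tendsto_mult[OF tendsto_const tendsto_gauss_at_top] by simp
      qed
    qed
    then show ?thesis using x by (simp add: abs_mult field_simps)
  qed
  consider "x > 0" | "x = 0" | "x < 0" by linarith
  then show ?thesis
  proof cases
    case 1 then show ?thesis using * u r bdd by blast
  next
    case 2 then show ?thesis using r[of 0] by simp
  next
    case 3
    have "((\<lambda>t. u (- t)) has_real_derivative (t * u (- t) + - r (- t))) (at t)" for t
      using u[of "- t"] by (simp add: DERIV_mirror)
    then have "\<bar>(- x) * u (- (- x))\<bar> \<le> B"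
      by (rule *) (use r bdd 3 in auto)
    then show ?thesis by simp
  qed
qed

text \<open>
  The difference quotient of a solution solves Stein's equation again, with right-hand side
  \<open>f(t + s) + (g(t + s) - g(t)) / s\<close>, which is bounded by \<open>A + 1\<close>. The previous bound therefore
  applies to it and controls the increments of \<open>f'\<close>, without differentiating \<open>g\<close>.
\<close>

lemma stein_solution_deriv_lipschitz:
  fixes f g :: "real \<Rightarrow> real"
  assumes f: "\<And>t. (f has_real_derivative t * f t + g t) (at t)"
    and bdd: "\<And>t. \<bar>f t\<bar> \<le> A" and g: "1-lipschitz_on UNIV g"
  shows "(2 * (A + 1))-lipschitz_on UNIV (\<lambda>t. t * f t + g t)"
proof -
  have A: "A \<ge> 0" using bdd[of 0] by simp
  define f' where "f' t = t * f t + g t" for t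
  have "\<bar>f' (x + s) - f' x\<bar> \<le> 2 * (A + 1) * \<bar>s\<bar>" if s: "s \<noteq> 0" for x s
  proof -
    define u where "u t = (f (t + s) - f t) / s" for t
    define r where "r t = f (t + s) + (g (t + s) - g t) / s" for t
    have u_eq: "(f' (t + s) - f' t) / s = t * u t + r t" for t
      using s by (simp add: f'_def u_def r_def field_simps)
    have fs: "((\<lambda>t. f (t + s)) has_real_derivative f' (t + s)) (at t)" for t
      using f[of "t + s"] by (simp add: f'_def DERIV_shift)
    have u: "(u has_real_derivative t * u t + r t) (at t)" for t
      unfolding u_eq[symmetric] unfolding u_def
      by (intro DERIV_cdivide DERIV_diff fs) (use f in \<open>simp add: f'_def\<close>)
    have r: "\<bar>r t\<bar> \<le> A + 1" for t
    proof -
      have "\<bar>g (t + s) - g t\<bar> \<le> \<bar>s\<bar>" using lipschitz_onD[OF g, of "t + s" t] by (simp add: dist_real_def)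
      then have "\<bar>(g (t + s) - g t) / s\<bar> \<le> 1" using s by (simp add: abs_divide)
      then show ?thesis using bdd[of "t + s"] unfolding r_def by linarith
    qed
    have "\<bar>u t\<bar> \<le> 2 * A / \<bar>s\<bar>" for t
    proof -
      have "\<bar>f (t + s) - f t\<bar> \<le> 2 * A" using bdd[of "t + s"] bdd[of t] by linarith
      then show ?thesis by (simp add: u_def divide_right_mono)
    qed
    from bounded_stein_solution_bound[OF u r this] have "\<bar>x * u x\<bar> \<le> A + 1" .
    then have "\<bar>x * u x + r x\<bar> \<le> 2 * (A + 1)" 
      using r[of x] abs_triangle_ineq[of "x * u x" "r x"] by (simp add: algebra_simps)
    then have "\<bar>(f' (x + s) - f' x) / s\<bar> \<le> 2 * (A + 1)" using u_eq[of x] by simp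
    then show ?thesis using s by (simp add: abs_divide field_simps)
  qed
  note * = this
  show ?thesis
  proof (rule lipschitz_onI)
    fix x y :: real
    show "dist (x * f x + g x) (y * f y + g y) \<le> 2 * (A + 1) * dist x y"
      using *[of "x - y" y] by (cases "x = y") (auto simp: dist_real_def f'_def)
  qed (use A in simp)
qed

lemma prob_space_std_normal_distribution: "prob_space std_normal_distribution"
  using prob_space_normal_density by simp

lemma integrable_std_normal_lipschitz:
  assumes "C-lipschitz_on UNIV (h :: real \<Rightarrow> real)"
  shows "integrable std_normal_distribution h"
proof -
  interpret prob_space std_normal_distribution by (rule prob_space_std_normal_distribution)
  have [measurable]: "h \<in> borel_measurable borel"
    using lipschitz_on_continuous_on[OF assms] by (rule borel_measurable_continuous_onI)
  have i: "integrable std_normal_distribution (\<lambda>x. \<bar>x\<bar>)"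
    using integrable_std_normal_distribution_moment[of 1] by simp
  show ?thesis
  proof (rule Bochner_Integration.integrable_bound)
    show "integrable std_normal_distribution (\<lambda>x. \<bar>h 0\<bar> + C * \<bar>x\<bar>)" using i by simp
    show "AE x in std_normal_distribution. norm (h x) \<le> norm (\<bar>h 0\<bar> + C * \<bar>x\<bar>)"
    proof (rule AE_I2)
      fix x show "norm (h x) \<le> norm (\<bar>h 0\<bar> + C * \<bar>x\<bar>)"
        using lipschitz_onD[OF assms, of x 0] lipschitz_on_nonneg[OF assms]
        by (auto simp: dist_real_def abs_if split: if_splits)
    qed
  qed auto
qed

text \<open>
  The bound holds for every Lipschitz \<open>h\<close> with the same constants, so that the constant in the
  solution of Stein's equation will not depend on \<open>h\<close>.
\<close>

lemma std_normal_mean_lipschitz: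
  assumes h: "1-lipschitz_on UNIV (h :: real \<Rightarrow> real)"
  shows "\<bar>h t - integral\<^sup>L std_normal_distribution h\<bar> \<le> 1 + \<bar>t\<bar>"
proof -
  interpret prob_space std_normal_distribution by (rule prob_space_std_normal_distribution)
  have i: "integrable std_normal_distribution (\<lambda>x. \<bar>x\<bar>)" 
    using integrable_std_normal_distribution_moment[of 1] by simp
  have i2: "integrable std_normal_distribution (\<lambda>x. x^2)"
    using integrable_std_normal_distribution_moment[of 2] by simp
  note ih = integrable_std_normal_lipschitz[OF h]
  have "\<bar>h t - integral\<^sup>L std_normal_distribution h\<bar> = \<bar>\<integral>x. (h t - h x) \<partial>std_normal_distribution\<bar>"
    using ih prob_space by simp
  also have "\<dots> \<le> (\<integral>x. \<bar>h t - h x\<bar> \<partial>std_normal_distribution)"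
    by (rule integral_abs_bound)
  also have "\<dots> \<le> (\<integral>x. \<bar>t\<bar> + (1 + x^2)/2 \<partial>std_normal_distribution)"
  proof (rule integral_mono)
    fix x :: real
    have "\<bar>h t - h x\<bar> \<le> \<bar>t - x\<bar>" using lipschitz_onD[OF h, of t x] by (simp add: dist_real_def)
    also have "\<dots> \<le> \<bar>t\<bar> + \<bar>x\<bar>" by simp
    also have "\<bar>x\<bar> \<le> (1 + x\<^sup>2) / 2"
      using sum_squares_bound[of 1 "\<bar>x\<bar>"] by simp
    finally show "\<bar>h t - h x\<bar> \<le> \<bar>t\<bar> + (1 + x\<^sup>2) / 2" by simp
  qed (use ih i2 in auto)
  also have "\<dots> = \<bar>t\<bar> + 1"
    using i2 std_normal_distribution_even_moments(1)[of 1] prob_space by simp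
  finally show ?thesis by simp
qed


lemma gauss_inverse: "exp (- t\<^sup>2 / 2) * exp (t\<^sup>2 / 2) = 1" for t :: real
  by (simp add: exp_minus)

text \<open>
  The solution is \<open>f(t) = exp(t\<^sup>2/2) Q(t)\<close>, where \<open>Q(t)\<close> is the integral of \<open>g exp(-x\<^sup>2/2)\<close> over
  \<open>x \<le> t\<close> and \<open>g = h - E h(N)\<close>. As \<open>g\<close> has mean zero under the normal law, \<open>Q\<close> vanishes at both
  ends, and the tail comparison bounds \<open>f\<close> for \<open>\<bar>t\<bar> \<ge> 1\<close>. In between, the total mass of
  \<open>\<bar>g\<bar> exp(-x\<^sup>2/2)\<close> suffices.
\<close>

lemma stein_equation_solution:
  obtains C :: real where "C > 0" and
    "\<And>h. 1-lipschitz_on UNIV h \<Longrightarrow> \<exists>f f'. (\<forall>t. (f has_real_derivative f' t) (at t)) \<and> 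
       C-lipschitz_on UNIV f' \<and> (\<forall>t. f' t - t * f t = h t - integral\<^sup>L std_normal_distribution h)"
proof -
  interpret prob_space std_normal_distribution by (rule prob_space_std_normal_distribution)
  let ?w = "\<lambda>t::real. exp (- t\<^sup>2 / 2)"
  define A :: real where "A = 2 + 2 * sqrt (2 * pi) * exp (1 / 2)"
  have A: "A \<ge> 2" by (simp add: A_def)
  have main: "\<exists>f f'. (\<forall>t. (f has_real_derivative f' t) (at t)) \<and> 
       (2 * (A + 1))-lipschitz_on UNIV f' \<and> (\<forall>t. f' t - t * f t = h t - integral\<^sup>L std_normal_distribution h)"
    if h: "1-lipschitz_on UNIV h" for h :: "real \<Rightarrow> real"
  proof -
    define m where "m = integral\<^sup>L std_normal_distribution h"
    define g where "g t = h t - m" for t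
    have g_lip: "1-lipschitz_on UNIV g"
      using h unfolding g_def lipschitz_on_def by (simp add: dist_real_def)
    have g_bound: "\<bar>g t\<bar> \<le> 1 + \<bar>t\<bar>" for t
      using std_normal_mean_lipschitz[OF h] by (simp add: g_def m_def)
    have g_cont: "continuous_on UNIV g" using g_lip by (rule lipschitz_on_continuous_on)
    have g_meas [measurable]: "g \<in> borel_measurable borel" 
      using g_cont by (rule borel_measurable_continuous_onI)
    have g_int: "integrable std_normal_distribution g" using g_lip by (rule integrable_std_normal_lipschitz)
    have g_mean: "integral\<^sup>L std_normal_distribution g = 0"
      using integrable_std_normal_lipschitz[OF h] prob_space by (simp add: g_def[abs_def] m_def)
    define p where "p t = g t * ?w t" for t
    have w_density: "?w t = sqrt (2 * pi) * std_normal_density t" for t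
      by (simp add: std_normal_density_def)
    have p_eq: "p t = sqrt (2 * pi) * (std_normal_density t * g t)" for t
      unfolding p_def w_density by simp
    have p_int: "integrable lborel p" unfolding p_eq[abs_def]
      using g_int by (intro integrable_mult_right) (simp add: integrable_density normal_density_nonneg)
    have p_total: "integral\<^sup>L lborel p = 0" unfolding p_eq[abs_def]
      using g_mean by (simp add: integral_density normal_density_nonneg)
    have p_abs: "(\<integral>t. \<bar>p t\<bar> \<partial>lborel) \<le> 2 * sqrt (2 * pi)"
    proof -
      have abs_lip: "1-lipschitz_on UNIV (\<lambda>t::real. \<bar>t\<bar>)"
        by (rule lipschitz_onI) (auto simp: dist_real_def)
      note abs_int = integrable_std_normal_lipschitz[OF abs_lip]
      have "(\<integral>t. \<bar>p t\<bar> \<partial>lborel) = sqrt (2 * pi) * (\<integral>t. \<bar>g t\<bar> \<partial>std_normal_distribution)"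
        unfolding p_eq by (simp add: integral_density normal_density_nonneg abs_mult)
      also have "(\<integral>t. \<bar>g t\<bar> \<partial>std_normal_distribution) \<le> (\<integral>t. 1 + \<bar>t\<bar> \<partial>std_normal_distribution)"
        using g_int abs_int g_bound by (intro integral_mono) auto
      also have "\<dots> \<le> 2"
        using std_normal_mean_lipschitz[OF abs_lip, of 0] abs_int prob_space by simp
      finally show ?thesis by simp
    qed
    define Q where "Q x = (\<integral>t. indicator {..x} t *\<^sub>R p t \<partial>lborel)" for x
    have p_cont: "continuous_on S p" for S
      unfolding p_def by (intro continuous_intros continuous_on_subset[OF g_cont]) auto
    have Q_step: "Q y = Q x + integral {x..y} p" if "x \<le> y" for x y
    proof -
      have i: "set_integrable lborel {x..y} p" 
        unfolding set_integrable_def using p_int by (intro integrable_mult_indicator) auto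
      have "Q y = (\<integral>t. indicator {..x} t *\<^sub>R p t + indicator {x<..y} t *\<^sub>R p t \<partial>lborel)"
        unfolding Q_def using that by (intro Bochner_Integration.integral_cong) (auto split: split_indicator)
      also have "\<dots> = Q x + (\<integral>t. indicator {x<..y} t *\<^sub>R p t \<partial>lborel)"
        unfolding Q_def using p_int by (intro Bochner_Integration.integral_add integrable_mult_indicator) auto
      also have "(\<integral>t. indicator {x<..y} t *\<^sub>R p t \<partial>lborel) = (\<integral>t. indicator {x..y} t *\<^sub>R p t \<partial>lborel)"
        using AE_lborel_singleton[of x] p_int that
        by (intro integral_cong_AE) (auto split: split_indicator)
      also have "\<dots> = integral {x..y} p"
        using set_borel_integral_eq_integral(2)[OF i] by (simp add: set_lebesgue_integral_def)
      finally show ?thesis .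
    qed
    have Q_deriv: "(Q has_real_derivative p x) (at x)" for x
    proof -
      have "((\<lambda>y. Q (x - 1) + integral {x - 1..y} p) has_real_derivative p x) (at x within {x - 1..x + 1})"
        using integral_has_real_derivative[OF p_cont, of x "x - 1" "x + 1"] 
        by (auto intro!: derivative_eq_intros)
      then have "(Q has_real_derivative p x) (at x within {x - 1..x + 1})"
      proof (rule has_field_derivative_transform_within[where d = 1])
        fix y assume "y \<in> {x - 1..x + 1}"
        then show "Q (x - 1) + integral {x - 1..y} p = Q y" using Q_step[of "x - 1" y] by simp
      qed auto
      then show ?thesis by (subst (asm) at_within_Icc_at) auto
    qed
    have Q_top: "(Q \<longlongrightarrow> 0) at_top"
      using tendsto_integral_at_top[OF _ p_int] p_total by (simp add: Q_def[abs_def])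
    have Q_bot: "((\<lambda>x. Q (- x)) \<longlongrightarrow> 0) at_top"
    proof -
      have "((\<lambda>x. \<integral>t. indicator {..-x} t *\<^sub>R p t \<partial>lborel) \<longlongrightarrow> (\<integral>t. 0 \<partial>(lborel :: real measure))) at_top"
      proof (rule integral_dominated_convergence_at_top[where w = "\<lambda>t. \<bar>p t\<bar>" and f = "\<lambda>_. 0" 
            and s = "\<lambda>x t. indicator {..-x} t *\<^sub>R p t"])
        show "AE t in lborel. ((\<lambda>x. indicator {..- x} t *\<^sub>R p t) \<longlongrightarrow> 0) at_top"
        proof (rule AE_I2)
          fix t :: real
          have "\<forall>\<^sub>F x in at_top. x > - t" by (rule eventually_gt_at_top)
          then have "\<forall>\<^sub>F x in at_top. indicator {..- x} t *\<^sub>R p t = 0"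
            by eventually_elim (auto split: split_indicator)
          then show "((\<lambda>x. indicator {..- x} t *\<^sub>R p t) \<longlongrightarrow> 0) at_top" by (rule tendsto_eventually)
        qed
      qed (use p_int in \<open>auto split: split_indicator\<close>)
      then show ?thesis by (simp add: Q_def)
    qed
    have Q_bound: "\<bar>Q x\<bar> \<le> A * ?w x" for x
    proof -
      consider "x \<ge> 1" | "x \<le> -1" | "\<bar>x\<bar> < 1" by linarith
      then show ?thesis
      proof cases
        case 1
        have "\<bar>Q x\<bar> \<le> 2 * ?w x"
        proof (rule gaussian_tail_comparison[OF Q_deriv _ Q_top])
          fix t assume "x \<le> t" then show "\<bar>p t\<bar> \<le> 2 * t * ?w t"
            unfolding p_def abs_mult using 1 g_bound[of t] by (intro mult_mono) auto
        qed
        also have "\<dots> \<le> A * ?w x" using A by (intro mult_right_mono) auto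
        finally show ?thesis .
      next
        case 2
        have "\<bar>Q (- (- x))\<bar> \<le> 2 * ?w (- x)"
        proof (rule gaussian_tail_comparison[OF _ _ Q_bot])
          show "((\<lambda>x. Q (- x)) has_real_derivative - p (- t)) (at t)" for t
            using Q_deriv[of "- t"] by (simp add: DERIV_mirror)
          fix t assume "- x \<le> t" then show "\<bar>- p (- t)\<bar> \<le> 2 * t * ?w t"
            unfolding p_def abs_mult abs_minus_cancel using 2 g_bound[of "-t"] by (intro mult_mono) auto
        qed
        also have "\<dots> \<le> A * ?w (- x)" using A by (intro mult_right_mono) auto
        finally show ?thesis by simp
      next
        case 3
        have "\<bar>Q x\<bar> \<le> (\<integral>t. \<bar>indicator {..x} t *\<^sub>R p t\<bar> \<partial>lborel)"
          unfolding Q_def by (rule integral_abs_bound)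
        also have "\<dots> \<le> (\<integral>t. \<bar>p t\<bar> \<partial>lborel)"
          using p_int by (intro integral_mono integrable_abs integrable_mult_indicator) 
            (auto split: split_indicator)
        also have "\<dots> \<le> 2 * sqrt (2 * pi) * 1" using p_abs by simp
        also have "\<dots> \<le> 2 * sqrt (2 * pi) * (exp (1 / 2) * ?w x)"
        proof (intro mult_left_mono)
          have "x\<^sup>2 \<le> 1" using 3 by (simp add: abs_square_le_1)
          then have "exp 0 \<le> exp (1 / 2 + - x\<^sup>2 / 2)" by (subst exp_le_cancel_iff) simp
          then show "1 \<le> exp (1 / 2) * ?w x" by (simp only: exp_add exp_zero)
        qed auto
        also have "\<dots> \<le> A * ?w x" by (simp add: A_def distrib_right)
        finally show ?thesis .
      qed
    qed
    define f where "f t = Q t * exp (t\<^sup>2 / 2)" for t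
    have f_bound: "\<bar>f t\<bar> \<le> A" for t
    proof -
      have "\<bar>f t\<bar> \<le> A * ?w t * exp (t\<^sup>2 / 2)"
        unfolding f_def abs_mult using Q_bound[of t] by (intro mult_mono) auto
      also have "\<dots> = A" using gauss_inverse[of t] by (simp add: mult.assoc)
      finally show ?thesis .
    qed
    have "(f has_real_derivative t * f t + g t) (at t)" for t
    proof -
      have "((\<lambda>t. exp (t\<^sup>2 / 2)) has_real_derivative t * exp (t\<^sup>2 / 2)) (at t)"
        by (auto intro!: derivative_eq_intros)
      from DERIV_mult[OF Q_deriv[of t] this]
      have "(f has_real_derivative p t * exp (t\<^sup>2 / 2) + t * exp (t\<^sup>2 / 2) * Q t) (at t)"
        by (simp add: f_def[abs_def])
      moreover have "p t * exp (t\<^sup>2 / 2) = g t" 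
        using gauss_inverse[of t] by (simp add: p_def mult.assoc)
      ultimately show ?thesis by (simp add: f_def algebra_simps)
    qed
    note f_deriv = this
    show ?thesis
      by (intro exI[of _ f] exI[of _ "\<lambda>t. t * f t + g t"] conjI allI f_deriv
          stein_solution_deriv_lipschitz[OF f_deriv f_bound g_lip]) (simp add: g_def m_def)
  qed
  show thesis by (rule that[of "2 * (A + 1)"]) (use A main in auto)
qed

section \<open>Bounded random variables and their moments\<close>

definition bounded_rv :: "'a measure \<Rightarrow> ('a \<Rightarrow> real) \<Rightarrow> bool" where
  "bounded_rv M Z \<longleftrightarrow> Z \<in> borel_measurable M \<and> (\<exists>B. AE \<omega> in M. \<bar>Z \<omega>\<bar> \<le> B)"

lemma bounded_rv_measurable: "bounded_rv M Z \<Longrightarrow> Z \<in> borel_measurable M"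
  by (simp add: bounded_rv_def)

lemma bounded_rv_const: "bounded_rv M (\<lambda>_. c)"
  unfolding bounded_rv_def by (auto intro: exI[of _ "\<bar>c\<bar>"])

lemma bounded_rv_add:
  assumes "bounded_rv M Y" "bounded_rv M Z"
  shows "bounded_rv M (\<lambda>\<omega>. Y \<omega> + Z \<omega>)"
proof -
  from assms obtain A B where "AE \<omega> in M. \<bar>Y \<omega>\<bar> \<le> A" "AE \<omega> in M. \<bar>Z \<omega>\<bar> \<le> B"
    by (auto simp: bounded_rv_def)
  then have "AE \<omega> in M. \<bar>Y \<omega> + Z \<omega>\<bar> \<le> A + B" by eventually_elim linarith
  then show ?thesis using assms by (auto simp: bounded_rv_def)
qed

lemma bounded_rv_mult:
  assumes "bounded_rv M Y" "bounded_rv M Z"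
  shows "bounded_rv M (\<lambda>\<omega>. Y \<omega> * Z \<omega>)"
proof -
  from assms obtain A B where "AE \<omega> in M. \<bar>Y \<omega>\<bar> \<le> A" "AE \<omega> in M. \<bar>Z \<omega>\<bar> \<le> B"
    by (auto simp: bounded_rv_def)
  then have "AE \<omega> in M. \<bar>Y \<omega> * Z \<omega>\<bar> \<le> A * B" 
    by eventually_elim (simp add: abs_mult mult_mono')
  then show ?thesis using assms by (auto simp: bounded_rv_def)
qed

lemma bounded_rv_uminus: "bounded_rv M Z \<Longrightarrow> bounded_rv M (\<lambda>\<omega>. - Z \<omega>)"
  by (auto simp: bounded_rv_def)

lemma bounded_rv_diff:
  assumes "bounded_rv M Y" "bounded_rv M Z"
  shows "bounded_rv M (\<lambda>\<omega>. Y \<omega> - Z \<omega>)"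
  using bounded_rv_add[OF assms(1) bounded_rv_uminus[OF assms(2)]] by simp

lemma bounded_rv_divide: "bounded_rv M Z \<Longrightarrow> bounded_rv M (\<lambda>\<omega>. Z \<omega> / c)" for c :: real
  unfolding divide_inverse by (intro bounded_rv_mult bounded_rv_const)

lemma bounded_rv_abs: "bounded_rv M Z \<Longrightarrow> bounded_rv M (\<lambda>\<omega>. \<bar>Z \<omega>\<bar>)"
  by (auto simp: bounded_rv_def)

lemma bounded_rv_power: "bounded_rv M Z \<Longrightarrow> bounded_rv M (\<lambda>\<omega>. Z \<omega> ^ n)"
  by (induction n) (simp_all add: bounded_rv_const bounded_rv_mult)

lemma bounded_rv_sum:
  "(\<And>i. i \<in> I \<Longrightarrow> bounded_rv M (Z i)) \<Longrightarrow> bounded_rv M (\<lambda>\<omega>. \<Sum>i\<in>I. Z i \<omega>)"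
  by (induction I rule: infinite_finite_induct) (simp_all add: bounded_rv_const bounded_rv_add)

lemma bounded_rv_compose:
  assumes Z: "bounded_rv M Z" and g: "continuous_on UNIV (g :: real \<Rightarrow> real)"
  shows "bounded_rv M (\<lambda>\<omega>. g (Z \<omega>))"
proof -
  from Z obtain B where B: "AE \<omega> in M. \<bar>Z \<omega>\<bar> \<le> B" by (auto simp: bounded_rv_def)
  have "bounded (g ` {-B..B})"
    by (intro compact_imp_bounded compact_continuous_image continuous_on_subset[OF g]) auto
  then obtain C where C: "\<forall>x\<in>{-B..B}. \<bar>g x\<bar> \<le> C" unfolding bounded_iff by auto
  from B have "AE \<omega> in M. \<bar>g (Z \<omega>)\<bar> \<le> C" by eventually_elim (use C in \<open>auto simp: abs_le_iff\<close>)
  moreover have "(\<lambda>\<omega>. g (Z \<omega>)) \<in> borel_measurable M"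
    using borel_measurable_continuous_onI[OF g] bounded_rv_measurable[OF Z] by measurable
  ultimately show ?thesis by (auto simp: bounded_rv_def)
qed

lemma bounded_rv_distr_iff:
  assumes "Z \<in> borel_measurable M" "g \<in> borel_measurable borel"
  shows "bounded_rv (distr M borel Z) g \<longleftrightarrow> bounded_rv M (\<lambda>\<omega>. g (Z \<omega>))"
  using assms by (auto simp: bounded_rv_def AE_distr_iff)

lemmas bounded_rv_intros = bounded_rv_const bounded_rv_add bounded_rv_mult bounded_rv_uminus
  bounded_rv_diff bounded_rv_divide bounded_rv_abs bounded_rv_power bounded_rv_sum

context prob_space
begin

lemma bounded_rv_integrable: "bounded_rv M Z \<Longrightarrow> integrable M Z"
proof -
  assume Z: "bounded_rv M Z"
  then obtain B where "AE \<omega> in M. \<bar>Z \<omega>\<bar> \<le> B" by (auto simp: bounded_rv_def)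
  then show ?thesis
    using bounded_rv_measurable[OF Z] by (intro integrable_const_bound[of Z B]) auto
qed

lemma square_expectation_le:
  assumes "bounded_rv M Z"
  shows "(expectation Z)\<^sup>2 \<le> expectation (\<lambda>\<omega>. (Z \<omega>)\<^sup>2)"
  using variance_positive[of Z] 
  by (subst (asm) variance_eq) (auto intro!: bounded_rv_integrable bounded_rv_intros assms)

text \<open>
  Nonnegativity of \<open>E (s U + t V)\<^sup>2\<close> for suitable \<open>s\<close> and \<open>t\<close>.
\<close>

lemma expectation_Cauchy_Schwarz:
  assumes U: "bounded_rv M U" and V: "bounded_rv M V"
  shows "(expectation (\<lambda>\<omega>. U \<omega> * V \<omega>))\<^sup>2 \<le> expectation (\<lambda>\<omega>. (U \<omega>)\<^sup>2) * expectation (\<lambda>\<omega>. (V \<omega>)\<^sup>2)"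
proof -
  define p where "p = expectation (\<lambda>\<omega>. (U \<omega>)\<^sup>2)"
  define q where "q = expectation (\<lambda>\<omega>. (V \<omega>)\<^sup>2)"
  define r where "r = expectation (\<lambda>\<omega>. U \<omega> * V \<omega>)"
  note int = bounded_rv_integrable bounded_rv_intros U V
  have quad: "0 \<le> s\<^sup>2 * p + 2 * s * t * r + t\<^sup>2 * q" for s t
  proof -
    have "0 \<le> expectation (\<lambda>\<omega>. (s * U \<omega> + t * V \<omega>)\<^sup>2)" by simp
    also have "\<dots> = expectation (\<lambda>\<omega>. s\<^sup>2 * (U \<omega>)\<^sup>2 + 2 * s * t * (U \<omega> * V \<omega>) + t\<^sup>2 * (V \<omega>)\<^sup>2)"
      by (intro Bochner_Integration.integral_cong) (simp_all add: power2_eq_square algebra_simps)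
    also have "\<dots> = s\<^sup>2 * p + 2 * s * t * r + t\<^sup>2 * q"
      unfolding p_def q_def r_def by (subst Bochner_Integration.integral_add, (intro int)+)+ simp
    finally show ?thesis .
  qed
  have nn: "0 \<le> p" "0 \<le> q" by (simp_all add: p_def q_def)
  have "r\<^sup>2 \<le> p * q"
  proof (cases "q = 0")
    case True
    have "0 \<le> r\<^sup>2 * p - 2 * r * (p + 1) * r"
      using quad[of "- r" "p + 1"] True by (simp add: power2_eq_square algebra_simps)
    then have "r\<^sup>2 * (p + 2) \<le> 0" by (simp add: power2_eq_square algebra_simps)
    then have "r\<^sup>2 = 0" using nn by (smt (verit) mult_pos_pos zero_le_power2)
    then show ?thesis using True by simp
  next
    case False
    then have "q > 0" using nn by simp
    have "0 \<le> q * (p * q - r\<^sup>2)"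
      using quad[of q "- r"] by (simp add: power2_eq_square algebra_simps)
    then show ?thesis using \<open>q > 0\<close> by (simp add: zero_le_mult_iff)
  qed
  then show ?thesis by (simp add: p_def q_def r_def)
qed

lemma bounded_rv_mono_AE:
  assumes "bounded_rv M U" "bounded_rv M V" "AE \<omega> in M. U \<omega> \<le> V \<omega>"
  shows "expectation U \<le> expectation V"
  using assms by (intro integral_mono_AE bounded_rv_integrable)

lemma variance_le_second_moment:
  assumes "bounded_rv M Z"
  shows "variance Z \<le> expectation (\<lambda>\<omega>. (Z \<omega> - t)\<^sup>2)"
proof -
  note int = bounded_rv_integrable bounded_rv_intros assms
  have "expectation (\<lambda>\<omega>. (Z \<omega> - t)\<^sup>2) 
      = expectation (\<lambda>\<omega>. (Z \<omega> - expectation Z)\<^sup>2 + 2 * (expectation Z - t) * (Z \<omega> - expectation Z) + (expectation Z - t)\<^sup>2)"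
    by (intro Bochner_Integration.integral_cong) (simp_all add: power2_eq_square algebra_simps)
  also have "\<dots> = variance Z + (expectation Z - t)\<^sup>2"
    by (subst Bochner_Integration.integral_add, (intro int)+)+
       (simp add: prob_space bounded_rv_integrable[OF assms])
  finally show ?thesis by simp
qed

lemma expectation_indep_mult:
  assumes ind: "indep_var borel Y borel Z" and Y: "bounded_rv M Y" and Z: "bounded_rv M Z"
    and [measurable]: "f \<in> borel_measurable borel" "g \<in> borel_measurable borel"
    and "bounded_rv M (\<lambda>\<omega>. f (Y \<omega>))" "bounded_rv M (\<lambda>\<omega>. g (Z \<omega>))"
  shows "expectation (\<lambda>\<omega>. f (Y \<omega>) * g (Z \<omega>)) = expectation (\<lambda>\<omega>. f (Y \<omega>)) * expectation (\<lambda>\<omega>. g (Z \<omega>))"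
proof -
  have "indep_var borel (f \<circ> Y) borel (g \<circ> Z)" by (rule indep_var_compose[OF ind]) auto
  then have "indep_var borel (\<lambda>\<omega>. f (Y \<omega>)) borel (\<lambda>\<omega>. g (Z \<omega>))" by (simp add: comp_def)
  then show ?thesis by (rule indep_var_lebesgue_integral) (auto intro: bounded_rv_integrable assms)
qed

text \<open>
  By induction on the index set: the odd mixed terms vanish by independence and centring, and the
  only surviving mixed term \<open>6 E[W\<^sup>2] E[S\<^sup>2]\<close> of the fourth power is what the coefficient \<open>3\<close> of
  \<open>v\<^sup>2\<close> absorbs.
\<close>

lemma linear_combination_moments:
  fixes V :: "'k \<Rightarrow> 'a \<Rightarrow> real" and c :: "'k \<Rightarrow> real"
  assumes ind: "indep_vars (\<lambda>_. borel) V I" and fin: "finite I"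
    and bdd: "\<And>i. i \<in> I \<Longrightarrow> bounded_rv M (V i)"
    and mean: "\<And>i. i \<in> I \<Longrightarrow> expectation (V i) = 0"
    and second: "\<And>i. i \<in> I \<Longrightarrow> expectation (\<lambda>\<omega>. (V i \<omega>)\<^sup>2) = v"
    and fourth: "\<And>i. i \<in> I \<Longrightarrow> expectation (\<lambda>\<omega>. (V i \<omega>) ^ 4) = m"
  defines "S \<equiv> \<lambda>J \<omega>. \<Sum>i\<in>J. c i * V i \<omega>"
  shows "expectation (S I) = 0" (is ?A)
    and "expectation (\<lambda>\<omega>. (S I \<omega>)\<^sup>2) = (\<Sum>i\<in>I. (c i)\<^sup>2) * v" (is ?B)
    and "expectation (\<lambda>\<omega>. (S I \<omega>) ^ 4) \<le> (\<Sum>i\<in>I. (c i)\<^sup>2)\<^sup>2 * (m + 3 * v\<^sup>2)" (is ?C)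
proof -
  have m: "m \<ge> 0" if "i \<in> I" for i
  proof -
    have "m = expectation (\<lambda>\<omega>. (V i \<omega>) ^ 4)" using that by (simp add: fourth)
    then show ?thesis by simp
  qed
  have bS: "bounded_rv M (S J)" if "J \<subseteq> I" for J
    unfolding S_def using that bdd by (intro bounded_rv_intros) auto
  have "expectation (S J) = 0 \<and> expectation (\<lambda>\<omega>. (S J \<omega>)\<^sup>2) = (\<Sum>i\<in>J. (c i)\<^sup>2) * v \<and>
      expectation (\<lambda>\<omega>. (S J \<omega>) ^ 4) \<le> (\<Sum>i\<in>J. (c i)\<^sup>2)\<^sup>2 * (m + 3 * v\<^sup>2)" 
    if "finite J" "J \<subseteq> I" for J
    using that
  proof (induction J rule: finite_induct)
    case empty
    then show ?case by (simp add: S_def)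
  next
    case (insert i J)
    define q where "q = (\<Sum>i\<in>J. (c i)\<^sup>2)"
    have IH: "expectation (S J) = 0" "expectation (\<lambda>\<omega>. (S J \<omega>)\<^sup>2) = q * v"
        "expectation (\<lambda>\<omega>. (S J \<omega>) ^ 4) \<le> q\<^sup>2 * (m + 3 * v\<^sup>2)"
      using insert by (auto simp: q_def)
    have iI: "i \<in> I" and JI: "J \<subseteq> I" using insert by auto
    define W where "W \<omega> = c i * V i \<omega>" for \<omega>
    have bW: "bounded_rv M W" unfolding W_def using bdd[OF iI] by (intro bounded_rv_intros)
    note bJ = bS[OF JI]
    have "indep_vars (\<lambda>_. borel) (\<lambda>j \<omega>. c j * V j \<omega>) (insert i J)"
      by (rule indep_vars_compose2[OF indep_vars_subset[OF ind]]) (use iI JI in auto)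
    from indep_vars_sum[OF \<open>finite J\<close> \<open>i \<notin> J\<close> this]
    have ind': "indep_var borel W borel (S J)" by (simp add: W_def[abs_def] S_def)
    have mult: "expectation (\<lambda>\<omega>. W \<omega> ^ k * S J \<omega> ^ l) 
        = expectation (\<lambda>\<omega>. W \<omega> ^ k) * expectation (\<lambda>\<omega>. S J \<omega> ^ l)" for k l
      using expectation_indep_mult[OF ind' bW bJ, of "\<lambda>x. x ^ k" "\<lambda>x. x ^ l"] bW bJ
      by (simp add: bounded_rv_intros)
    have W_mom: "expectation (\<lambda>\<omega>. W \<omega> ^ k) = c i ^ k * expectation (\<lambda>\<omega>. V i \<omega> ^ k)" for k
      by (simp add: W_def power_mult_distrib)
    have S_ins: "S (insert i J) \<omega> = W \<omega> + S J \<omega>" for \<omega>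
      using insert by (simp add: S_def W_def)
    have int: "integrable M (\<lambda>\<omega>. W \<omega> ^ k * S J \<omega> ^ l)" for k l
      by (intro bounded_rv_integrable bounded_rv_intros bW bJ)
    have E1: "expectation (S (insert i J)) = 0"
    proof -
      have "expectation (S (insert i J)) = expectation (\<lambda>\<omega>. W \<omega> ^ 1 * S J \<omega> ^ 0 + W \<omega> ^ 0 * S J \<omega> ^ 1)"
        by (simp add: S_ins[abs_def])
      also have "\<dots> = expectation (\<lambda>\<omega>. W \<omega> ^ 1 * S J \<omega> ^ 0) + expectation (\<lambda>\<omega>. W \<omega> ^ 0 * S J \<omega> ^ 1)"
        by (rule Bochner_Integration.integral_add[OF int int])
      also have "\<dots> = 0" unfolding mult using IH W_mom[of 1] mean[OF iI] by simp
      finally show ?thesis .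
    qed
    have E2: "expectation (\<lambda>\<omega>. (S (insert i J) \<omega>)\<^sup>2) = ((c i)\<^sup>2 + q) * v"
    proof -
      have "expectation (\<lambda>\<omega>. (S (insert i J) \<omega>)\<^sup>2) = expectation (\<lambda>\<omega>. W \<omega> ^ 2 * S J \<omega> ^ 0 
          + 2 * (W \<omega> ^ 1 * S J \<omega> ^ 1) + W \<omega> ^ 0 * S J \<omega> ^ 2)"
        by (intro Bochner_Integration.integral_cong) (simp_all add: S_ins power2_sum)
      also have "\<dots> = expectation (\<lambda>\<omega>. W \<omega> ^ 2 * S J \<omega> ^ 0) + 2 * expectation (\<lambda>\<omega>. W \<omega> ^ 1 * S J \<omega> ^ 1)
          + expectation (\<lambda>\<omega>. W \<omega> ^ 0 * S J \<omega> ^ 2)"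
        by (simp only: Bochner_Integration.integral_add int integrable_mult_right integral_mult_right_zero
            Bochner_Integration.integrable_add)
      also have "\<dots> = ((c i)\<^sup>2 + q) * v" 
        unfolding mult W_mom using IH mean[OF iI] second[OF iI] by (simp add: algebra_simps prob_space)
      finally show ?thesis .
    qed
    have E4: "expectation (\<lambda>\<omega>. (S (insert i J) \<omega>) ^ 4) \<le> ((c i)\<^sup>2 + q)\<^sup>2 * (m + 3 * v\<^sup>2)"
    proof -
      have "expectation (\<lambda>\<omega>. (S (insert i J) \<omega>) ^ 4) = expectation (\<lambda>\<omega>. W \<omega> ^ 4 * S J \<omega> ^ 0 
          + 4 * (W \<omega> ^ 3 * S J \<omega> ^ 1) + 6 * (W \<omega> ^ 2 * S J \<omega> ^ 2) + 4 * (W \<omega> ^ 1 * S J \<omega> ^ 3) 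
          + W \<omega> ^ 0 * S J \<omega> ^ 4)"
        by (intro Bochner_Integration.integral_cong) 
           (simp_all add: S_ins power4_eq_xxxx power3_eq_cube power2_eq_square algebra_simps)
      also have "\<dots> = expectation (\<lambda>\<omega>. W \<omega> ^ 4 * S J \<omega> ^ 0) + 4 * expectation (\<lambda>\<omega>. W \<omega> ^ 3 * S J \<omega> ^ 1)
          + 6 * expectation (\<lambda>\<omega>. W \<omega> ^ 2 * S J \<omega> ^ 2) + 4 * expectation (\<lambda>\<omega>. W \<omega> ^ 1 * S J \<omega> ^ 3)
          + expectation (\<lambda>\<omega>. W \<omega> ^ 0 * S J \<omega> ^ 4)"
        by (simp only: Bochner_Integration.integral_add int integrable_mult_right integral_mult_right_zero
            Bochner_Integration.integrable_add)
      also have "\<dots> = c i ^ 4 * m + 6 * ((c i)\<^sup>2 * v * (q * v)) + expectation (\<lambda>\<omega>. (S J \<omega>) ^ 4)" 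
        unfolding mult W_mom using IH mean[OF iI] second[OF iI] fourth[OF iI] 
        by (simp add: prob_space)
      also have "\<dots> \<le> c i ^ 4 * m + 6 * ((c i)\<^sup>2 * v * (q * v)) + q\<^sup>2 * (m + 3 * v\<^sup>2)
          + (3 * c i ^ 4 * v\<^sup>2 + 2 * (c i)\<^sup>2 * q * m)"
      proof -
        have "0 \<le> q" by (simp add: q_def sum_nonneg)
        then have "0 \<le> 3 * c i ^ 4 * v\<^sup>2 + 2 * (c i)\<^sup>2 * q * m" using m[OF iI] by simp
        then show ?thesis using IH(3) by linarith
      qed
      also have "\<dots> = ((c i)\<^sup>2 + q)\<^sup>2 * (m + 3 * v\<^sup>2)"
        by (simp add: power4_eq_xxxx power2_eq_square algebra_simps)
      finally show ?thesis .
    qed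
    show ?case using E1 E2 E4 insert.hyps by (simp add: q_def)
  qed
  from this[OF fin order.refl] show ?A ?B ?C by auto
qed

end

section \<open>The Stein discrepancy\<close>

text \<open>
  The least such \<open>d\<close> is, for a centred law with variance \<open>\<sigma>\<^sup>2\<close>, \<open>\<sigma>\<^sup>2\<close> times the Wasserstein
  distance between the law and its zero-bias transform. The variance is kept as a factor instead
  of being normalised to \<open>1\<close>, since then the bound is cubic in scalings and linear combinations
  need no renormalisation.
\<close>

definition stein_bounded :: "real measure \<Rightarrow> real \<Rightarrow> bool" where
  "stein_bounded \<mu> d \<longleftrightarrow> (\<forall>f f' L. (\<forall>t. (f has_real_derivative f' t) (at t)) \<longrightarrow> L-lipschitz_on UNIV f' \<longrightarrow>
     \<bar>(\<integral>x. x * f x \<partial>\<mu>) - (\<integral>x. x\<^sup>2 \<partial>\<mu>) * (\<integral>x. f' x \<partial>\<mu>)\<bar> \<le> L * d)"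

lemma (in prob_space) stein_bounded_distr_iff:
  assumes [measurable]: "Z \<in> borel_measurable M"
  shows "stein_bounded (distr M borel Z) d \<longleftrightarrow> 
    (\<forall>f f' L. (\<forall>t. (f has_real_derivative f' t) (at t)) \<longrightarrow> L-lipschitz_on UNIV f' \<longrightarrow>
     \<bar>expectation (\<lambda>\<omega>. Z \<omega> * f (Z \<omega>)) - expectation (\<lambda>\<omega>. (Z \<omega>)\<^sup>2) * expectation (\<lambda>\<omega>. f' (Z \<omega>))\<bar> \<le> L * d)"
proof -
  have "(\<integral>x. x * f x \<partial>distr M borel Z) = expectation (\<lambda>\<omega>. Z \<omega> * f (Z \<omega>)) \<and>
      (\<integral>x. f' x \<partial>distr M borel Z) = expectation (\<lambda>\<omega>. f' (Z \<omega>))"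
    if f: "\<forall>t. (f has_real_derivative f' t) (at t)" and f': "L-lipschitz_on UNIV f'" for f f' L
  proof -
    have [measurable]: "f' \<in> borel_measurable borel" "f \<in> borel_measurable borel"
      using f by (intro borel_measurable_continuous_onI lipschitz_on_continuous_on[OF f'],
          intro borel_measurable_continuous_onI DERIV_continuous_on) (auto intro: has_field_derivative_at_within)
    show ?thesis by (simp add: integral_distr)
  qed
  moreover have "(\<integral>x. x\<^sup>2 \<partial>distr M borel Z) = expectation (\<lambda>\<omega>. (Z \<omega>)\<^sup>2)" by (simp add: integral_distr)
  ultimately show ?thesis unfolding stein_bounded_def by (intro iff_allI imp_cong refl) auto
qed

lemma lipschitz_deriv_continuous:
  assumes "\<And>t. (f has_real_derivative f' t) (at t)" "L-lipschitz_on UNIV (f' :: real \<Rightarrow> real)"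
  shows "continuous_on UNIV f" "continuous_on UNIV f'"
proof -
  show "continuous_on UNIV f"
    by (rule DERIV_continuous_on) (use assms(1) in \<open>auto intro: has_field_derivative_at_within\<close>)
  show "continuous_on UNIV f'" by (rule lipschitz_on_continuous_on[OF assms(2)])
qed

text \<open>
  Adding an affine function to \<open>f\<close> does not change the discrepancy of a centred variable, so \<open>f\<close>
  can be taken to vanish to first order at \<open>0\<close>. It then grows quadratically, and differences of
  \<open>x f(x)\<close> are controlled by third powers.
\<close>

lemma normalized_growth:
  assumes f: "\<And>t. (f has_real_derivative f' t) (at t)" and f': "L-lipschitz_on UNIV f'"
    and 0: "f 0 = (0::real)" "f' 0 = (0::real)"
  shows "\<bar>f' x\<bar> \<le> L * \<bar>x\<bar>" and "\<bar>f x\<bar> \<le> L * x\<^sup>2"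
    and "\<bar>x * f x - y * f y\<bar> \<le> 2 * L * \<bar>x - y\<bar> * (x\<^sup>2 + y\<^sup>2)"
proof -
  have L: "L \<ge> 0" by (rule lipschitz_on_nonneg[OF f'])
  have A: "\<bar>f' x\<bar> \<le> L * \<bar>x\<bar>" for x
    using lipschitz_onD[OF f', of x 0] 0 by (simp add: dist_real_def)
  have B: "\<bar>f x\<bar> \<le> L * x\<^sup>2" for x
  proof -
    have "norm (f x - f 0) \<le> L * \<bar>x\<bar> * norm (x - 0)"
    proof (rule field_differentiable_bound)
      show "convex (closed_segment 0 x)" by simp
      show "(f has_real_derivative f' z) (at z within closed_segment 0 x)" for z
        using f by (rule has_field_derivative_at_within)
      show "norm (f' z) \<le> L * \<bar>x\<bar>" if "z \<in> closed_segment 0 x" for z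
      proof -
        have "\<bar>z\<bar> \<le> \<bar>x\<bar>" using that by (auto simp: closed_segment_eq_real_ivl split: if_splits)
        then show ?thesis using A[of z] L by (smt (verit) mult_left_mono real_norm_def)
      qed
    qed auto
    then show ?thesis using 0 by (simp add: power2_eq_square mult.assoc)
  qed
  show "\<bar>f' x\<bar> \<le> L * \<bar>x\<bar>" "\<bar>f x\<bar> \<le> L * x\<^sup>2" by (fact A B)+
  have "norm (x * f x - y * f y) \<le> 2 * L * (x\<^sup>2 + y\<^sup>2) * norm (x - y)"
  proof (rule field_differentiable_bound)
    show "convex (closed_segment y x)" by simp
    show "((\<lambda>t. t * f t) has_real_derivative (f z + z * f' z)) (at z within closed_segment y x)" for z
      by (rule has_field_derivative_at_within) (auto intro!: derivative_eq_intros f)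
    show "norm (f z + z * f' z) \<le> 2 * L * (x\<^sup>2 + y\<^sup>2)" if "z \<in> closed_segment y x" for z
    proof -
      have "\<bar>z\<bar> \<le> max \<bar>x\<bar> \<bar>y\<bar>" using that by (auto simp: closed_segment_eq_real_ivl split: if_splits)
      then have "z\<^sup>2 \<le> (max \<bar>x\<bar> \<bar>y\<bar>)\<^sup>2" by (metis abs_ge_zero power2_abs power_mono)
      also have "\<dots> \<le> x\<^sup>2 + y\<^sup>2" by (auto simp: max_def)
      finally have z: "z\<^sup>2 \<le> x\<^sup>2 + y\<^sup>2" .
      have "\<bar>f z + z * f' z\<bar> \<le> \<bar>f z\<bar> + \<bar>z\<bar> * \<bar>f' z\<bar>" by (metis abs_triangle_ineq abs_mult)
      also have "\<dots> \<le> L * z\<^sup>2 + \<bar>z\<bar> * (L * \<bar>z\<bar>)" using A[of z] B[of z] by (intro add_mono mult_left_mono) auto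
      also have "\<dots> = 2 * L * z\<^sup>2" by (simp add: power2_eq_square)
      also have "\<dots> \<le> 2 * L * (x\<^sup>2 + y\<^sup>2)" using z L by (intro mult_left_mono) auto
      finally show ?thesis by simp
    qed
  qed auto
  then show "\<bar>x * f x - y * f y\<bar> \<le> 2 * L * \<bar>x - y\<bar> * (x\<^sup>2 + y\<^sup>2)" by (simp only: real_norm_def mult_ac)
qed

context prob_space
begin

lemma stein_bounded_normalizedI:
  assumes Z: "bounded_rv M Z" "expectation Z = 0"
    and *: "\<And>f f' L. (\<And>t. (f has_real_derivative f' t) (at t)) \<Longrightarrow> L-lipschitz_on UNIV f' \<Longrightarrow> 
      f 0 = 0 \<Longrightarrow> f' 0 = 0 \<Longrightarrow>
      \<bar>expectation (\<lambda>\<omega>. Z \<omega> * f (Z \<omega>)) - expectation (\<lambda>\<omega>. (Z \<omega>)\<^sup>2) * expectation (\<lambda>\<omega>. f' (Z \<omega>))\<bar> \<le> L * d"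
  shows "stein_bounded (distr M borel Z) d"
  unfolding stein_bounded_distr_iff[OF bounded_rv_measurable[OF Z(1)]]
proof (intro allI impI)
  fix f f' L 
  assume f: "\<forall>t. (f has_real_derivative f' t) (at t)" and f': "L-lipschitz_on UNIV f'"
  \<comment> \<open>Subtracting the constant uses \<open>E Z = 0\<close>; subtracting the multiple of \<open>t\<close> changes both terms by its slope times \<open>E Z\<^sup>2\<close>.\<close>
  define f0 where "f0 t = f t - f 0 - f' 0 * t" for t
  define f0' where "f0' t = f' t - f' 0" for t
  have f0: "(f0 has_real_derivative f0' t) (at t)" for t
    unfolding f0_def f0'_def by (auto intro!: derivative_eq_intros f[rule_format])
  have f0': "L-lipschitz_on UNIV f0'"
    using f' unfolding f0'_def lipschitz_on_def by (simp add: dist_real_def)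
  note cont = lipschitz_deriv_continuous[OF f[rule_format] f']
  note int = bounded_rv_integrable bounded_rv_intros Z(1) bounded_rv_compose[OF Z(1) cont(1)] 
    bounded_rv_compose[OF Z(1) cont(2)]
  have "expectation (\<lambda>\<omega>. Z \<omega> * f0 (Z \<omega>)) 
      = expectation (\<lambda>\<omega>. Z \<omega> * f (Z \<omega>) - f 0 * Z \<omega> - f' 0 * (Z \<omega>)\<^sup>2)"
    by (simp add: f0_def algebra_simps power2_eq_square)
  also have "\<dots> = expectation (\<lambda>\<omega>. Z \<omega> * f (Z \<omega>)) - f' 0 * expectation (\<lambda>\<omega>. (Z \<omega>)\<^sup>2)"
    by (subst Bochner_Integration.integral_diff, (intro int)+)+ (simp add: Z(2))
  finally have 1: "expectation (\<lambda>\<omega>. Z \<omega> * f0 (Z \<omega>)) 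
      = expectation (\<lambda>\<omega>. Z \<omega> * f (Z \<omega>)) - f' 0 * expectation (\<lambda>\<omega>. (Z \<omega>)\<^sup>2)" .
  have 2: "expectation (\<lambda>\<omega>. f0' (Z \<omega>)) = expectation (\<lambda>\<omega>. f' (Z \<omega>)) - f' 0"
    unfolding f0'_def by (subst Bochner_Integration.integral_diff, (intro int)+) (simp add: prob_space)
  have "\<bar>expectation (\<lambda>\<omega>. Z \<omega> * f0 (Z \<omega>)) - expectation (\<lambda>\<omega>. (Z \<omega>)\<^sup>2) * expectation (\<lambda>\<omega>. f0' (Z \<omega>))\<bar> \<le> L * d"
    by (rule *[OF f0 f0']) (simp_all add: f0_def f0'_def)
  then show "\<bar>expectation (\<lambda>\<omega>. Z \<omega> * f (Z \<omega>)) - expectation (\<lambda>\<omega>. (Z \<omega>)\<^sup>2) * expectation (\<lambda>\<omega>. f' (Z \<omega>))\<bar> \<le> L * d"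
    unfolding 1 2 by (simp add: algebra_simps)
qed

text \<open>
  Each difference that occurs is bounded by a product of one factor \<open>Z - S\<close> and two factors \<open>Z\<close>
  or \<open>S\<close>. The arithmetic-geometric mean inequality splits them into \<open>(Z - S)\<^sup>2\<close> and fourth powers,
  which are of the same order in the application, where \<open>Z - S\<close> is quadratic.
\<close>

lemma stein_bounded_perturbation:
  assumes S: "bounded_rv M S" "expectation S = 0" and Z: "bounded_rv M Z" "expectation Z = 0"
    and d: "stein_bounded (distr M borel S) d"
    and A: "expectation (\<lambda>\<omega>. (Z \<omega> - S \<omega>)\<^sup>2) \<le> A" "expectation (\<lambda>\<omega>. Z \<omega> ^ 4) \<le> A"
      "expectation (\<lambda>\<omega>. S \<omega> ^ 4) \<le> A"
  shows "stein_bounded (distr M borel Z) (d + 10 * A)"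
proof (rule stein_bounded_normalizedI[OF Z])
  fix f f' L 
  assume f: "\<And>t. (f has_real_derivative f' t) (at t)" and f': "L-lipschitz_on UNIV f'"
    and zero: "f 0 = 0" "f' 0 = 0"
  have L: "L \<ge> 0" by (rule lipschitz_on_nonneg[OF f'])
  note growth = normalized_growth[OF f f' zero]
  note cont = lipschitz_deriv_continuous[OF f f']
  note bdd = bounded_rv_intros Z(1) S(1) bounded_rv_compose[OF Z(1) cont(1)] 
    bounded_rv_compose[OF Z(1) cont(2)] bounded_rv_compose[OF S(1) cont(1)] 
    bounded_rv_compose[OF S(1) cont(2)]
  note int = bounded_rv_integrable
  define z where "z = expectation (\<lambda>\<omega>. (Z \<omega>)\<^sup>2)"
  define s where "s = expectation (\<lambda>\<omega>. (S \<omega>)\<^sup>2)"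
  define r where "r = expectation (\<lambda>\<omega>. \<bar>Z \<omega> - S \<omega>\<bar>)"
  define e where "e = expectation (\<lambda>\<omega>. \<bar>Z \<omega>\<bar>)"
  have nonneg: "z \<ge> 0" "s \<ge> 0" "r \<ge> 0" "e \<ge> 0"
    by (simp_all add: z_def s_def r_def e_def)
  have zA: "z\<^sup>2 \<le> A" 
    using square_expectation_le[of "\<lambda>\<omega>. (Z \<omega>)\<^sup>2"] A(2) by (auto simp: z_def bdd simp flip: power_mult)
  have sA: "s\<^sup>2 \<le> A" 
    using square_expectation_le[of "\<lambda>\<omega>. (S \<omega>)\<^sup>2"] A(3) by (auto simp: s_def bdd simp flip: power_mult)
  have rA: "r\<^sup>2 \<le> A" 
    using square_expectation_le[of "\<lambda>\<omega>. \<bar>Z \<omega> - S \<omega>\<bar>"] A(1) by (auto simp: r_def bdd)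
  have e2: "e\<^sup>2 \<le> z"
    using square_expectation_le[of "\<lambda>\<omega>. \<bar>Z \<omega>\<bar>"] by (auto simp: e_def z_def bdd)
  have amgm: "a * b \<le> (a\<^sup>2 + b\<^sup>2) / 2" for a b :: real
    using sum_squares_bound[of a b] by simp
  have A0: "A \<ge> 0" using zA by (smt (verit) zero_le_power2)
  have 1: "\<bar>expectation (\<lambda>\<omega>. Z \<omega> * f (Z \<omega>)) - expectation (\<lambda>\<omega>. S \<omega> * f (S \<omega>))\<bar> \<le> L * (5 * A)"
  proof -
    have "\<bar>expectation (\<lambda>\<omega>. Z \<omega> * f (Z \<omega>)) - expectation (\<lambda>\<omega>. S \<omega> * f (S \<omega>))\<bar>
        = \<bar>expectation (\<lambda>\<omega>. Z \<omega> * f (Z \<omega>) - S \<omega> * f (S \<omega>))\<bar>"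
      by (subst Bochner_Integration.integral_diff, (intro int bdd)+) simp
    also have "\<dots> \<le> expectation (\<lambda>\<omega>. \<bar>Z \<omega> * f (Z \<omega>) - S \<omega> * f (S \<omega>)\<bar>)"
      by (rule integral_abs_bound)
    also have "\<dots> \<le> expectation (\<lambda>\<omega>. L * ((Z \<omega> - S \<omega>)\<^sup>2 + 2 * Z \<omega> ^ 4 + 2 * S \<omega> ^ 4))"
    proof (rule integral_mono)
      fix \<omega>
      let ?q = "(Z \<omega>)\<^sup>2 + (S \<omega>)\<^sup>2"
      have "\<bar>Z \<omega> * f (Z \<omega>) - S \<omega> * f (S \<omega>)\<bar> \<le> L * (2 * (\<bar>Z \<omega> - S \<omega>\<bar> * ?q))"
        using growth(3)[of "Z \<omega>" "S \<omega>"] by (simp add: mult_ac)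
      also have "2 * (\<bar>Z \<omega> - S \<omega>\<bar> * ?q) \<le> (Z \<omega> - S \<omega>)\<^sup>2 + ?q\<^sup>2"
        using amgm[of "\<bar>Z \<omega> - S \<omega>\<bar>" ?q] by simp
      also have "?q\<^sup>2 \<le> 2 * Z \<omega> ^ 4 + 2 * S \<omega> ^ 4"
        using amgm[of "(Z \<omega>)\<^sup>2" "(S \<omega>)\<^sup>2"] by (simp add: power2_sum flip: power_mult)
      finally show "\<bar>Z \<omega> * f (Z \<omega>) - S \<omega> * f (S \<omega>)\<bar> \<le> L * ((Z \<omega> - S \<omega>)\<^sup>2 + 2 * Z \<omega> ^ 4 + 2 * S \<omega> ^ 4)"
        using L by (simp add: mult_left_mono add.assoc)
    qed (intro int bdd)+
    also have "\<dots> = L * (expectation (\<lambda>\<omega>. (Z \<omega> - S \<omega>)\<^sup>2) + 2 * expectation (\<lambda>\<omega>. Z \<omega> ^ 4) 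
        + 2 * expectation (\<lambda>\<omega>. S \<omega> ^ 4))"
      by (simp add: int bdd)
    also have "\<dots> \<le> L * (5 * A)" using A L by (intro mult_left_mono) auto
    finally show ?thesis .
  qed
  \<comment> \<open>The factor \<open>e = E \<bar>Z\<bar>\<close> is moved inside the expectation, so that all terms become second order in \<open>Z - S\<close> or fourth order.\<close>
  have zs: "\<bar>z - s\<bar> * e \<le> 3 * A"
  proof -
    have "\<bar>z - s\<bar> = \<bar>expectation (\<lambda>\<omega>. (Z \<omega>)\<^sup>2 - (S \<omega>)\<^sup>2)\<bar>"
      unfolding z_def s_def by (subst Bochner_Integration.integral_diff, (intro int bdd)+) simp
    also have "\<dots> \<le> expectation (\<lambda>\<omega>. \<bar>(Z \<omega>)\<^sup>2 - (S \<omega>)\<^sup>2\<bar>)" by (rule integral_abs_bound)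
    finally have "\<bar>z - s\<bar> * e \<le> e * expectation (\<lambda>\<omega>. \<bar>(Z \<omega>)\<^sup>2 - (S \<omega>)\<^sup>2\<bar>)"
      using nonneg by (simp add: mult_left_mono mult.commute)
    also have "\<dots> = expectation (\<lambda>\<omega>. e * \<bar>(Z \<omega>)\<^sup>2 - (S \<omega>)\<^sup>2\<bar>)" by simp
    also have "\<dots> \<le> expectation (\<lambda>\<omega>. (Z \<omega> - S \<omega>)\<^sup>2 / 2 + e\<^sup>2 * ((Z \<omega>)\<^sup>2 + (S \<omega>)\<^sup>2))"
    proof (rule integral_mono)
      fix \<omega>
      have "e * \<bar>(Z \<omega>)\<^sup>2 - (S \<omega>)\<^sup>2\<bar> = \<bar>Z \<omega> - S \<omega>\<bar> * (e * \<bar>Z \<omega> + S \<omega>\<bar>)"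
        by (simp add: power2_eq_square square_diff_square_factored abs_mult mult_ac)
      also have "\<dots> \<le> ((Z \<omega> - S \<omega>)\<^sup>2 + e\<^sup>2 * (Z \<omega> + S \<omega>)\<^sup>2) / 2"
        using amgm[of "\<bar>Z \<omega> - S \<omega>\<bar>" "e * \<bar>Z \<omega> + S \<omega>\<bar>"] by (simp add: power_mult_distrib)
      also have "\<dots> \<le> ((Z \<omega> - S \<omega>)\<^sup>2 + e\<^sup>2 * (2 * ((Z \<omega>)\<^sup>2 + (S \<omega>)\<^sup>2))) / 2"
        using amgm[of "Z \<omega>" "S \<omega>"] 
        by (intro divide_right_mono add_left_mono mult_left_mono) (auto simp: power2_sum)
      finally show "e * \<bar>(Z \<omega>)\<^sup>2 - (S \<omega>)\<^sup>2\<bar> \<le> (Z \<omega> - S \<omega>)\<^sup>2 / 2 + e\<^sup>2 * ((Z \<omega>)\<^sup>2 + (S \<omega>)\<^sup>2)"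
        by (simp add: field_simps)
    qed (intro int bdd)+
    also have "\<dots> = expectation (\<lambda>\<omega>. (Z \<omega> - S \<omega>)\<^sup>2) / 2 + e\<^sup>2 * (z + s)"
      unfolding z_def s_def by (simp add: int bdd)
    also have "\<dots> \<le> A / 2 + z * (z + s)" using A(1) e2 nonneg by (intro add_mono mult_right_mono) auto
    also have "\<dots> \<le> 3 * A" using zA sA amgm[of z s] A0 by (simp add: power2_eq_square algebra_simps)
    finally show ?thesis .
  qed
  have 2: "\<bar>z * expectation (\<lambda>\<omega>. f' (Z \<omega>)) - s * expectation (\<lambda>\<omega>. f' (S \<omega>))\<bar> \<le> L * (4 * A)"
  proof -
    have a: "\<bar>expectation (\<lambda>\<omega>. f' (Z \<omega>))\<bar> \<le> L * e"
    proof -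
      have "\<bar>expectation (\<lambda>\<omega>. f' (Z \<omega>))\<bar> \<le> expectation (\<lambda>\<omega>. \<bar>f' (Z \<omega>)\<bar>)" by (rule integral_abs_bound)
      also have "\<dots> \<le> expectation (\<lambda>\<omega>. L * \<bar>Z \<omega>\<bar>)" using growth(1) by (intro integral_mono int bdd)
      finally show ?thesis by (simp add: e_def)
    qed
    have b: "\<bar>expectation (\<lambda>\<omega>. f' (Z \<omega>)) - expectation (\<lambda>\<omega>. f' (S \<omega>))\<bar> \<le> L * r"
    proof -
      have "\<bar>expectation (\<lambda>\<omega>. f' (Z \<omega>)) - expectation (\<lambda>\<omega>. f' (S \<omega>))\<bar> = \<bar>expectation (\<lambda>\<omega>. f' (Z \<omega>) - f' (S \<omega>))\<bar>"
        by (subst Bochner_Integration.integral_diff, (intro int bdd)+) simp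
      also have "\<dots> \<le> expectation (\<lambda>\<omega>. \<bar>f' (Z \<omega>) - f' (S \<omega>)\<bar>)" by (rule integral_abs_bound)
      also have "\<dots> \<le> expectation (\<lambda>\<omega>. L * \<bar>Z \<omega> - S \<omega>\<bar>)" 
        using lipschitz_onD[OF f'] by (intro integral_mono int bdd) (auto simp: dist_real_def)
      finally show ?thesis by (simp add: r_def)
    qed
    have "z * expectation (\<lambda>\<omega>. f' (Z \<omega>)) - s * expectation (\<lambda>\<omega>. f' (S \<omega>)) 
        = (z - s) * expectation (\<lambda>\<omega>. f' (Z \<omega>)) + s * (expectation (\<lambda>\<omega>. f' (Z \<omega>)) - expectation (\<lambda>\<omega>. f' (S \<omega>)))"
      by (simp add: algebra_simps)
    also have "\<bar>\<dots>\<bar> \<le> \<bar>z - s\<bar> * \<bar>expectation (\<lambda>\<omega>. f' (Z \<omega>))\<bar> 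
        + s * \<bar>expectation (\<lambda>\<omega>. f' (Z \<omega>)) - expectation (\<lambda>\<omega>. f' (S \<omega>))\<bar>"
      by (rule order.trans[OF abs_triangle_ineq]) (simp add: abs_mult nonneg)
    also have "\<dots> \<le> \<bar>z - s\<bar> * (L * e) + s * (L * r)"
      using a b nonneg by (intro add_mono mult_left_mono) auto
    also have "\<dots> = L * (\<bar>z - s\<bar> * e + s * r)" by (simp add: algebra_simps)
    also have "\<dots> \<le> L * (4 * A)" using zs amgm[of s r] sA rA L by (intro mult_left_mono) auto
    finally show ?thesis .
  qed
  have 3: "\<bar>expectation (\<lambda>\<omega>. S \<omega> * f (S \<omega>)) - s * expectation (\<lambda>\<omega>. f' (S \<omega>))\<bar> \<le> L * d"
    using d f f' unfolding stein_bounded_distr_iff[OF bounded_rv_measurable[OF S(1)]] s_def by blast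
  have "\<bar>expectation (\<lambda>\<omega>. Z \<omega> * f (Z \<omega>)) - z * expectation (\<lambda>\<omega>. f' (Z \<omega>))\<bar> \<le> L * (5 * A) + L * (4 * A) + L * d"
    using 1 2 3 by linarith
  also have "\<dots> \<le> L * (d + 10 * A)" using L A0 by (simp add: distrib_left mult_nonneg_nonneg)
  finally show "\<bar>expectation (\<lambda>\<omega>. Z \<omega> * f (Z \<omega>)) - expectation (\<lambda>\<omega>. (Z \<omega>)\<^sup>2) * expectation (\<lambda>\<omega>. f' (Z \<omega>))\<bar> 
      \<le> L * (d + 10 * A)" by (simp add: z_def)
qed

text \<open>
  The zero variable has discrepancy \<open>0\<close>, and any bounded centred variable is a perturbation of
  it.
\<close>

lemma stein_bounded_exists:
  assumes Z: "bounded_rv M Z" "expectation Z = 0"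
  shows "\<exists>d\<ge>0. stein_bounded (distr M borel Z) d"
proof -
  define A where "A = expectation (\<lambda>\<omega>. (Z \<omega>)\<^sup>2) + expectation (\<lambda>\<omega>. Z \<omega> ^ 4)"
  have pos: "expectation (\<lambda>\<omega>. (Z \<omega>)\<^sup>2) \<ge> 0" "expectation (\<lambda>\<omega>. Z \<omega> ^ 4) \<ge> 0" by auto
  have "stein_bounded (distr M borel (\<lambda>_. 0)) 0"
    by (subst stein_bounded_distr_iff) auto
  then have "stein_bounded (distr M borel Z) (0 + 10 * A)"
    by (intro stein_bounded_perturbation[OF bounded_rv_const _ Z]) (use pos in \<open>auto simp: A_def\<close>)
  then show ?thesis using pos by (intro exI[of _ "10 * A"]) (auto simp: A_def)
qed

end

context prob_space
begin

text \<open>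
  Write \<open>S = c\<^sub>i V\<^sub>i + T\<close> with \<open>T\<close> independent of \<open>V\<^sub>i\<close>. For fixed \<open>t\<close> the function
  \<open>x \<mapsto> f(c\<^sub>i x + t)\<close> has derivative Lipschitz with constant \<open>c\<^sub>i\<^sup>2 L\<close>, so \<open>E[V\<^sub>i f(S)]\<close> differs
  from \<open>c\<^sub>i v E[f'(S)]\<close> by at most \<open>c\<^sub>i\<^sup>2 L d\<close>. The outer factor \<open>c\<^sub>i\<close> in
  \<open>S f(S) = \<Sum> c\<^sub>i V\<^sub>i f(S)\<close> turns the square into a cube.
\<close>

lemma stein_bounded_linear_combination:
  fixes V :: "'k::finite \<Rightarrow> 'a \<Rightarrow> real" and c :: "'k \<Rightarrow> real"
  assumes ind: "indep_vars (\<lambda>_. borel) V UNIV"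
    and bdd: "\<And>i. bounded_rv M (V i)" and mean: "\<And>i. expectation (V i) = 0"
    and law: "\<And>i. distr M borel (V i) = \<mu>"
    and d: "stein_bounded \<mu> d"
  shows "stein_bounded (distr M borel (\<lambda>\<omega>. \<Sum>i\<in>UNIV. c i * V i \<omega>)) ((\<Sum>i\<in>UNIV. \<bar>c i\<bar> ^ 3) * d)"
proof -
  define S where "S \<omega> = (\<Sum>i\<in>UNIV. c i * V i \<omega>)" for \<omega>
  define v where "v = (\<integral>x. x\<^sup>2 \<partial>\<mu>)"
  have [measurable]: "V i \<in> borel_measurable M" for i using bdd by (simp add: bounded_rv_measurable)
  have bS: "bounded_rv M S" unfolding S_def by (intro bounded_rv_intros bdd)
  note [measurable] = bounded_rv_measurable[OF bS]
  have via_\<mu>: "expectation (\<lambda>\<omega>. g (V i \<omega>)) = (\<integral>x. g x \<partial>\<mu>)" if "g \<in> borel_measurable borel" for g :: "real \<Rightarrow> real" and i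
    using that unfolding law[symmetric, of i] by (simp add: integral_distr)
  have second: "expectation (\<lambda>\<omega>. (V i \<omega>)\<^sup>2) = v" for i unfolding v_def by (rule via_\<mu>) simp
  have fourth: "expectation (\<lambda>\<omega>. (V i \<omega>) ^ 4) = (\<integral>x. x ^ 4 \<partial>\<mu>)" for i by (rule via_\<mu>) simp
  have S2: "expectation (\<lambda>\<omega>. (S \<omega>)\<^sup>2) = (\<Sum>i\<in>UNIV. (c i)\<^sup>2) * v"
    unfolding S_def using linear_combination_moments(2)[OF ind _ bdd mean second fourth] by simp
  show ?thesis
    unfolding S_def[abs_def, symmetric] stein_bounded_distr_iff[OF bounded_rv_measurable[OF bS]]
  proof (intro allI impI)
    fix f f' L 
    assume f: "\<forall>t. (f has_real_derivative f' t) (at t)" and f': "L-lipschitz_on UNIV f'"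
    note cont = lipschitz_deriv_continuous[OF f[rule_format] f']
    have [measurable]: "f \<in> borel_measurable borel" "f' \<in> borel_measurable borel"
      using cont by (auto intro: borel_measurable_continuous_onI)
    have single: "\<bar>expectation (\<lambda>\<omega>. V i \<omega> * f (S \<omega>)) - c i * v * expectation (\<lambda>\<omega>. f' (S \<omega>))\<bar> \<le> (c i)\<^sup>2 * L * d" for i
    proof -
      define T where "T \<omega> = (\<Sum>j\<in>UNIV - {i}. c j * V j \<omega>)" for \<omega>
      have bT: "bounded_rv M T" unfolding T_def by (intro bounded_rv_intros bdd)
      note [measurable] = bounded_rv_measurable[OF bT]
      have "indep_vars (\<lambda>_. borel) (\<lambda>j \<omega>. (if j = i then V j \<omega> else c j * V j \<omega>)) (insert i (UNIV - {i}))"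
        by (rule indep_vars_compose2[OF indep_vars_subset[OF ind], of _ "\<lambda>j x. if j = i then x else c j * x"]) auto
      from indep_vars_sum[OF _ _ this]
      have "indep_var borel (V i) borel (\<lambda>\<omega>. \<Sum>j\<in>UNIV - {i}. (if j = i then V j \<omega> else c j * V j \<omega>))"
        by simp
      also have "(\<lambda>\<omega>. \<Sum>j\<in>UNIV - {i}. (if j = i then V j \<omega> else c j * V j \<omega>)) = T"
        unfolding T_def by (intro ext sum.cong) auto
      finally have "distr M borel (V i) \<Otimes>\<^sub>M distr M borel T = distr M (borel \<Otimes>\<^sub>M borel) (\<lambda>\<omega>. (V i \<omega>, T \<omega>))"
        unfolding indep_var_distribution_eq by blast
      then have prod: "\<mu> \<Otimes>\<^sub>M distr M borel T = distr M (borel \<Otimes>\<^sub>M borel) (\<lambda>\<omega>. (V i \<omega>, T \<omega>))"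
        by (simp add: law)
      interpret \<mu>: prob_space \<mu> using prob_space_distr[of "V i" borel] law by simp
      interpret \<nu>: prob_space "distr M borel T" by (rule prob_space_distr) simp
      interpret P: pair_prob_space \<mu> "distr M borel T" ..
      have sets_\<mu> [measurable_cong, simp]: "sets \<mu> = sets borel" using law[of i] by auto
      have S_eq: "S \<omega> = c i * V i \<omega> + T \<omega>" for \<omega>
        unfolding S_def T_def by (rule sum.remove) auto
      define \<Phi> where "\<Phi> x t = x * f (c i * x + t) - c i * v * f' (c i * x + t)" for x t
      have \<Phi>_meas [measurable]: "case_prod \<Phi> \<in> borel_measurable (borel \<Otimes>\<^sub>M borel)"
        unfolding \<Phi>_def by measurable
      note bfS = bounded_rv_compose[OF bS cont(1)] bounded_rv_compose[OF bS cont(2)]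
      have b\<Phi>: "bounded_rv M (\<lambda>\<omega>. \<Phi> (V i \<omega>) (T \<omega>))"
        unfolding \<Phi>_def S_eq[symmetric] by (intro bounded_rv_intros bdd bfS)
      have int: "integrable (\<mu> \<Otimes>\<^sub>M distr M borel T) (case_prod \<Phi>)"
        unfolding prod using bounded_rv_integrable[OF b\<Phi>] by (subst integrable_distr_eq) auto
      have "expectation (\<lambda>\<omega>. V i \<omega> * f (S \<omega>)) - c i * v * expectation (\<lambda>\<omega>. f' (S \<omega>))
          = expectation (\<lambda>\<omega>. \<Phi> (V i \<omega>) (T \<omega>))"
        unfolding \<Phi>_def S_eq[symmetric]
        by (subst Bochner_Integration.integral_diff, (intro bounded_rv_integrable bounded_rv_intros bdd bfS)+) simp
      also have "\<dots> = integral\<^sup>L (\<mu> \<Otimes>\<^sub>M distr M borel T) (case_prod \<Phi>)"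
        unfolding prod by (subst integral_distr) auto
      also have "\<dots> = (\<integral>t. (\<integral>x. \<Phi> x t \<partial>\<mu>) \<partial>distr M borel T)"
        using P.integral_snd[OF int] by simp
      finally have eq: "expectation (\<lambda>\<omega>. V i \<omega> * f (S \<omega>)) - c i * v * expectation (\<lambda>\<omega>. f' (S \<omega>))
          = (\<integral>t. (\<integral>x. \<Phi> x t \<partial>\<mu>) \<partial>distr M borel T)" .
      have inner: "\<bar>\<integral>x. \<Phi> x t \<partial>\<mu>\<bar> \<le> (c i)\<^sup>2 * L * d" for t
      proof -
        define g where "g x = f (c i * x + t)" for x
        define g' where "g' x = c i * f' (c i * x + t)" for x
        have g: "(g has_real_derivative g' x) (at x)" for x
        proof -
          have "((\<lambda>x. f (c i * x + t)) has_real_derivative f' (c i * x + t) * c i) (at x)"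
            by (rule DERIV_chain2[where f = f and g = "\<lambda>x. c i * x + t"]) 
               (auto intro!: derivative_eq_intros f[rule_format])
          then show ?thesis by (simp add: g_def[abs_def] g'_def mult.commute)
        qed
        have g': "((c i)\<^sup>2 * L)-lipschitz_on UNIV g'"
        proof (rule lipschitz_onI)
          fix x y
          have "dist (g' x) (g' y) = \<bar>c i\<bar> * dist (f' (c i * x + t)) (f' (c i * y + t))"
            by (simp add: g'_def dist_real_def flip: right_diff_distrib abs_mult)
          also have "\<dots> \<le> \<bar>c i\<bar> * (L * dist (c i * x + t) (c i * y + t))"
            by (intro mult_left_mono lipschitz_onD[OF f']) auto
          also have "dist (c i * x + t) (c i * y + t) = \<bar>c i\<bar> * dist x y"
            by (simp add: dist_real_def flip: right_diff_distrib abs_mult)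
          finally show "dist (g' x) (g' y) \<le> (c i)\<^sup>2 * L * dist x y"
            by (simp add: power2_eq_square mult_ac flip: abs_mult)
        qed (use lipschitz_on_nonneg[OF f'] in simp)
        note gcont = lipschitz_deriv_continuous[OF g g']
        have bx: "bounded_rv \<mu> (\<lambda>x. x)"
          unfolding law[symmetric, of i] using bdd by (subst bounded_rv_distr_iff) auto
        have "(\<integral>x. \<Phi> x t \<partial>\<mu>) = (\<integral>x. x * g x - v * g' x \<partial>\<mu>)"
          by (simp add: \<Phi>_def g_def g'_def mult_ac)
        also have "\<dots> = (\<integral>x. x * g x \<partial>\<mu>) - v * (\<integral>x. g' x \<partial>\<mu>)"
          by (subst Bochner_Integration.integral_diff, (intro \<mu>.bounded_rv_integrable bounded_rv_intros bx 
            bounded_rv_compose[OF bx gcont(1)] bounded_rv_compose[OF bx gcont(2)])+) simp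
        also have "\<bar>\<dots>\<bar> \<le> (c i)\<^sup>2 * L * d"
          using d g g' unfolding stein_bounded_def v_def by blast
        finally show ?thesis .
      qed
      have "\<bar>\<integral>t. (\<integral>x. \<Phi> x t \<partial>\<mu>) \<partial>distr M borel T\<bar> \<le> (\<integral>t. \<bar>\<integral>x. \<Phi> x t \<partial>\<mu>\<bar> \<partial>distr M borel T)"
        by (rule integral_abs_bound)
      also have "\<dots> \<le> (\<integral>t. (c i)\<^sup>2 * L * d \<partial>distr M borel T)"
      proof (rule integral_mono)
        show "integrable (distr M borel T) (\<lambda>t. \<bar>\<integral>x. \<Phi> x t \<partial>\<mu>\<bar>)"
          using P.integrable_snd[OF int] by (rule integrable_abs)
      qed (use inner in auto)
      also have "\<dots> = (c i)\<^sup>2 * L * d" using \<nu>.prob_space by simp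
      finally show ?thesis unfolding eq .
    qed
    have bfS: "bounded_rv M (\<lambda>\<omega>. f (S \<omega>))" by (rule bounded_rv_compose[OF bS cont(1)])
    have "expectation (\<lambda>\<omega>. S \<omega> * f (S \<omega>)) = expectation (\<lambda>\<omega>. \<Sum>i\<in>UNIV. c i * (V i \<omega> * f (S \<omega>)))"
      by (simp add: S_def sum_distrib_right mult_ac)
    also have "\<dots> = (\<Sum>i\<in>UNIV. c i * expectation (\<lambda>\<omega>. V i \<omega> * f (S \<omega>)))"
      by (subst Bochner_Integration.integral_sum) (auto intro!: bounded_rv_integrable bounded_rv_intros bdd bfS)
    finally have split: "expectation (\<lambda>\<omega>. S \<omega> * f (S \<omega>)) = (\<Sum>i\<in>UNIV. c i * expectation (\<lambda>\<omega>. V i \<omega> * f (S \<omega>)))" .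
    have "expectation (\<lambda>\<omega>. S \<omega> * f (S \<omega>)) - expectation (\<lambda>\<omega>. (S \<omega>)\<^sup>2) * expectation (\<lambda>\<omega>. f' (S \<omega>))
        = (\<Sum>i\<in>UNIV. c i * (expectation (\<lambda>\<omega>. V i \<omega> * f (S \<omega>)) - c i * v * expectation (\<lambda>\<omega>. f' (S \<omega>))))"
      unfolding S2 split
      by (simp add: sum_distrib_left sum_distrib_right sum_subtractf right_diff_distrib 
          power2_eq_square mult_ac)
    also have "\<bar>\<dots>\<bar> \<le> (\<Sum>i\<in>UNIV. \<bar>c i * (expectation (\<lambda>\<omega>. V i \<omega> * f (S \<omega>)) - c i * v * expectation (\<lambda>\<omega>. f' (S \<omega>)))\<bar>)"
      by (rule sum_abs)
    also have "\<dots> \<le> (\<Sum>i\<in>UNIV. \<bar>c i\<bar> * ((c i)\<^sup>2 * L * d))"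
      unfolding abs_mult[of "c _"] by (intro sum_mono mult_left_mono single) auto
    also have "\<dots> = L * ((\<Sum>i\<in>UNIV. \<bar>c i\<bar> ^ 3) * d)"
      by (simp add: sum_distrib_left sum_distrib_right power3_eq_cube power2_eq_square mult_ac flip: abs_mult)
    finally show "\<bar>expectation (\<lambda>\<omega>. S \<omega> * f (S \<omega>)) - expectation (\<lambda>\<omega>. (S \<omega>)\<^sup>2) * expectation (\<lambda>\<omega>. f' (S \<omega>))\<bar>
        \<le> L * ((\<Sum>i\<in>UNIV. \<bar>c i\<bar> ^ 3) * d)" .
  qed
qed

end

text \<open>
  Test the discrepancy with \<open>x \<mapsto> f(x / s)\<close>, where \<open>f\<close> solves Stein's equation and \<open>s\<close> is the
  standard deviation: its derivative has Lipschitz constant \<open>C / s\<^sup>2\<close>, and a further factor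
  \<open>1 / s\<close> comes from standardizing the first term.
\<close>

lemma wasserstein_le_stein_bound:
  obtains C :: real where "C > 0" and
    "\<And>(M :: 'a measure) Z d. prob_space M \<Longrightarrow> bounded_rv M Z \<Longrightarrow> prob_space.variance M Z > 0 \<Longrightarrow> 
       stein_bounded (distr M borel (\<lambda>\<omega>. Z \<omega> - prob_space.expectation M Z)) d \<Longrightarrow>
       wasserstein_dist (distr M borel (standardized M Z)) std_normal_distribution
         \<le> ereal (C * d / sqrt (prob_space.variance M Z) ^ 3)"
proof -
  obtain C :: real where C: "C > 0" and
    sol: "\<And>h. 1-lipschitz_on UNIV h \<Longrightarrow> \<exists>f f'. (\<forall>t. (f has_real_derivative f' t) (at t)) \<and> 
       C-lipschitz_on UNIV f' \<and> (\<forall>t. f' t - t * f t = h t - integral\<^sup>L std_normal_distribution h)"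
    using stein_equation_solution by blast
  have "wasserstein_dist (distr M borel (standardized M Z)) std_normal_distribution
         \<le> ereal (C * d / sqrt (prob_space.variance M Z) ^ 3)"
    if "prob_space M" and Z: "bounded_rv M Z" and var: "prob_space.variance M Z > 0" and
      d: "stein_bounded (distr M borel (\<lambda>\<omega>. Z \<omega> - prob_space.expectation M Z)) d"
    for M :: "'a measure" and Z d
    unfolding wasserstein_dist_def
  proof (rule SUP_least)
    interpret prob_space M by fact
    fix h :: "real \<Rightarrow> real" assume "h \<in> {h. 1-lipschitz_on UNIV h}"
    then have h: "1-lipschitz_on UNIV h" by simp
    from sol[OF h] obtain f f' where f: "\<And>t. (f has_real_derivative f' t) (at t)"
      and f': "C-lipschitz_on UNIV f'" 
      and eq: "\<And>t. f' t - t * f t = h t - integral\<^sup>L std_normal_distribution h" by blast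
    define s where "s = sqrt (variance Z)"
    define V where "V \<omega> = Z \<omega> - expectation Z" for \<omega>
    define W where "W = standardized M Z"
    have s: "s > 0" using var by (simp add: s_def)
    have bV: "bounded_rv M V" unfolding V_def by (intro bounded_rv_intros Z)
    have W_eq: "W \<omega> = V \<omega> / s" for \<omega> by (simp add: W_def standardized_def V_def s_def)
    have bW: "bounded_rv M W"
      unfolding W_eq[abs_def] divide_inverse by (intro bounded_rv_intros bV)
    note [measurable] = bounded_rv_measurable[OF bW]
    note cont = lipschitz_deriv_continuous[OF f f']
    have [measurable]: "h \<in> borel_measurable borel"
      using lipschitz_on_continuous_on[OF h] by (rule borel_measurable_continuous_onI)
    define g where "g x = f (x / s)" for x
    define g' where "g' x = f' (x / s) / s" for x
    have g: "(g has_real_derivative g' x) (at x)" for x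
    proof -
      have "((\<lambda>x. f (x / s)) has_real_derivative f' (x / s) * (1 / s)) (at x)"
        by (rule DERIV_chain2[where f = f and g = "\<lambda>x. x / s"]) 
           (use s in \<open>auto intro!: derivative_eq_intros f\<close>)
      then show ?thesis by (simp add: g_def[abs_def] g'_def)
    qed
    have g': "(C / s\<^sup>2)-lipschitz_on UNIV g'"
    proof (rule lipschitz_onI)
      fix x y
      have "dist (g' x) (g' y) = dist (f' (x / s)) (f' (y / s)) / s"
        using s by (simp add: g'_def dist_real_def abs_divide flip: diff_divide_distrib)
      also have "\<dots> \<le> C * dist (x / s) (y / s) / s"
        using lipschitz_onD[OF f'] s by (intro divide_right_mono) auto
      also have "dist (x / s) (y / s) = dist x y / s" 
        using s by (simp add: dist_real_def abs_divide flip: diff_divide_distrib)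
      finally show "dist (g' x) (g' y) \<le> C / s\<^sup>2 * dist x y"
        by (simp add: power2_eq_square mult_ac)
    qed (use C in simp)
    have d': "stein_bounded (distr M borel V) d" using d by (simp add: V_def[abs_def])
    have var_eq: "expectation (\<lambda>\<omega>. (V \<omega>)\<^sup>2) = s\<^sup>2" using var by (simp add: s_def V_def)
    have "\<bar>integral\<^sup>L (distr M borel W) h - integral\<^sup>L std_normal_distribution h\<bar>
        = \<bar>expectation (\<lambda>\<omega>. h (W \<omega>) - integral\<^sup>L std_normal_distribution h)\<bar>"
      using lipschitz_on_continuous_on[OF h] 
      by (subst Bochner_Integration.integral_diff) 
         (auto simp: integral_distr prob_space intro!: bounded_rv_integrable bounded_rv_compose[OF bW])
    also have "\<dots> = \<bar>expectation (\<lambda>\<omega>. f' (W \<omega>)) - expectation (\<lambda>\<omega>. W \<omega> * f (W \<omega>))\<bar>"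
      unfolding eq[symmetric] 
      by (subst Bochner_Integration.integral_diff) 
         (auto intro!: bounded_rv_integrable bounded_rv_intros bW 
           bounded_rv_compose[OF bW cont(1)] bounded_rv_compose[OF bW cont(2)])
    also have "\<dots> = \<bar>expectation (\<lambda>\<omega>. W \<omega> * f (W \<omega>)) - expectation (\<lambda>\<omega>. f' (W \<omega>))\<bar>"
      by (rule abs_minus_commute)
    also have "\<dots> = \<bar>(expectation (\<lambda>\<omega>. V \<omega> * g (V \<omega>)) - s\<^sup>2 * expectation (\<lambda>\<omega>. g' (V \<omega>))) / s\<bar>"
      using s by (simp add: g_def g'_def W_eq power2_eq_square diff_divide_distrib)
    also have "\<dots> = \<bar>expectation (\<lambda>\<omega>. V \<omega> * g (V \<omega>)) - s\<^sup>2 * expectation (\<lambda>\<omega>. g' (V \<omega>))\<bar> / s"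
      using s by (simp add: abs_divide)
    also have "\<dots> \<le> (C / s\<^sup>2 * d) / s"
      using d'[unfolded stein_bounded_distr_iff[OF bounded_rv_measurable[OF bV]], rule_format, OF g g'] s
      by (intro divide_right_mono) (simp_all add: var_eq)
    also have "\<dots> = C * d / s ^ 3" by (simp add: power2_eq_square power3_eq_cube)
    finally show "ereal \<bar>integral\<^sup>L (distr M borel (standardized M Z)) h - integral\<^sup>L std_normal_distribution h\<bar>
       \<le> ereal (C * d / sqrt (variance Z) ^ 3)" by (simp add: W_def s_def)
  qed
  with C show thesis by (rule that) 
qed

section \<open>Geometric recursions\<close>

text \<open>
  Every rate statement below is obtained from this lemma or the next: the multipliers only need
  to converge, at the price of a rate slightly worse than their limit. Finitely many steps are
  absorbed in the constant.
\<close>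

lemma geometric_recursion_upper:
  fixes u r :: "nat \<Rightarrow> real"
  assumes u: "\<And>n. 0 \<le> u n" 
    and step: "eventually (\<lambda>n. u (Suc n) \<le> r n * u n + K * q ^ n) sequentially"
    and r: "r \<longlonglongrightarrow> \<rho>" and s: "\<rho> < s" "0 \<le> q" "q < s"
  shows "\<exists>C>0. \<forall>n. u n \<le> C * s ^ n"
proof -
  have s0: "0 < s" using s by simp
  \<comment> \<open>The maximum keeps the multiplier nonnegative, which allows it to be applied to an upper bound.\<close>
  define r' where "r' = (max \<rho> 0 + s) / 2"
  have r': "0 \<le> r'" "r' < s" "\<rho> < r'" using s s0 by (auto simp: r'_def max_def field_simps)
  from r r'(3) have "eventually (\<lambda>n. r n < r') sequentially" by (rule order_tendstoD)
  with step have "eventually (\<lambda>n. u (Suc n) \<le> r n * u n + K * q ^ n \<and> r n < r') sequentially"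
    by eventually_elim simp
  then obtain N where N: "\<And>n. n \<ge> N \<Longrightarrow> u (Suc n) \<le> r n * u n + K * q ^ n \<and> r n < r'"
    by (auto simp: eventually_sequentially)
  define C where "C = 1 + (\<Sum>n\<le>N. u n / s ^ n) + \<bar>K\<bar> / (s - r')"
  have sum_nonneg: "0 \<le> (\<Sum>n\<le>N. u n / s ^ n)" using u s0 by (intro sum_nonneg) auto
  have C: "C > 0" "\<bar>K\<bar> \<le> C * (s - r')"
  proof -
    show "C > 0" using sum_nonneg r' by (auto simp: C_def intro!: add_pos_nonneg)
    have "\<bar>K\<bar> / (s - r') \<le> C" using sum_nonneg by (simp add: C_def)
    then show "\<bar>K\<bar> \<le> C * (s - r')" using r' by (simp add: field_simps)
  qed
  have "u n \<le> C * s ^ n" for n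
  proof (induction n)
    case 0
    have "u 0 / s ^ 0 \<le> (\<Sum>n\<le>N. u n / s ^ n)" using u s0 by (intro member_le_sum) auto
    then show ?case using r' by (simp add: C_def add_increasing2)
  next
    case (Suc n)
    show ?case
    proof (cases "n \<ge> N")
      case True
      have "u (Suc n) \<le> r n * u n + K * q ^ n" using N[OF True] by simp
      also have "\<dots> \<le> r' * u n + \<bar>K\<bar> * s ^ n"
        using N[OF True] u s 
        by (intro add_mono mult_mono[of K "\<bar>K\<bar>" "q ^ n" "s ^ n"] power_mono mult_right_mono) auto
      also have "\<dots> \<le> r' * (C * s ^ n) + (C * (s - r')) * s ^ n"
        using Suc r' C(2) s0 by (intro add_mono mult_left_mono mult_right_mono) auto
      also have "\<dots> = C * s ^ Suc n" by (simp add: algebra_simps)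
      finally show ?thesis .
    next
      case False
      then have "u (Suc n) / s ^ Suc n \<le> (\<Sum>n\<le>N. u n / s ^ n)" using u s0 by (intro member_le_sum) auto
      also have "\<dots> \<le> C" using r' by (simp add: C_def)
      finally show ?thesis using s0 by (simp add: field_simps)
    qed
  qed
  with C(1) show ?thesis by blast
qed

lemma geometric_recursion_lower:
  fixes u r :: "nat \<Rightarrow> real"
  assumes u: "\<And>n. 0 < u n" 
    and step: "eventually (\<lambda>n. r n * u n \<le> u (Suc n)) sequentially"
    and r: "r \<longlonglongrightarrow> \<rho>" and s: "0 < s" "s < \<rho>"
  shows "\<exists>C>0. \<forall>n. C * s ^ n \<le> u n"
proof -
  from r s(2) have "eventually (\<lambda>n. s < r n) sequentially" by (rule order_tendstoD)
  with step have "eventually (\<lambda>n. s * u n \<le> u (Suc n)) sequentially"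
  proof eventually_elim
    case (elim n)
    have "s * u n \<le> r n * u n" using elim u[of n] by (intro mult_right_mono) auto
    with elim show ?case by simp
  qed
  then obtain N where N: "\<And>n. n \<ge> N \<Longrightarrow> s * u n \<le> u (Suc n)"
    by (auto simp: eventually_sequentially)
  define C where "C = Min ((\<lambda>n. u n / s ^ n) ` {..N})"
  have C: "C > 0" unfolding C_def using u s by (subst Min_gr_iff) auto
  have le: "C \<le> u n / s ^ n" if "n \<le> N" for n unfolding C_def using that by (intro Min_le) auto
  have "C * s ^ n \<le> u n" for n
  proof (induction n)
    case 0 then show ?case using le[of 0] by simp
  next
    case (Suc n)
    show ?case
    proof (cases "n \<ge> N")
      case True
      have "C * s ^ Suc n = s * (C * s ^ n)" by simp
      also have "\<dots> \<le> s * u n" using Suc s by (intro mult_left_mono) auto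
      also have "\<dots> \<le> u (Suc n)" using N True by simp
      finally show ?thesis .
    next
      case False
      then have "C \<le> u (Suc n) / s ^ Suc n" by (intro le) auto
      then show ?thesis using s by (simp add: field_simps)
    qed
  qed
  with C show ?thesis by blast
qed

section \<open>Averaging functions\<close>

lemma cube_eq_cbox: "cube {a..b} = cbox (vec a) (vec b)"
  by (auto simp: cube_def mem_box_cart)

lemma vec_mem_cube: "t \<in> D \<Longrightarrow> vec t \<in> cube D"
  by (simp add: cube_def)

lemma uminus_mem_cube: "- x \<in> cube {a..b} \<longleftrightarrow> x \<in> cube {-b..-a}"
proof -
  have "(- x) $ i \<in> {a..b} \<longleftrightarrow> x $ i \<in> {-b..-a}" for i by auto
  then show ?thesis by (simp add: cube_def)
qed

lemma averaging_cubeD: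
  fixes F :: "real ^ 'k \<Rightarrow> real"
  assumes "averaging D F" "x \<in> cube D"
  shows "\<exists>i. x $ i \<le> F x" and "\<exists>i. F x \<le> x $ i"
  using assms unfolding averaging_def by (auto simp: Min_le_iff Max_ge_iff)

lemma averaging_range: "averaging D F \<Longrightarrow> x \<in> cube D \<Longrightarrow> F x \<in> D"
  by (simp add: averaging_def Pi_iff)

lemma averaging_mono:
  assumes "averaging D F" "x \<in> cube D" "y \<in> cube D" "\<And>i. x $ i \<le> y $ i"
  shows "F x \<le> F y"
  using assms by (simp add: averaging_def)

lemma averaging_vec:
  assumes "averaging D F" "t \<in> D"
  shows "F (vec t) = t"
  using averaging_cubeD[OF assms(1) vec_mem_cube[OF assms(2)]] by force

lemma averaging_between:
  fixes F :: "real ^ 'k \<Rightarrow> real"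
  assumes "averaging D F" "x \<in> D" "y \<in> D" "x < y" "i1 \<noteq> i2"
  obtains z where "\<And>i. z $ i \<in> {x, y}" "z $ i1 = x" "z $ i2 = y" "x < F z" "F z < y"
  using assms unfolding averaging_def by meson

text \<open>
  The class of averaging functions is symmetric under reflection, so that statements about large
  arguments yield those about small ones.
\<close>

lemma averaging_reflect:
  fixes F :: "real ^ 'k \<Rightarrow> real"
  assumes F: "averaging {a..b} F"
  shows "averaging {-b..-a} (\<lambda>x. - F (- x))"
proof -
  have refl: "- x \<in> cube {a..b}" if "x \<in> cube {-b..-a}" for x :: "real ^ 'k"
    using that by (simp add: uminus_mem_cube)
  have "F x \<in> {a..b}" if "x \<in> cube {a..b}" for x
    using F that by (rule averaging_range)
  note maps = this
  have "\<exists>z. (\<forall>i. z $ i \<in> {x, y}) \<and> z $ i1 = x \<and> z $ i2 = y \<and> x < - F (- z) \<and> - F (- z) < y"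
    if xy: "x \<in> {-b..-a}" "y \<in> {-b..-a}" "x < y" "i1 \<noteq> i2" for x y and i1 i2 :: 'k
  proof -
    obtain z where z: "\<And>i. z $ i \<in> {-y, -x}" "z $ i2 = -y" "z $ i1 = -x" "-y < F z" "F z < -x"
      by (rule averaging_between[OF F, of "-y" "-x" i2 i1]) (use xy in auto)
    show ?thesis
    proof (intro exI[of _ "- z"] conjI allI)
      show "(- z) $ i \<in> {x, y}" for i using z(1)[of i] by auto
    qed (use z in auto)
  qed
  then show ?thesis
    unfolding averaging_def
    using refl maps averaging_cubeD[OF F refl] averaging_mono[OF F refl refl]
    by (auto simp: Min_le_iff Max_ge_iff le_minus_iff minus_le_iff)
qed

text \<open>
  By monotonicity all coordinates but \<open>i\<close> may be taken to be \<open>w = c + \<eta>/2\<close>. By monotonicity again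
  and the strictness condition for the values \<open>w < y\<close>, the value of \<open>F\<close> at coordinate \<open>i\<close> equal to
  \<open>y\<close> is smaller than \<open>y\<close>. By compactness it is so by a fixed amount for all \<open>y \<ge> c + \<eta>\<close>: one
  outlier cannot sustain itself.
\<close>

lemma averaging_one_large:
  fixes F :: "real ^ 'k \<Rightarrow> real"
  assumes F: "averaging {a..b} F" and cont: "continuous_on (cube {a..b}) F"
    and k: "CARD('k) \<ge> 2" and c: "c \<in> {a..b}" and \<eta>: "\<eta> > 0"
  shows "\<exists>\<delta>>0. \<forall>x\<in>cube {a..b}. \<forall>i. c + \<eta> \<le> x $ i \<longrightarrow> (\<forall>j. j \<noteq> i \<longrightarrow> x $ j \<le> c + \<eta> / 2) \<longrightarrow> F x \<le> x $ i - \<delta>"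
proof (cases "c + \<eta> \<le> b")
  case False
  then have "\<not> c + \<eta> \<le> x $ i" if "x \<in> cube {a..b}" for x i
    using that unfolding cube_def by (simp add: not_le) (meson le_less_trans)
  then show ?thesis by (intro exI[of _ 1]) auto
next
  case True
  define w where "w = c + \<eta> / 2"
  define p :: "'k \<Rightarrow> real \<Rightarrow> real ^ 'k" where "p i y = (\<chi> j. if j = i then y else w)" for i y
  have w: "w \<in> {a..b}" using c \<eta> True by (auto simp: w_def)
  have p_cube: "p i y \<in> cube {a..b}" if "y \<in> {a..b}" for i y using that w by (auto simp: cube_def p_def)
  have "\<exists>\<delta>>0. \<forall>y\<in>{c + \<eta>..b}. F (p i y) \<le> y - \<delta>" for i
  proof -
    have "continuous_on {c + \<eta>..b} (\<lambda>y. F (p i y) - y)"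
    proof (intro continuous_intros continuous_on_compose2[OF cont])
      show "continuous_on {c + \<eta>..b} (p i)"
        unfolding p_def
      proof (intro continuous_on_vec_lambda)
        show "continuous_on {c + \<eta>..b} (\<lambda>y. if j = i then y else w)" for j by (cases "j = i") auto
      qed
      show "p i ` {c + \<eta>..b} \<subseteq> cube {a..b}" using c \<eta> by (auto intro!: p_cube)
    qed
    from continuous_attains_sup[OF compact_Icc _ this] True
    obtain y where y: "y \<in> {c + \<eta>..b}" and max: "\<And>z. z \<in> {c + \<eta>..b} \<Longrightarrow> F (p i z) - z \<le> F (p i y) - y"
      by auto
    have yab: "y \<in> {a..b}" "w < y" using y c \<eta> by (auto simp: w_def)
    obtain i1 where "i1 \<noteq> i" using k by (metis card_2_iff' card_le_Suc0_iff_eq UNIV_I finite_class.finite_UNIV not_less_eq_eq numeral_2_eq_2)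
    then obtain z where z: "\<And>j. z $ j \<in> {w, y}" "z $ i = y" "F z < y"
      using averaging_between[OF F w yab(1) yab(2), of i1 i] by metis
    have "F (p i y) \<le> F z"
    proof (rule averaging_mono[OF F p_cube[OF yab(1)]])
      show "z \<in> cube {a..b}" unfolding cube_def using z(1) w yab(1) by (force)
      show "p i y $ j \<le> z $ j" for j using z(1)[of j] z(2) yab(2) by (auto simp: p_def)
    qed
    with z(3) have "F (p i y) < y" by simp
    then show ?thesis using max by (intro exI[of _ "y - F (p i y)"]) force
  qed
  then obtain \<delta> where \<delta>: "\<And>i. \<delta> i > 0" "\<And>i y. y \<in> {c + \<eta>..b} \<Longrightarrow> F (p i y) \<le> y - \<delta> i" by metis
  have "F x \<le> x $ i - Min (range \<delta>)" 
    if x: "x \<in> cube {a..b}" and i: "c + \<eta> \<le> x $ i" and j: "\<forall>j. j \<noteq> i \<longrightarrow> x $ j \<le> c + \<eta> / 2" for x i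
  proof -
    have xi: "x $ i \<in> {a..b}" using x by (auto simp: cube_def)
    have "F x \<le> F (p i (x $ i))"
      using j by (intro averaging_mono[OF F x p_cube[OF xi]]) (auto simp: p_def w_def)
    also have "\<dots> \<le> x $ i - \<delta> i" using \<delta>(2)[of "x $ i" i] i xi by auto
    also have "\<dots> \<le> x $ i - Min (range \<delta>)" by simp
    finally show ?thesis .
  qed
  moreover have "Min (range \<delta>) > 0" using \<delta>(1) by (subst Min_gr_iff) auto
  ultimately show ?thesis by blast
qed

lemma averaging_one_small:
  fixes F :: "real ^ 'k \<Rightarrow> real"
  assumes F: "averaging {a..b} F" and cont: "continuous_on (cube {a..b}) F"
    and k: "CARD('k) \<ge> 2" and c: "c \<in> {a..b}" and \<eta>: "\<eta> > 0"
  shows "\<exists>\<delta>>0. \<forall>x\<in>cube {a..b}. \<forall>i. x $ i \<le> c - \<eta> \<longrightarrow> (\<forall>j. j \<noteq> i \<longrightarrow> c - \<eta> / 2 \<le> x $ j) \<longrightarrow> x $ i + \<delta> \<le> F x"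
proof -
  have refl: "- x \<in> cube {a..b} \<longleftrightarrow> x \<in> cube {-b..-a}" for x :: "real ^ 'k" by (rule uminus_mem_cube)
  have "continuous_on (cube {-b..-a}) (\<lambda>x. - F (- x))"
    by (intro continuous_intros continuous_on_compose2[OF cont]) (auto simp: refl)
  from averaging_one_large[OF averaging_reflect[OF F] this k, of "- c" \<eta>] c \<eta>
  obtain \<delta> where \<delta>: "\<delta> > 0" and *: "\<And>x i. x \<in> cube {-b..-a} \<Longrightarrow> - c + \<eta> \<le> x $ i \<Longrightarrow> 
      (\<And>j. j \<noteq> i \<Longrightarrow> x $ j \<le> - c + \<eta> / 2) \<Longrightarrow> - F (- x) \<le> x $ i - \<delta>" by auto
  show ?thesis
  proof (intro exI[of _ \<delta>] conjI ballI allI impI \<delta>)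
    fix x :: "real ^ 'k" and i
    assume "x \<in> cube {a..b}" "x $ i \<le> c - \<eta>" "\<forall>j. j \<noteq> i \<longrightarrow> c - \<eta> / 2 \<le> x $ j"
    then show "x $ i + \<delta> \<le> F x" using *[of "- x" i] refl[of "- x"] by fastforce
  qed
qed

text \<open>
  The point \<open>c\<close> may be an endpoint of the interval, where derivatives are one-sided. All
  information about the gradient is therefore extracted from difference quotients along directions
  that stay in the cube.
\<close>

lemma directional_derivative_cube:
  fixes F :: "real ^ 'k \<Rightarrow> real"
  assumes F: "(F has_derivative (\<lambda>h. \<beta> \<bullet> h)) (at (vec c) within cube {a..b})"
    and v: "\<And>t. t \<in> J \<Longrightarrow> vec c + t *\<^sub>R v \<in> cube {a..b}"
  shows "((\<lambda>t. (F (vec c + t *\<^sub>R v) - F (vec c)) / t) \<longlongrightarrow> \<beta> \<bullet> v) (at 0 within J)"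
proof -
  have sub: "(\<lambda>t. vec c + t *\<^sub>R v) ` J \<subseteq> cube {a..b}" by (intro image_subsetI v)
  have "((\<lambda>t. vec c + t *\<^sub>R v) has_derivative (\<lambda>t. t *\<^sub>R v)) (at 0 within J)"
    by (auto intro!: derivative_eq_intros)
  moreover have "(F has_derivative (\<lambda>h. \<beta> \<bullet> h)) (at (vec c + 0 *\<^sub>R v) within (\<lambda>t. vec c + t *\<^sub>R v) ` J)"
    using has_derivative_subset[OF F sub] by simp
  ultimately have "(F \<circ> (\<lambda>t. vec c + t *\<^sub>R v) has_derivative ((\<lambda>h. \<beta> \<bullet> h) \<circ> (\<lambda>t. t *\<^sub>R v))) (at 0 within J)"
    by (rule diff_chain_within)
  then have "((\<lambda>t. F (vec c + t *\<^sub>R v)) has_real_derivative \<beta> \<bullet> v) (at 0 within J)"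
    by (simp add: has_field_derivative_def comp_def mult_commute_abs)
  then show ?thesis by (simp add: has_field_derivative_iff)
qed

lemma axis_mem_cube:
  assumes "c \<in> {a..b}" "t \<in> {a - c..b - c}"
  shows "vec c + t *\<^sub>R axis i 1 \<in> cube {a..b}"
  using assms by (auto simp: cube_def axis_def)

lemma at_within_cube_nontrivial:
  assumes "a < b" "c \<in> {a..b}"
  shows "at 0 within {a - c..b - c :: real} \<noteq> bot"
proof -
  have "0 islimpt {a - c..b - c}" using assms by (subst islimpt_Icc) auto
  then show ?thesis by (simp add: trivial_limit_within)
qed

lemma gradient_unique_cube:
  fixes F :: "real ^ 'k \<Rightarrow> real"
  assumes "(F has_derivative (\<lambda>h. \<beta> \<bullet> h)) (at (vec c) within cube {a..b})"
    and "(F has_derivative (\<lambda>h. \<gamma> \<bullet> h)) (at (vec c) within cube {a..b})"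
    and c: "a < b" "c \<in> {a..b}"
  shows "\<beta> = \<gamma>"
proof -
  have "\<beta> \<bullet> axis i 1 = \<gamma> \<bullet> axis i 1" for i
    by (rule tendsto_unique[OF at_within_cube_nontrivial[OF c]
          directional_derivative_cube[OF assms(1) axis_mem_cube[OF c(2)]]
          directional_derivative_cube[OF assms(2) axis_mem_cube[OF c(2)]]])
  then show ?thesis by (simp add: inner_axis vec_eq_iff)
qed

text \<open>
  Monotonicity gives the signs, and \<open>F(t,\<dots>,t) = t\<close> gives the sum.
\<close>

lemma averaging_gradient:
  fixes F :: "real ^ 'k \<Rightarrow> real"
  assumes F: "averaging {a..b} F"
    and deriv: "(F has_derivative (\<lambda>h. \<beta> \<bullet> h)) (at (vec c) within cube {a..b})"
    and c: "a < b" "c \<in> {a..b}"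
  shows "0 \<le> \<beta> $ i" and "(\<Sum>i\<in>UNIV. \<beta> $ i) = 1"
proof -
  let ?J = "{a - c..b - c}"
  note nt = at_within_cube_nontrivial[OF c]
  have Fc: "F (vec c) = c" by (rule averaging_vec[OF F c(2)])
  have "((\<lambda>t. (F (vec c + t *\<^sub>R axis i 1) - F (vec c)) / t) \<longlongrightarrow> \<beta> \<bullet> axis i 1) (at 0 within ?J)"
    by (rule directional_derivative_cube[OF deriv axis_mem_cube[OF c(2)]])
  moreover have "0 \<le> (F (vec c + t *\<^sub>R axis i 1) - F (vec c)) / t" if t: "t \<in> ?J" for t
  proof (cases "t \<ge> 0")
    case True
    have "F (vec c) \<le> F (vec c + t *\<^sub>R axis i 1)"
      using True by (intro averaging_mono[OF F] axis_mem_cube[OF c(2) t] vec_mem_cube[OF c(2)]) (auto simp: axis_def)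
    then show ?thesis using True by simp
  next
    case False
    have "F (vec c + t *\<^sub>R axis i 1) \<le> F (vec c)"
      using False by (intro averaging_mono[OF F] axis_mem_cube[OF c(2) t] vec_mem_cube[OF c(2)]) (auto simp: axis_def)
    then show ?thesis using False by (simp add: divide_nonpos_neg)
  qed
  then have "\<forall>\<^sub>F t in at 0 within ?J. 0 \<le> (F (vec c + t *\<^sub>R axis i 1) - F (vec c)) / t"
    by (auto simp: eventually_at_filter)
  ultimately have "0 \<le> \<beta> \<bullet> axis i 1" by (intro tendsto_lowerbound[OF _ _ nt])
  then show "0 \<le> \<beta> $ i" by (simp add: inner_axis)
  have vec_eq: "vec c + t *\<^sub>R vec 1 = (vec (c + t) :: real ^ 'k)" 
    "vec c + t *\<^sub>R 1 = (vec (c + t) :: real ^ 'k)" for t by (simp_all add: vec_eq_iff)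
  have "((\<lambda>t. (F (vec c + t *\<^sub>R vec 1) - F (vec c)) / t) \<longlongrightarrow> \<beta> \<bullet> vec 1) (at 0 within ?J)"
    using c by (intro directional_derivative_cube[OF deriv]) (auto simp: vec_eq intro!: vec_mem_cube)
  moreover have "\<forall>\<^sub>F t in at 0 within ?J. (F (vec c + t *\<^sub>R vec 1) - F (vec c)) / t = 1"
    unfolding eventually_at_filter
    by (rule always_eventually) (auto simp: vec_eq Fc averaging_vec[OF F])
  then have "((\<lambda>t. (F (vec c + t *\<^sub>R vec 1) - F (vec c)) / t) \<longlongrightarrow> 1) (at 0 within ?J)"
    by (rule tendsto_eventually)
  ultimately have "\<beta> \<bullet> vec 1 = 1" by (rule tendsto_unique[OF nt])
  then show "(\<Sum>i\<in>UNIV. \<beta> $ i) = 1" by (simp add: inner_vec_def)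
qed

lemma norm_matrix_vector_le:
  fixes A :: "real ^ 'k ^ 'k"
  shows "norm (A *v h) \<le> real CARD('k) * norm A * norm h"
proof -
  have "norm (A *v h) \<le> (\<Sum>i\<in>UNIV. \<bar>(A *v h) $ i\<bar>)" by (rule norm_le_l1_cart)
  also have "\<dots> \<le> (\<Sum>i\<in>(UNIV :: 'k set). norm A * norm h)"
  proof (rule sum_mono)
    fix i
    have "(A *v h) $ i = (A $ i) \<bullet> h" by (simp add: matrix_vector_mult_def inner_vec_def)
    also have "\<bar>\<dots>\<bar> \<le> norm (A $ i) * norm h" by (rule Cauchy_Schwarz_ineq2)
    also have "\<dots> \<le> norm A * norm h" by (intro mult_right_mono Finite_Cartesian_Product.norm_nth_le) auto
    finally show "\<bar>(A *v h) $ i\<bar> \<le> norm A * norm h" .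
  qed
  finally show ?thesis by simp
qed

text \<open>
  The Hessian is bounded on a compact set, so the gradient is Lipschitz by convexity; the mean
  value inequality for \<open>F - G(x) \<bullet> z\<close> on the segment from \<open>x\<close> to \<open>y\<close> then yields the quadratic
  error.
\<close>

lemma twice_differentiable_taylor:
  fixes F :: "real ^ 'k \<Rightarrow> real"
  assumes "twice_continuously_differentiable_on F S" and S: "compact S" "convex S"
  obtains G K where "K \<ge> 0" "continuous_on S G"
    "\<And>x. x \<in> S \<Longrightarrow> (F has_derivative (\<lambda>h. G x \<bullet> h)) (at x within S)"
    "\<And>x y. x \<in> S \<Longrightarrow> y \<in> S \<Longrightarrow> \<bar>F y - F x - G x \<bullet> (y - x)\<bar> \<le> K * (norm (y - x))\<^sup>2"
proof -
  from assms(1) obtain G :: "real ^ 'k \<Rightarrow> real ^ 'k" and H :: "real ^ 'k \<Rightarrow> real ^ 'k ^ 'k" where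
    F: "\<And>x. x \<in> S \<Longrightarrow> (F has_derivative (\<lambda>h. G x \<bullet> h)) (at x within S)" and
    G: "\<And>x. x \<in> S \<Longrightarrow> (G has_derivative (\<lambda>h. H x *v h)) (at x within S)" and
    H: "continuous_on S H"
    unfolding twice_continuously_differentiable_on_def by blast
  have "bounded (H ` S)" by (intro compact_imp_bounded compact_continuous_image H S)
  then obtain B where B: "B > 0" "\<And>x. x \<in> S \<Longrightarrow> norm (H x) \<le> B" unfolding bounded_pos by auto
  define K where "K = real CARD('k) * B"
  have K: "K \<ge> 0" using B by (simp add: K_def)
  have G_lip: "norm (G x - G y) \<le> K * norm (x - y)" if "x \<in> S" "y \<in> S" for x y
  proof (rule differentiable_bound[OF S(2) G _ that])
    fix z assume z: "z \<in> S"
    show "onorm (\<lambda>h. H z *v h) \<le> K"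
    proof (rule onorm_le)
      fix h
      have "norm (H z *v h) \<le> real CARD('k) * norm (H z) * norm h" by (rule norm_matrix_vector_le)
      also have "\<dots> \<le> K * norm h" unfolding K_def using B z by (intro mult_right_mono mult_left_mono) auto
      finally show "norm (H z *v h) \<le> K * norm h" .
    qed
  qed
  have "\<bar>F y - F x - G x \<bullet> (y - x)\<bar> \<le> K * (norm (y - x))\<^sup>2" if xy: "x \<in> S" "y \<in> S" for x y
  proof -
    let ?T = "closed_segment x y"
    have sub: "?T \<subseteq> S" by (rule closed_segment_subset[OF xy S(2)])
    have "norm ((F y - G x \<bullet> y) - (F x - G x \<bullet> x)) \<le> K * norm (y - x) * norm (y - x)"
    proof (rule differentiable_bound[of ?T])
      fix z assume z: "z \<in> ?T"
      have "(F has_derivative (\<lambda>h. G z \<bullet> h)) (at z within ?T)"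
        using has_derivative_subset[OF F sub] z sub by blast
      then show "((\<lambda>z. F z - G x \<bullet> z) has_derivative (\<lambda>h. G z \<bullet> h - G x \<bullet> h)) (at z within ?T)"
        by (auto intro!: derivative_eq_intros)
      show "onorm (\<lambda>h. G z \<bullet> h - G x \<bullet> h) \<le> K * norm (y - x)"
      proof (rule onorm_le)
        fix h
        have "norm (G z \<bullet> h - G x \<bullet> h) \<le> norm (G z - G x) * norm h"
          unfolding inner_diff_left[symmetric] real_norm_def by (rule Cauchy_Schwarz_ineq2)
        also have "\<dots> \<le> K * norm (z - x) * norm h"
          using G_lip[of z x] z sub xy by (intro mult_right_mono) auto
        also have "\<dots> \<le> K * norm (y - x) * norm h"
        proof (intro mult_right_mono mult_left_mono)
          show "norm (z - x) \<le> norm (y - x)"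
            using segment_bound(1)[OF z] by (simp add: norm_minus_commute)
        qed (use K in auto)
        finally show "norm (G z \<bullet> h - G x \<bullet> h) \<le> K * norm (y - x) * norm h" .
      qed
    qed auto
    then show ?thesis by (simp add: inner_diff_right power2_eq_square algebra_simps)
  qed
  moreover have "continuous_on S G" by (rule has_derivative_continuous_on[OF G])
  ultimately show thesis using that K F by blast
qed

section \<open>The recursion and its moments\<close>

text \<open>
  Only continuity of \<open>F\<close> is assumed here, so that the locale serves both the averaging and the
  linear case.
\<close>

locale hierarchical_sequence = prob_space M
  for M :: "'a measure" +
  fixes F :: "real ^ 'k \<Rightarrow> real" and X :: "nat \<Rightarrow> 'a \<Rightarrow> real" and Y :: "nat \<Rightarrow> 'k \<Rightarrow> 'a \<Rightarrow> real"
    and a b c :: real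
  assumes ab: "a < b"
    and X_measurable [measurable]: "\<And>n. X n \<in> borel_measurable M"
    and X0_nonconst: "\<not> (\<exists>x. AE \<omega> in M. X 0 \<omega> = x)"
    and X0_range: "AE \<omega> in M. X 0 \<omega> \<in> {a..b}"
    and F_range: "\<And>x. x \<in> cube {a..b} \<Longrightarrow> F x \<in> {a..b}"
    and F_cont: "continuous_on (cube {a..b}) F"
    and Y_indep: "\<And>n. indep_vars (\<lambda>_. borel) (Y n) UNIV"
    and Y_law: "\<And>n i. distr M borel (Y n i) = distr M borel (X n)"
    and X_step: "\<And>n. AE \<omega> in M. X (Suc n) \<omega> = F (\<chi> i. Y n i \<omega>)"
    and X_conv: "converges_in_probability M X c"
begin

lemma Y_measurable [measurable]: "Y n i \<in> borel_measurable M"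
  using Y_indep[of n] by (simp add: indep_vars_def)

lemma AE_Y_iff:
  assumes [measurable]: "Measurable.pred borel P"
  shows "(AE \<omega> in M. P (Y n i \<omega>)) \<longleftrightarrow> (AE \<omega> in M. P (X n \<omega>))"
proof -
  have "(AE \<omega> in M. P (Z \<omega>)) \<longleftrightarrow> (AE x in distr M borel Z. P x)" if [measurable]: "Z \<in> borel_measurable M" for Z
    by (subst AE_distr_iff) auto
  from this[of "Y n i"] this[of "X n"] show ?thesis unfolding Y_law by simp
qed

lemma expectation_Y:
  fixes g :: "real \<Rightarrow> real"
  assumes [measurable]: "g \<in> borel_measurable borel"
  shows "expectation (\<lambda>\<omega>. g (Y n i \<omega>)) = expectation (\<lambda>\<omega>. g (X n \<omega>))"
proof -
  have "expectation (\<lambda>\<omega>. g (Z \<omega>)) = (\<integral>x. g x \<partial>distr M borel Z)" if [measurable]: "Z \<in> borel_measurable M" for Z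
    by (subst integral_distr) auto
  from this[of "Y n i"] this[of "X n"] show ?thesis unfolding Y_law by simp
qed

lemma X_range: "AE \<omega> in M. X n \<omega> \<in> {a..b}"
  and Y_range: "AE \<omega> in M. \<forall>i. Y n i \<omega> \<in> {a..b}"
proof -
  have Y: "AE \<omega> in M. \<forall>i. Y n i \<omega> \<in> {a..b}" if "AE \<omega> in M. X n \<omega> \<in> {a..b}" for n
  proof -
    have "AE \<omega> in M. Y n i \<omega> \<in> {a..b}" for i by (subst AE_Y_iff) (use that in auto)
    then have "AE \<omega> in M. \<forall>i\<in>UNIV. Y n i \<omega> \<in> {a..b}" by (intro AE_finite_allI) auto
    then show ?thesis by simp
  qed
  show X: "AE \<omega> in M. X n \<omega> \<in> {a..b}" for n
  proof (induction n)
    case 0 show ?case by (rule X0_range)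
  next
    case (Suc n)
    from Y[OF Suc] X_step[of n] show ?case
    proof eventually_elim
      case (elim \<omega>)
      then have "(\<chi> i. Y n i \<omega>) \<in> cube {a..b}" by (simp add: cube_def)
      with elim(2) show ?case using F_range by simp
    qed
  qed
  show "AE \<omega> in M. \<forall>i. Y n i \<omega> \<in> {a..b}" by (rule Y[OF X])
qed

lemma Y_cube: "AE \<omega> in M. (\<chi> i. Y n i \<omega>) \<in> cube {a..b}"
  using Y_range[of n] by eventually_elim (simp add: cube_def)

lemma X_bounded_rv: "bounded_rv M (X n)"
proof -
  from X_range[of n] have "AE \<omega> in M. \<bar>X n \<omega>\<bar> \<le> \<bar>a\<bar> + \<bar>b\<bar>" by eventually_elim auto
  then show ?thesis by (auto simp: bounded_rv_def)
qed

lemma Y_bounded_rv: "bounded_rv M (Y n i)"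
proof -
  from Y_range[of n] have "AE \<omega> in M. \<bar>Y n i \<omega>\<bar> \<le> \<bar>a\<bar> + \<bar>b\<bar>" by eventually_elim (drule spec[of _ i], auto)
  then show ?thesis by (auto simp: bounded_rv_def)
qed

definition mean :: "nat \<Rightarrow> real" where "mean n = expectation (X n)"

definition dev :: "nat \<Rightarrow> 'a \<Rightarrow> real" where "dev n \<omega> = X n \<omega> - mean n"

definition copy_dev :: "nat \<Rightarrow> 'k \<Rightarrow> 'a \<Rightarrow> real" where "copy_dev n i \<omega> = Y n i \<omega> - mean n"

definition moment :: "nat \<Rightarrow> nat \<Rightarrow> real" where "moment p n = expectation (\<lambda>\<omega>. dev n \<omega> ^ p)"

definition linear_part :: "real ^ 'k \<Rightarrow> nat \<Rightarrow> 'a \<Rightarrow> real" where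
  "linear_part g n \<omega> = (\<Sum>i\<in>UNIV. g $ i * copy_dev n i \<omega>)"

lemma dev_bounded_rv: "bounded_rv M (dev n)"
  and copy_dev_bounded_rv: "bounded_rv M (copy_dev n i)"
  unfolding dev_def[abs_def] copy_dev_def[abs_def] 
  by (intro bounded_rv_intros X_bounded_rv Y_bounded_rv)+

lemma linear_part_bounded_rv: "bounded_rv M (linear_part g n)"
  unfolding linear_part_def[abs_def] by (intro bounded_rv_intros copy_dev_bounded_rv)

lemma [measurable]: "dev n \<in> borel_measurable M" "copy_dev n i \<in> borel_measurable M"
    "linear_part g n \<in> borel_measurable M"
  using dev_bounded_rv copy_dev_bounded_rv linear_part_bounded_rv by (auto simp: bounded_rv_measurable)

lemma mean_range: "mean n \<in> {a..b}"
proof -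
  have "a \<le> mean n" "mean n \<le> b" unfolding mean_def 
    using X_range[of n] bounded_rv_integrable[OF X_bounded_rv]
    by (auto intro!: integral_ge_const integral_le_const)
  then show ?thesis by simp
qed

lemma copy_dev_moment: "expectation (\<lambda>\<omega>. copy_dev n i \<omega> ^ p) = moment p n"
  unfolding copy_dev_def moment_def dev_def by (rule expectation_Y[of "\<lambda>x. (x - mean n) ^ p"]) measurable

lemma moment_1: "expectation (dev n) = 0"
  unfolding dev_def[abs_def] mean_def using bounded_rv_integrable[OF X_bounded_rv] by (simp add: prob_space)

lemma copy_dev_mean: "expectation (copy_dev n i) = 0"
  using copy_dev_moment[of n i 1] moment_1[of n] by (simp add: moment_def)

lemma moment_2: "moment 2 n = variance (X n)"
  by (simp add: moment_def dev_def mean_def)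

lemma moment_even_nonneg: "even p \<Longrightarrow> 0 \<le> moment p n"
  unfolding moment_def by (intro integral_nonneg_AE) (simp add: zero_le_even_power)

lemma moment_2_sq_le: "(moment 2 n)\<^sup>2 \<le> moment 4 n"
  using square_expectation_le[of "\<lambda>\<omega>. (dev n \<omega>)\<^sup>2"] 
  by (simp add: moment_def bounded_rv_intros dev_bounded_rv flip: power_mult)

lemma copy_dev_law: "distr M borel (copy_dev n i) = distr M borel (dev n)"
proof -
  have "distr M borel (\<lambda>\<omega>. Z \<omega> - mean n) = distr (distr M borel Z) borel (\<lambda>x. x - mean n)" 
    if [measurable]: "Z \<in> borel_measurable M" for Z :: "'a \<Rightarrow> real"
    by (subst distr_distr) (auto simp: comp_def)
  then show ?thesis unfolding copy_dev_def[abs_def] dev_def[abs_def] by (simp add: Y_law)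
qed

lemma copy_dev_indep: "indep_vars (\<lambda>_. borel) (copy_dev n) UNIV"
  unfolding copy_dev_def[abs_def]
  by (rule indep_vars_compose2[OF Y_indep, where Y = "\<lambda>_ x. x - mean n"]) auto

lemma linear_part_moments:
  shows "expectation (linear_part g n) = 0"
    and "expectation (\<lambda>\<omega>. (linear_part g n \<omega>)\<^sup>2) = (norm g)\<^sup>2 * moment 2 n"
    and "expectation (\<lambda>\<omega>. (linear_part g n \<omega>) ^ 4) \<le> norm g ^ 4 * (moment 4 n + 3 * (moment 2 n)\<^sup>2)"
proof -
  note m = linear_combination_moments[OF copy_dev_indep[of n] finite_class.finite_UNIV copy_dev_bounded_rv 
    copy_dev_mean copy_dev_moment copy_dev_moment, of "\<lambda>i. g $ i"]
  show "expectation (linear_part g n) = 0" 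
      "expectation (\<lambda>\<omega>. (linear_part g n \<omega>)\<^sup>2) = (norm g)\<^sup>2 * moment 2 n"
    using m by (simp_all add: linear_part_def[abs_def] norm_sq_sum)
  have "norm g ^ 4 = (\<Sum>i\<in>UNIV. (g $ i)\<^sup>2)\<^sup>2" by (simp flip: norm_sq_sum power_mult)
  then show "expectation (\<lambda>\<omega>. (linear_part g n \<omega>) ^ 4) \<le> norm g ^ 4 * (moment 4 n + 3 * (moment 2 n)\<^sup>2)"
    using m(3) by (simp add: linear_part_def)
qed

lemma stein_bounded_linear_part:
  assumes "stein_bounded (distr M borel (dev n)) d"
  shows "stein_bounded (distr M borel (linear_part g n)) ((\<Sum>i\<in>UNIV. \<bar>g $ i\<bar> ^ 3) * d)"
  unfolding linear_part_def[abs_def]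
  by (rule stein_bounded_linear_combination[OF copy_dev_indep copy_dev_bounded_rv copy_dev_mean copy_dev_law assms])

lemma deviation_tail_vanishes:
  assumes "\<epsilon> > 0"
  shows "(\<lambda>n. \<P>(\<omega> in M. \<bar>X n \<omega> - c\<bar> > \<epsilon>)) \<longlonglongrightarrow> 0"
  using X_conv assms by (simp add: converges_in_probability_def)

lemma expectation_indicator_pred:
  assumes [measurable]: "Measurable.pred M P"
  shows "expectation (\<lambda>\<omega>. if P \<omega> then 1 else 0) = \<P>(\<omega> in M. P \<omega>)"
proof -
  have "expectation (\<lambda>\<omega>. if P \<omega> then 1 else 0) = expectation (indicator {\<omega>\<in>space M. P \<omega>})"
    by (intro Bochner_Integration.integral_cong) (auto split: split_indicator)
  also have "\<dots> = \<P>(\<omega> in M. P \<omega>)" by simp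
  finally show ?thesis .
qed

lemma bounded_rv_indicator_pred:
  assumes [measurable]: "Measurable.pred M P"
  shows "bounded_rv M (\<lambda>\<omega>. if P \<omega> then 1 else 0)"
  unfolding bounded_rv_def by (auto intro!: exI[of _ 1])

lemma mean_abs_dev_vanishes: "(\<lambda>n. expectation (\<lambda>\<omega>. \<bar>X n \<omega> - c\<bar>)) \<longlonglongrightarrow> 0"
proof (rule LIMSEQ_I)
  fix r :: real assume r: "r > 0"
  define L where "L = \<bar>a\<bar> + \<bar>b\<bar> + \<bar>c\<bar> + 1"
  have L: "L > 0" by (simp add: L_def)
  have "r / (2 * L) > 0" using r L by simp
  with deviation_tail_vanishes[of "r / 2"] r have "eventually (\<lambda>n. \<P>(\<omega> in M. \<bar>X n \<omega> - c\<bar> > r / 2) < r / (2 * L)) sequentially"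
    by (intro order_tendstoD) auto
  then have "eventually (\<lambda>n. norm (expectation (\<lambda>\<omega>. \<bar>X n \<omega> - c\<bar>) - 0) < r) sequentially"
  proof eventually_elim
    case (elim n)
    have "expectation (\<lambda>\<omega>. \<bar>X n \<omega> - c\<bar>) \<le> expectation (\<lambda>\<omega>. r / 2 + L * (if \<bar>X n \<omega> - c\<bar> > r / 2 then 1 else 0))"
    proof (rule integral_mono_AE)
      show "AE \<omega> in M. \<bar>X n \<omega> - c\<bar> \<le> r / 2 + L * (if \<bar>X n \<omega> - c\<bar> > r / 2 then 1 else 0)"
        using X_range[of n] by eventually_elim (use r in \<open>auto simp: L_def\<close>)
    qed (intro bounded_rv_integrable bounded_rv_intros X_bounded_rv bounded_rv_indicator_pred; measurable)+
    also have "\<dots> = r / 2 + L * \<P>(\<omega> in M. \<bar>X n \<omega> - c\<bar> > r / 2)"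
      by (subst Bochner_Integration.integral_add)
         (auto simp: expectation_indicator_pred prob_space intro!: bounded_rv_integrable bounded_rv_intros bounded_rv_indicator_pred)
    also have "\<dots> < r / 2 + L * (r / (2 * L))" using elim L by (intro add_strict_left_mono mult_strict_left_mono)
    also have "\<dots> = r" using L by simp
    finally show ?case by simp
  qed
  then show "\<exists>no. \<forall>n\<ge>no. norm (expectation (\<lambda>\<omega>. \<bar>X n \<omega> - c\<bar>) - 0) < r"
    by (simp add: eventually_sequentially)
qed

lemma mean_tendsto: "mean \<longlonglongrightarrow> c"
proof (rule Lim_transform2[OF tendsto_const])
  show "(\<lambda>n. c - mean n) \<longlonglongrightarrow> 0"
  proof (rule Lim_null_comparison[OF _ mean_abs_dev_vanishes], rule always_eventually, rule allI)
    fix n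
    have "c - mean n = expectation (\<lambda>\<omega>. c - X n \<omega>)"
      unfolding mean_def using bounded_rv_integrable[OF X_bounded_rv] by (simp add: prob_space)
    also have "norm \<dots> \<le> expectation (\<lambda>\<omega>. \<bar>c - X n \<omega>\<bar>)" unfolding real_norm_def by (rule integral_abs_bound)
    finally show "norm (c - mean n) \<le> expectation (\<lambda>\<omega>. \<bar>X n \<omega> - c\<bar>)" by (simp add: abs_minus_commute)
  qed
qed

lemma limit_range: "c \<in> {a..b}"
  using LIMSEQ_le_const[OF mean_tendsto, of a] LIMSEQ_le_const2[OF mean_tendsto, of b] mean_range by auto

lemma variance_pos_iff: "0 < moment 2 n \<longleftrightarrow> \<not> (\<exists>x. AE \<omega> in M. X n \<omega> = x)"
proof
  assume pos: "0 < moment 2 n"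
  show "\<not> (\<exists>x. AE \<omega> in M. X n \<omega> = x)"
  proof
    assume "\<exists>x. AE \<omega> in M. X n \<omega> = x"
    then obtain x where x: "AE \<omega> in M. X n \<omega> = x" ..
    then have "expectation (X n) = expectation (\<lambda>_. x)" by (intro integral_cong_AE) auto
    then have "mean n = x" by (simp add: mean_def prob_space)
    with x have "moment 2 n = expectation (\<lambda>_. 0)" unfolding moment_def dev_def by (intro integral_cong_AE) auto
    with pos show False by simp
  qed
next
  assume nc: "\<not> (\<exists>x. AE \<omega> in M. X n \<omega> = x)"
  show "0 < moment 2 n"
  proof (rule ccontr)
    assume "\<not> 0 < moment 2 n"
    moreover have "0 \<le> moment 2 n" by (rule moment_even_nonneg) simp
    ultimately have "expectation (\<lambda>\<omega>. (dev n \<omega>)\<^sup>2) = 0" unfolding moment_def by linarith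
    then have "AE \<omega> in M. (dev n \<omega>)\<^sup>2 = 0"
      by (subst (asm) integral_nonneg_eq_0_iff_AE) (auto intro!: bounded_rv_integrable bounded_rv_intros dev_bounded_rv)
    then have "AE \<omega> in M. X n \<omega> = mean n" by eventually_elim (simp add: dev_def)
    with nc show False by blast
  qed
qed

text \<open>
  Let \<open>A = \<Sum>\<bar>\<alpha>\<^sub>i\<bar>\<^sup>3 = \<phi> \<bar>\<alpha>\<bar>\<^sup>3\<close>. Discrepancies of order nearly \<open>A\<^sup>n\<close> and standard deviations of
  order nearly \<open>\<bar>\<alpha>\<bar>\<^sup>n\<close> give distances of order nearly \<open>\<phi>\<^sup>n\<close>. The slack between \<open>\<phi>\<close> and \<open>\<gamma>\<close> is
  spent by choosing \<open>u\<close> slightly below \<open>\<bar>\<alpha>\<bar>\<close> such that still \<open>A < \<gamma> u\<^sup>3\<close>.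
\<close>

lemma wasserstein_rate:
  assumes pos: "\<And>n. 0 < moment 2 n"
    and d: "\<And>n. stein_bounded (distr M borel (dev n)) (d n)"
    and d_rate: "\<And>s. (\<Sum>i\<in>UNIV. \<bar>\<alpha> $ i\<bar> ^ 3) < s \<Longrightarrow> \<exists>C>0. \<forall>n. d n \<le> C * s ^ n"
    and var_rate: "\<And>t. 0 < t \<Longrightarrow> t < (norm \<alpha>)\<^sup>2 \<Longrightarrow> \<exists>C>0. \<forall>n. C * t ^ n \<le> moment 2 n"
    and \<alpha>: "\<alpha> \<noteq> 0" and \<gamma>: "contraction_rate \<alpha> < \<gamma>"
  shows "\<exists>C::real. \<forall>n. wasserstein_dist (distr M borel (standardized M (X n))) std_normal_distribution \<le> ereal (C * \<gamma> ^ n)"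
proof -
  define A where "A = (\<Sum>i\<in>UNIV. \<bar>\<alpha> $ i\<bar> ^ 3)"
  define l where "l = norm \<alpha>"
  have l: "l > 0" using \<alpha> by (simp add: l_def)
  have A: "A = contraction_rate \<alpha> * l ^ 3" using \<alpha> by (simp add: contraction_rate_norm A_def l_def)
  have \<gamma>0: "\<gamma> > 0" using contraction_rate_pos[OF \<alpha>] \<gamma> by simp
  define q where "q = contraction_rate \<alpha> / \<gamma>"
  have q: "0 < q" "q < 1" using contraction_rate_pos[OF \<alpha>] \<gamma> \<gamma>0 by (auto simp: q_def)
  \<comment> \<open>Bernoulli's inequality gives \<open>(1 - e)\<^sup>3 \<ge> 1 - 3 * e\<close>, which exceeds \<open>q = 1 - 4 * e\<close>.\<close>
  define e where "e = (1 - q) / 4"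
  define u where "u = l * (1 - e)"
  have e: "0 < e" "e < 1" using q by (auto simp: e_def)
  have u: "0 < u" "u < l" using e l by (auto simp: u_def)
  have "q = 1 - 4 * e" by (simp add: e_def field_simps)
  then have "q < 1 - 3 * e" using e by simp
  also have "\<dots> \<le> (1 - e) ^ 3" 
  proof -
    have "(1 - e) ^ 3 = 1 - 3 * e + e\<^sup>2 * (3 - e)" by (simp add: power3_eq_cube power2_eq_square algebra_simps)
    moreover have "0 \<le> e\<^sup>2 * (3 - e)" using e by simp
    ultimately show ?thesis by linarith
  qed
  finally have "A < \<gamma> * u ^ 3"
    unfolding A u_def power_mult_distrib using \<gamma>0 l by (simp add: q_def field_simps)
  from d_rate[OF this[unfolded A_def]] obtain C1 where C1: "C1 > 0" "\<And>n. d n \<le> C1 * (\<gamma> * u ^ 3) ^ n" by blast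
  have "u\<^sup>2 < (norm \<alpha>)\<^sup>2" using u by (simp add: l_def power_strict_mono)
  then obtain C2 where C2: "C2 > 0" "\<And>n. C2 * (u\<^sup>2) ^ n \<le> moment 2 n" using var_rate[of "u\<^sup>2"] u by auto
  obtain C :: real where C: "C > 0" and wd:
    "\<And>(M :: 'a measure) Z d. prob_space M \<Longrightarrow> bounded_rv M Z \<Longrightarrow> prob_space.variance M Z > 0 \<Longrightarrow> 
       stein_bounded (distr M borel (\<lambda>\<omega>. Z \<omega> - prob_space.expectation M Z)) d \<Longrightarrow>
       wasserstein_dist (distr M borel (standardized M Z)) std_normal_distribution
         \<le> ereal (C * d / sqrt (prob_space.variance M Z) ^ 3)"
    using wasserstein_le_stein_bound by blast
  have "wasserstein_dist (distr M borel (standardized M (X n))) std_normal_distribution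
      \<le> ereal (C * C1 / sqrt C2 ^ 3 * \<gamma> ^ n)" for n
  proof -
    have "wasserstein_dist (distr M borel (standardized M (X n))) std_normal_distribution
        \<le> ereal (C * d n / sqrt (variance (X n)) ^ 3)"
      by (rule wd) (use prob_space_axioms X_bounded_rv pos d in \<open>auto simp: moment_2[symmetric] dev_def[abs_def] mean_def\<close>)
    also have "\<dots> \<le> ereal (C * C1 / sqrt C2 ^ 3 * \<gamma> ^ n)"
    proof -
      have s: "sqrt C2 * u ^ n \<le> sqrt (variance (X n))"
      proof -
        have "sqrt C2 * u ^ n = sqrt (C2 * (u\<^sup>2) ^ n)"
          using u by (simp add: real_sqrt_mult real_sqrt_power)
        also have "\<dots> \<le> sqrt (variance (X n))" using C2(2)[of n] by (simp add: moment_2)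
        finally show ?thesis .
      qed
      have "C * d n / sqrt (variance (X n)) ^ 3 \<le> C * (C1 * (\<gamma> * u ^ 3) ^ n) / sqrt (variance (X n)) ^ 3"
        using C C1(2)[of n] by (intro divide_right_mono mult_left_mono) auto
      also have "\<dots> \<le> C * (C1 * (\<gamma> * u ^ 3) ^ n) / (sqrt C2 * u ^ n) ^ 3"
        using C C1 \<gamma>0 u C2(1) s pos[of n, unfolded moment_2] by (intro divide_left_mono power_mono mult_pos_pos) auto
      also have "\<dots> = C * C1 / sqrt C2 ^ 3 * \<gamma> ^ n"
        using u C2(1) by (simp add: power_mult_distrib mult.commute field_simps flip: power_mult)
      finally show ?thesis by simp
    qed
    finally show ?thesis .
  qed
  then show ?thesis by blast
qed

end

section \<open>Tails of averaging recursions\<close>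

locale averaging_sequence = hierarchical_sequence M F X Y a b c
  for M :: "'a measure" and F :: "real ^ 'k \<Rightarrow> real" and X Y a b c +
  assumes card: "CARD('k) \<ge> 2" and avg: "averaging {a..b} F"
begin

text \<open>
  The potential \<open>\<psi>(u) = exp(B u)\<close> for \<open>u > \<eta>\<close>, and \<open>0\<close> otherwise, is applied to the signed
  deviation \<open>U\<close>. If \<open>U(F(x)) > \<eta>\<close>, then some \<open>U(x\<^sub>i)\<close> is at least as large. Either no other
  coordinate has \<open>U(x\<^sub>j) > \<eta>/2\<close>, and then the gap makes \<open>\<psi>(U(F(x)))\<close> smaller than \<open>\<psi>(U(x\<^sub>i))\<close> by
  the factor \<open>exp(-B \<delta>)\<close>; or there is a second outlier, which by independence contributes the
  vanishing factor \<open>Q n\<close>. Taking \<open>B\<close> large makes \<open>k exp(-B \<delta>)\<close> as small as desired, where \<open>k\<close> is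
  the number of possible \<open>i\<close>. The sign \<open>e\<close> selects the upper or the lower tail.
\<close>

lemma tail_geometric_signed:
  fixes e :: real
  assumes e: "\<bar>e\<bar> = 1"
    and max: "\<And>x. x \<in> cube {a..b} \<Longrightarrow> \<exists>i. e * (F x - c) \<le> e * (x $ i - c)"
    and gap: "\<delta> > 0" "\<And>x i. x \<in> cube {a..b} \<Longrightarrow> \<eta> \<le> e * (x $ i - c) \<Longrightarrow> 
      (\<And>j. j \<noteq> i \<Longrightarrow> e * (x $ j - c) \<le> \<eta> / 2) \<Longrightarrow> e * (F x - c) \<le> e * (x $ i - c) - \<delta>"
    and \<eta>: "\<eta> > 0" and \<theta>: "\<theta> > 0"
  shows "\<exists>C>0. \<forall>n. \<P>(\<omega> in M. \<eta> < e * (X n \<omega> - c)) \<le> C * \<theta> ^ n"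
proof -
  define U where "U x = e * (x - c)" for x
  define L where "L = \<bar>a\<bar> + \<bar>b\<bar> + \<bar>c\<bar>"
  define k where "k = real CARD('k)"
  \<comment> \<open>With this choice \<open>exp (- B * \<delta>) \<le> 1 / (B * \<delta>)\<close> makes the main coefficient at most \<open>\<theta> / 2\<close>.\<close>
  define B where "B = 2 * k / (\<theta> * \<delta>)"
  have k: "k > 0" by (simp add: k_def)
  have B: "B > 0" using k \<theta> gap(1) by (simp add: B_def)
  have small: "k * exp (- B * \<delta>) \<le> \<theta> / 2"
  proof -
    have "B * \<delta> \<le> exp (B * \<delta>)" using exp_ge_add_one_self[of "B * \<delta>"] by linarith
    then have "inverse (exp (B * \<delta>)) \<le> inverse (B * \<delta>)"
      by (rule le_imp_inverse_le) (use B gap(1) in simp)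
    then have "k * exp (- B * \<delta>) \<le> k * inverse (B * \<delta>)"
      using k by (intro mult_left_mono) (auto simp: exp_minus)
    also have "\<dots> = \<theta> / 2" using k \<theta> gap(1) by (simp add: B_def field_simps)
    finally show ?thesis .
  qed
  have [measurable]: "U \<in> borel_measurable borel" unfolding U_def by measurable
  define \<psi> where "\<psi> u = (if \<eta> < u then exp (B * u) else 0)" for u
  have [measurable]: "\<psi> \<in> borel_measurable borel" unfolding \<psi>_def by measurable
  have \<psi>_nonneg: "\<psi> u \<ge> 0" for u by (simp add: \<psi>_def)
  have U_le: "U x \<le> L" if "x \<in> {a..b}" for x
  proof -
    have "U x \<le> \<bar>e * (x - c)\<bar>" by (simp add: U_def)
    also have "\<dots> = \<bar>x - c\<bar>" using e by (simp add: abs_mult)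
    also have "\<dots> \<le> L" using that by (auto simp: L_def)
    finally show ?thesis .
  qed
  have \<psi>_le: "\<psi> (U x) \<le> exp (B * L)" if "x \<in> {a..b}" for x
    using U_le[OF that] B by (simp add: \<psi>_def)
  have \<psi>_bdd: "bounded_rv M (\<lambda>\<omega>. \<psi> (U (Z \<omega>)))" 
    if [measurable]: "Z \<in> borel_measurable M" and "AE \<omega> in M. Z \<omega> \<in> {a..b}" for Z
  proof -
    from that(2) have "AE \<omega> in M. \<bar>\<psi> (U (Z \<omega>))\<bar> \<le> exp (B * L)" 
      by eventually_elim (use \<psi>_le \<psi>_nonneg in \<open>simp add: abs_of_nonneg\<close>)
    moreover have "(\<lambda>\<omega>. \<psi> (U (Z \<omega>))) \<in> borel_measurable M" by measurable
    ultimately show ?thesis unfolding bounded_rv_def by blast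
  qed
  have Yr: "AE \<omega> in M. Y n i \<omega> \<in> {a..b}" for n i using Y_range[of n] by eventually_elim simp
  define b1 where "b1 x = (if \<eta> < U x then 1 else 0 :: real)" for x
  define b2 where "b2 x = (if \<eta> / 2 < U x then 1 else 0 :: real)" for x
  have [measurable]: "b1 \<in> borel_measurable borel" "b2 \<in> borel_measurable borel"
    unfolding b1_def b2_def by measurable
  have b_nonneg: "0 \<le> b1 x" "0 \<le> b2 x" for x by (simp_all add: b1_def b2_def)
  have b_bdd: "bounded_rv M (\<lambda>\<omega>. b1 (Z \<omega>))" "bounded_rv M (\<lambda>\<omega>. b2 (Z \<omega>))" 
    if [measurable]: "Z \<in> borel_measurable M" for Z
    unfolding b1_def b2_def by (rule bounded_rv_indicator_pred, measurable)+
  define u where "u n = expectation (\<lambda>\<omega>. \<psi> (U (X n \<omega>)))" for n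
  define Q where "Q n = \<P>(\<omega> in M. \<bar>X n \<omega> - c\<bar> > \<eta> / 2)" for n
  have tail: "expectation (\<lambda>\<omega>. b1 (X n \<omega>)) \<le> u n" for n
    unfolding u_def
  proof (rule bounded_rv_mono_AE[OF b_bdd(1) \<psi>_bdd])
    show "AE \<omega> in M. b1 (X n \<omega>) \<le> \<psi> (U (X n \<omega>))"
      using B \<eta> by (intro AE_I2) (auto simp: b1_def \<psi>_def)
  qed (use X_range in auto)
  have Q: "expectation (\<lambda>\<omega>. b2 (X n \<omega>)) \<le> Q n" for n
  proof -
    have "expectation (\<lambda>\<omega>. b2 (X n \<omega>)) = \<P>(\<omega> in M. \<eta> / 2 < U (X n \<omega>))"
      unfolding b2_def by (rule expectation_indicator_pred) measurable
    also have "\<dots> \<le> Q n" unfolding Q_def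
    proof (rule finite_measure_mono)
      show "{\<omega> \<in> space M. \<eta> / 2 < U (X n \<omega>)} \<subseteq> {\<omega> \<in> space M. \<eta> / 2 < \<bar>X n \<omega> - c\<bar>}"
      proof safe
        fix \<omega> assume "\<eta> / 2 < U (X n \<omega>)"
        also have "\<dots> \<le> \<bar>e * (X n \<omega> - c)\<bar>" by (simp add: U_def)
        also have "\<dots> = \<bar>X n \<omega> - c\<bar>" using e by (simp add: abs_mult)
        finally show "\<eta> / 2 < \<bar>X n \<omega> - c\<bar>" .
      qed
    qed measurable
    finally show ?thesis .
  qed
  have Q_nonneg: "0 \<le> Q n" for n by (simp add: Q_def)
  have u_nonneg: "0 \<le> u n" for n unfolding u_def using \<psi>_nonneg by simp
  define pairs where "pairs = {p :: 'k \<times> 'k. fst p \<noteq> snd p}"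
  have pointwise: "\<psi> (U (F x)) \<le> (\<Sum>i\<in>UNIV. exp (- B * \<delta>) * \<psi> (U (x $ i))) 
      + (\<Sum>(i, j)\<in>pairs. exp (B * L) * (b1 (x $ i) * b2 (x $ j)))" if x: "x \<in> cube {a..b}" for x
  proof -
    have s1: "0 \<le> (\<Sum>i\<in>UNIV. exp (- B * \<delta>) * \<psi> (U (x $ i)))" 
      using \<psi>_nonneg by (intro sum_nonneg) auto
    have s2: "0 \<le> (\<Sum>(i, j)\<in>pairs. exp (B * L) * (b1 (x $ i) * b2 (x $ j)))" 
      using b_nonneg by (intro sum_nonneg) auto
    show ?thesis
    proof (cases "\<eta> < U (F x)")
      case False
      then show ?thesis using s1 s2 by (simp add: \<psi>_def)
    next
      case True
      obtain i where i: "U (F x) \<le> U (x $ i)" using max[OF x] by (auto simp: U_def)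
      then have ib: "b1 (x $ i) = 1" using True by (simp add: b1_def)
      show ?thesis
      proof (cases "\<exists>j. j \<noteq> i \<and> \<eta> / 2 < U (x $ j)")
        case True
        then obtain j where j: "j \<noteq> i" "\<eta> / 2 < U (x $ j)" by blast
        have "\<psi> (U (F x)) \<le> exp (B * L)" using \<psi>_le F_range[OF x] by blast
        also have "\<dots> = (case (i, j) of (i, j) \<Rightarrow> exp (B * L) * (b1 (x $ i) * b2 (x $ j)))"
          using ib j by (simp add: b2_def)
        also have "\<dots> \<le> (\<Sum>(i, j)\<in>pairs. exp (B * L) * (b1 (x $ i) * b2 (x $ j)))"
          by (rule member_le_sum) (use j b_nonneg in \<open>auto simp: pairs_def\<close>)
        finally show ?thesis using s1 by linarith
      next
        case False
        then have "U (F x) \<le> U (x $ i) - \<delta>"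
          unfolding U_def using i True x by (intro gap(2)) (auto simp: U_def not_less)
        then have "B * U (F x) \<le> B * (U (x $ i) - \<delta>)" using B by (intro mult_left_mono) auto
        then have "B * U (F x) \<le> - B * \<delta> + B * U (x $ i)" by (simp add: algebra_simps) 
        then have "exp (B * U (F x)) \<le> exp (- B * \<delta>) * exp (B * U (x $ i))"
          unfolding exp_add[symmetric] by simp
        then have "\<psi> (U (F x)) \<le> exp (- B * \<delta>) * \<psi> (U (x $ i))"
          using True i by (simp add: \<psi>_def)
        also have "\<dots> \<le> (\<Sum>i\<in>UNIV. exp (- B * \<delta>) * \<psi> (U (x $ i)))"
          by (rule member_le_sum) (use \<psi>_nonneg in auto)
        finally show ?thesis using s2 by linarith
      qed
    qed
  qed
  have step: "u (Suc n) \<le> (k * exp (- B * \<delta>) + real (card pairs) * exp (B * L) * Q n) * u n" for n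
  proof -
    have pair: "expectation (\<lambda>\<omega>. b1 (Y n i \<omega>) * b2 (Y n j \<omega>)) \<le> u n * Q n" if "i \<noteq> j" for i j
    proof -
      have "indep_vars (\<lambda>_. borel) (Y n) (insert i {j})" by (rule indep_vars_subset[OF Y_indep]) auto
      from indep_vars_sum[OF _ _ this] that have ind: "indep_var borel (Y n i) borel (Y n j)" by simp
      have "expectation (\<lambda>\<omega>. b1 (Y n i \<omega>) * b2 (Y n j \<omega>)) 
          = expectation (\<lambda>\<omega>. b1 (Y n i \<omega>)) * expectation (\<lambda>\<omega>. b2 (Y n j \<omega>))"
        by (rule expectation_indep_mult[OF ind]) (auto intro: Y_bounded_rv b_bdd)
      also have "\<dots> = expectation (\<lambda>\<omega>. b1 (X n \<omega>)) * expectation (\<lambda>\<omega>. b2 (X n \<omega>))"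
        by (simp add: expectation_Y)
      also have "\<dots> \<le> u n * Q n"
        using tail Q b_nonneg u_nonneg by (intro mult_mono) auto
      finally show ?thesis .
    qed
    have "u (Suc n) \<le> expectation (\<lambda>\<omega>. (\<Sum>i\<in>UNIV. exp (- B * \<delta>) * \<psi> (U (Y n i \<omega>))) 
      + (\<Sum>(i, j)\<in>pairs. exp (B * L) * (b1 (Y n i \<omega>) * b2 (Y n j \<omega>))))"
      unfolding u_def
    proof (rule bounded_rv_mono_AE)
      show "AE \<omega> in M. \<psi> (U (X (Suc n) \<omega>)) \<le> (\<Sum>i\<in>UNIV. exp (- B * \<delta>) * \<psi> (U (Y n i \<omega>))) 
        + (\<Sum>(i, j)\<in>pairs. exp (B * L) * (b1 (Y n i \<omega>) * b2 (Y n j \<omega>)))"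
        using Y_cube[of n] X_step[of n] 
      proof eventually_elim
        case (elim \<omega>)
        then show ?case using pointwise[OF elim(1)] by simp
      qed
    qed (auto intro!: bounded_rv_intros \<psi>_bdd b_bdd Yr X_range simp: case_prod_beta)
    also have "\<dots> = (\<Sum>i\<in>(UNIV :: 'k set). exp (- B * \<delta>) * u n) 
        + (\<Sum>(i, j)\<in>pairs. exp (B * L) * expectation (\<lambda>\<omega>. b1 (Y n i \<omega>) * b2 (Y n j \<omega>)))"
    proof -
      have "expectation (\<lambda>\<omega>. \<psi> (U (Y n i \<omega>))) = u n" for i
        unfolding u_def by (rule expectation_Y[of "\<lambda>x. \<psi> (U x)"]) measurable
      then have "expectation (\<lambda>\<omega>. \<Sum>i\<in>UNIV. exp (- B * \<delta>) * \<psi> (U (Y n i \<omega>))) 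
          = (\<Sum>i\<in>(UNIV :: 'k set). exp (- B * \<delta>) * u n)"
        by (subst Bochner_Integration.integral_sum)
           (auto intro!: bounded_rv_integrable bounded_rv_intros \<psi>_bdd Yr)
      moreover have "expectation (\<lambda>\<omega>. \<Sum>(i, j)\<in>pairs. exp (B * L) * (b1 (Y n i \<omega>) * b2 (Y n j \<omega>)))
          = (\<Sum>(i, j)\<in>pairs. exp (B * L) * expectation (\<lambda>\<omega>. b1 (Y n i \<omega>) * b2 (Y n j \<omega>)))"
        unfolding case_prod_beta
        by (subst Bochner_Integration.integral_sum)
           (auto intro!: bounded_rv_integrable bounded_rv_intros b_bdd)
      ultimately show ?thesis
        by (subst Bochner_Integration.integral_add)
           (auto intro!: bounded_rv_integrable bounded_rv_intros \<psi>_bdd b_bdd Yr simp: case_prod_beta)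
    qed
    also have "\<dots> \<le> k * (exp (- B * \<delta>) * u n) + (\<Sum>(i, j)\<in>pairs. exp (B * L) * (u n * Q n))"
      unfolding k_def by (intro add_mono sum_mono) (auto simp: pairs_def intro: pair)
    also have "\<dots> = (k * exp (- B * \<delta>) + real (card pairs) * exp (B * L) * Q n) * u n"
      by (simp add: case_prod_beta algebra_simps)
    finally show ?thesis .
  qed
  have "\<exists>C>0. \<forall>n. u n \<le> C * \<theta> ^ n"
  proof (rule geometric_recursion_upper[where K = 0 and q = 0])
    show "\<forall>\<^sub>F n in sequentially. u (Suc n) 
        \<le> (k * exp (- B * \<delta>) + real (card pairs) * exp (B * L) * Q n) * u n + 0 * 0 ^ n"
      using step by simp
    have "Q \<longlonglongrightarrow> 0" unfolding Q_def[abs_def] by (rule deviation_tail_vanishes) (use \<eta> in simp)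
    then show "(\<lambda>n. k * exp (- B * \<delta>) + real (card pairs) * exp (B * L) * Q n) 
        \<longlonglongrightarrow> k * exp (- B * \<delta>) + real (card pairs) * exp (B * L) * 0"
      by (intro tendsto_intros)
  qed (use small \<theta> u_nonneg in auto)
  then obtain C where C: "C > 0" "\<And>n. u n \<le> C * \<theta> ^ n" by blast
  have "\<P>(\<omega> in M. \<eta> < e * (X n \<omega> - c)) \<le> C * \<theta> ^ n" for n
  proof -
    have "\<P>(\<omega> in M. \<eta> < e * (X n \<omega> - c)) = expectation (\<lambda>\<omega>. b1 (X n \<omega>))"
      unfolding b1_def U_def by (rule expectation_indicator_pred[symmetric]) measurable
    also have "\<dots> \<le> C * \<theta> ^ n" using tail[of n] C(2)[of n] by linarith
    finally show ?thesis .
  qed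
  then show ?thesis using C(1) by blast
qed

lemma tail_geometric:
  assumes \<eta>: "\<eta> > 0" and \<theta>: "\<theta> > 0"
  shows "\<exists>C>0. \<forall>n. \<P>(\<omega> in M. \<eta> < \<bar>X n \<omega> - c\<bar>) \<le> C * \<theta> ^ n"
proof -
  obtain \<delta>1 where \<delta>1: "\<delta>1 > 0" "\<And>x i. x \<in> cube {a..b} \<Longrightarrow> c + \<eta> \<le> x $ i \<Longrightarrow> 
      (\<And>j. j \<noteq> i \<Longrightarrow> x $ j \<le> c + \<eta> / 2) \<Longrightarrow> F x \<le> x $ i - \<delta>1"
    using averaging_one_large[OF avg F_cont card limit_range \<eta>] by auto
  have "\<exists>C>0. \<forall>n. \<P>(\<omega> in M. \<eta> < 1 * (X n \<omega> - c)) \<le> C * \<theta> ^ n"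
  proof (rule tail_geometric_signed[of 1 \<delta>1, OF _ _ \<delta>1(1) _ \<eta> \<theta>])
    show "\<exists>i. 1 * (F x - c) \<le> 1 * (x $ i - c)" if "x \<in> cube {a..b}" for x
      using averaging_cubeD(2)[OF avg that] by auto
    fix x :: "real ^ 'k" and i
    assume x: "x \<in> cube {a..b}" and i: "\<eta> \<le> 1 * (x $ i - c)" and j: "\<And>j. j \<noteq> i \<Longrightarrow> 1 * (x $ j - c) \<le> \<eta> / 2"
    have "F x \<le> x $ i - \<delta>1"
    proof (rule \<delta>1(2)[OF x])
      show "x $ j \<le> c + \<eta> / 2" if "j \<noteq> i" for j using j[OF that] by simp
    qed (use i in simp)
    then show "1 * (F x - c) \<le> 1 * (x $ i - c) - \<delta>1" by simp
  qed simp
  then obtain C1 where C1: "C1 > 0" "\<And>n. \<P>(\<omega> in M. \<eta> < X n \<omega> - c) \<le> C1 * \<theta> ^ n" by auto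
  obtain \<delta>2 where \<delta>2: "\<delta>2 > 0" "\<And>x i. x \<in> cube {a..b} \<Longrightarrow> x $ i \<le> c - \<eta> \<Longrightarrow> 
      (\<And>j. j \<noteq> i \<Longrightarrow> c - \<eta> / 2 \<le> x $ j) \<Longrightarrow> x $ i + \<delta>2 \<le> F x"
    using averaging_one_small[OF avg F_cont card limit_range \<eta>] by auto
  have "\<exists>C>0. \<forall>n. \<P>(\<omega> in M. \<eta> < - 1 * (X n \<omega> - c)) \<le> C * \<theta> ^ n"
  proof (rule tail_geometric_signed[of "-1" \<delta>2, OF _ _ \<delta>2(1) _ \<eta> \<theta>])
    show "\<exists>i. - 1 * (F x - c) \<le> - 1 * (x $ i - c)" if "x \<in> cube {a..b}" for x
      using averaging_cubeD(1)[OF avg that] by auto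
    fix x :: "real ^ 'k" and i
    assume x: "x \<in> cube {a..b}" and i: "\<eta> \<le> - 1 * (x $ i - c)" and j: "\<And>j. j \<noteq> i \<Longrightarrow> - 1 * (x $ j - c) \<le> \<eta> / 2"
    have "x $ i + \<delta>2 \<le> F x"
    proof (rule \<delta>2(2)[OF x])
      show "c - \<eta> / 2 \<le> x $ j" if "j \<noteq> i" for j using j[OF that] by simp
    qed (use i in simp)
    then show "- 1 * (F x - c) \<le> - 1 * (x $ i - c) - \<delta>2" by simp
  qed simp
  then obtain C2 where C2: "C2 > 0" "\<And>n. \<P>(\<omega> in M. \<eta> < - (X n \<omega> - c)) \<le> C2 * \<theta> ^ n" by auto
  have "\<P>(\<omega> in M. \<eta> < \<bar>X n \<omega> - c\<bar>) \<le> (C1 + C2) * \<theta> ^ n" for n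
  proof -
    have "\<P>(\<omega> in M. \<eta> < \<bar>X n \<omega> - c\<bar>) 
        \<le> prob ({\<omega> \<in> space M. \<eta> < X n \<omega> - c} \<union> {\<omega> \<in> space M. \<eta> < - (X n \<omega> - c)})"
      by (rule finite_measure_mono) auto
    also have "\<dots> \<le> \<P>(\<omega> in M. \<eta> < X n \<omega> - c) + \<P>(\<omega> in M. \<eta> < - (X n \<omega> - c))"
      by (rule measure_Un_le) measurable
    also have "\<dots> \<le> (C1 + C2) * \<theta> ^ n" using C1(2)[of n] C2(2)[of n] by (simp add: distrib_right)
    finally show ?thesis .
  qed
  then show ?thesis using C1(1) C2(1) by (intro exI[of _ "C1 + C2"]) auto
qed

text \<open>
  If \<open>X (Suc n) = t\<close> almost surely, then the event that all \<open>Y n i\<close> are below \<open>t\<close> is null, as \<open>F\<close>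
  is at most the maximum; by independence \<open>X n < t\<close> is null as well. The same holds for values
  above \<open>t\<close>.
\<close>

lemma X_nonconst: "\<not> (\<exists>x. AE \<omega> in M. X n \<omega> = x)"
proof (induction n)
  case 0 show ?case by (rule X0_nonconst)
next
  case (Suc n)
  show ?case
  proof
    assume "\<exists>x. AE \<omega> in M. X (Suc n) \<omega> = x"
    then obtain t where t: "AE \<omega> in M. X (Suc n) \<omega> = t" ..
    have null: "AE \<omega> in M. X n \<omega> \<notin> A"
      if [measurable]: "A \<in> sets borel" and A: "\<And>x. x \<in> cube {a..b} \<Longrightarrow> F x = t \<Longrightarrow> \<exists>i. x $ i \<notin> A" for A
    proof -
      have "AE \<omega> in M. \<omega> \<notin> (\<Inter>i\<in>UNIV. Y n i -` A \<inter> space M)"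
        using t X_step[of n] Y_cube[of n]
      proof eventually_elim
        case (elim \<omega>)
        from A[OF elim(3)] elim(1,2) show ?case by auto
      qed
      then have "prob (\<Inter>i\<in>UNIV. Y n i -` A \<inter> space M) = 0"
        by (subst prob_eq_0) (auto intro!: sets.finite_INT)
      also have "prob (\<Inter>i\<in>UNIV. Y n i -` A \<inter> space M) = (\<Prod>i\<in>UNIV. prob (Y n i -` A \<inter> space M))"
        by (rule indep_varsD[OF Y_indep]) auto
      finally obtain i where "prob (Y n i -` A \<inter> space M) = 0" by auto
      then have "AE \<omega> in M. Y n i \<omega> \<notin> A"
        by (subst (asm) prob_eq_0) (auto elim!: AE_mp)
      then show ?thesis by (subst (asm) AE_Y_iff) auto
    qed
    have "AE \<omega> in M. X n \<omega> \<notin> {..<t}"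
      by (rule null) (use averaging_cubeD(2)[OF avg] in \<open>auto simp: not_less\<close>)
    moreover have "AE \<omega> in M. X n \<omega> \<notin> {t<..}"
      by (rule null) (use averaging_cubeD(1)[OF avg] in \<open>auto simp: not_less\<close>)
    ultimately have "AE \<omega> in M. X n \<omega> = t" by eventually_elim auto
    with Suc show False by blast
  qed
qed

lemma variance_pos: "0 < moment 2 n"
  using X_nonconst variance_pos_iff by blast

end

section \<open>A lower bound for the variance\<close>

definition clamp_real :: "real \<Rightarrow> real \<Rightarrow> real \<Rightarrow> real" where "clamp_real p q t = max p (min q t)"

lemma clamp_real_mono: "s \<le> t \<Longrightarrow> clamp_real p q s \<le> clamp_real p q t"
  by (auto simp: clamp_real_def)

lemma clamp_real_mem: "p \<le> q \<Longrightarrow> clamp_real p q t \<in> {p..q}"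
  by (auto simp: clamp_real_def)

lemma clamp_real_id: "t \<in> {p..q} \<Longrightarrow> clamp_real p q t = t"
  by (auto simp: clamp_real_def)

lemma clamp_real_nonexpansive: "\<bar>clamp_real p q s - clamp_real p q t\<bar> \<le> \<bar>s - t\<bar>"
  by (auto simp: clamp_real_def max_def min_def)

lemma borel_measurable_clamp [measurable]: "clamp_real p q \<in> borel_measurable borel"
  unfolding clamp_real_def[abs_def] by measurable

lemma borel_measurable_vec_lambda:
  assumes [measurable]: "\<And>j. f j \<in> borel_measurable M"
  shows "(\<lambda>x. (\<chi> j. f j x) :: real ^ 'k) \<in> borel_measurable M"
  by (subst borel_measurable_euclidean_space) (auto simp: Basis_vec_def inner_axis)

definition vec_upd :: "'k \<Rightarrow> real ^ 'k \<Rightarrow> real \<Rightarrow> real ^ 'k" where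
  "vec_upd i y t = (\<chi> j. if j = i then t else y $ j)"

text \<open>
  Near the diagonal \<open>F\<close> has slope at least \<open>\<kappa>\<close> in coordinate \<open>i\<close>; outside the box nothing is
  known except monotonicity. Truncating arguments and values to the box makes the slope bound hold
  for all \<open>x\<close>: monotonicity lets an argument outside the box be moved to its boundary, and
  averaging keeps values in the box there.
\<close>

lemma averaging_coordinate_expansion:
  fixes F :: "real ^ 'k \<Rightarrow> real"
  assumes F: "averaging {a..b} F"
    and deriv: "\<And>x. x \<in> cube {a..b} \<Longrightarrow> (F has_derivative (\<lambda>h. G x \<bullet> h)) (at x within cube {a..b})"
    and G: "\<And>x. x \<in> cube {p..q} \<Longrightarrow> \<kappa> \<le> G x $ i"
    and pq: "a \<le> p" "p \<le> q" "q \<le> b" and \<kappa>: "0 \<le> \<kappa>"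
    and y: "\<And>j. j \<noteq> i \<Longrightarrow> y $ j \<in> {p..q}" and x: "a \<le> x" "x \<le> x'" "x' \<le> b"
  shows "\<kappa> * (clamp_real p q x' - clamp_real p q x) \<le> clamp_real p q (F (vec_upd i y x')) - clamp_real p q (F (vec_upd i y x))"
proof -
  define h where "h t = F (vec_upd i y t)" for t
  have in_cube: "vec_upd i y t \<in> cube {a..b}" if "t \<in> {a..b}" for t
    using that y pq by (force simp: cube_def vec_upd_def)
  have in_box: "vec_upd i y t \<in> cube {p..q}" if "t \<in> {p..q}" for t
    using that y by (auto simp: cube_def vec_upd_def)
  have mono: "h s \<le> h t" if "a \<le> s" "s \<le> t" "t \<le> b" for s t
    unfolding h_def by (rule averaging_mono[OF F in_cube in_cube]) (use that in \<open>auto simp: vec_upd_def\<close>)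
  have box: "h t \<in> {p..q}" if "t \<in> {p..q}" for t
  proof -
    have c: "vec_upd i y t \<in> cube {a..b}" using that pq by (intro in_cube) auto
    have "vec_upd i y t $ j \<in> {p..q}" for j using in_box[OF that] by (auto simp: cube_def)
    then show ?thesis using averaging_cubeD[OF F c] unfolding h_def
      by (metis atLeastAtMost_iff order_trans)
  qed
  have slope: "\<kappa> * (t - s) \<le> h t - h s" if st: "p \<le> s" "s \<le> t" "t \<le> q" for s t
  proof -
    have "\<exists>z\<in>{s..t}. h t - h s = (\<lambda>d. G (vec_upd i y z) \<bullet> (d *\<^sub>R axis i 1)) (t - s)"
    proof (rule mvt_very_simple[OF st(2)])
      fix z assume z: "s \<le> z" "z \<le> t"
      have "((\<lambda>t. vec_upd i y z + (t - z) *\<^sub>R axis i 1) has_derivative (\<lambda>d. d *\<^sub>R axis i 1)) (at z within {s..t})"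
        by (auto intro!: derivative_eq_intros)
      moreover have "(\<lambda>t. vec_upd i y z + (t - z) *\<^sub>R axis i 1) = vec_upd i y"
        by (auto simp: vec_upd_def vec_eq_iff axis_def)
      ultimately have 1: "(vec_upd i y has_derivative (\<lambda>d. d *\<^sub>R axis i 1)) (at z within {s..t})" by simp
      have sub: "vec_upd i y ` {s..t} \<subseteq> cube {a..b}" using st pq by (intro image_subsetI in_cube) auto
      have "(F has_derivative (\<lambda>h. G (vec_upd i y z) \<bullet> h)) (at (vec_upd i y z) within vec_upd i y ` {s..t})"
        by (rule has_derivative_subset[OF deriv sub]) (use z st pq in \<open>auto intro!: in_cube\<close>)
      from diff_chain_within[OF 1 this]
      show "(h has_derivative (\<lambda>d. G (vec_upd i y z) \<bullet> (d *\<^sub>R axis i 1))) (at z within {s..t})"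
        by (simp add: h_def[abs_def] comp_def)
    qed
    then obtain z where z: "z \<in> {s..t}" "h t - h s = (t - s) * G (vec_upd i y z) $ i"
      by (auto simp: inner_axis)
    have "\<kappa> \<le> G (vec_upd i y z) $ i" using z(1) st by (intro G in_box) auto
    then have "(t - s) * \<kappa> \<le> (t - s) * G (vec_upd i y z) $ i" using st by (intro mult_left_mono) auto
    then show ?thesis using z(2) by (simp add: mult.commute)
  qed
  show ?thesis
  proof (cases "x' < p \<or> q < x")
    case True
    then have "clamp_real p q x' = clamp_real p q x" using x pq by (auto simp: clamp_real_def)
    then show ?thesis using clamp_real_mono mono[OF x] by (simp add: h_def)
  next
    case False
    let ?s = "clamp_real p q x" and ?t = "clamp_real p q x'"
    have st: "p \<le> ?s" "?s \<le> ?t" "?t \<le> q" using pq x clamp_real_mono by (auto simp: clamp_real_def)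
    have "?t \<le> x'" "x \<le> ?s" using False pq x by (auto simp: clamp_real_def)
    then have "h ?t \<le> h x'" "h x \<le> h ?s" using st pq x by (auto intro!: mono)
    then have "clamp_real p q (h ?t) \<le> clamp_real p q (h x')" "clamp_real p q (h x) \<le> clamp_real p q (h ?s)" 
      by (auto intro: clamp_real_mono)
    moreover have "clamp_real p q (h ?t) = h ?t" "clamp_real p q (h ?s) = h ?s"
      using st by (auto intro!: clamp_real_id box)
    ultimately show ?thesis using slope[OF st] by (simp add: h_def)
  qed
qed

locale smooth_averaging_sequence = averaging_sequence M F X Y a b c
  for M :: "'a measure" and F :: "real ^ 'k \<Rightarrow> real" and X Y a b c +
  fixes G :: "real ^ 'k \<Rightarrow> real ^ 'k" and K :: real
  assumes K: "K \<ge> 0" and G_cont: "continuous_on (cube {a..b}) G"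
    and F_deriv: "\<And>x. x \<in> cube {a..b} \<Longrightarrow> (F has_derivative (\<lambda>h. G x \<bullet> h)) (at x within cube {a..b})"
    and F_taylor: "\<And>x y. x \<in> cube {a..b} \<Longrightarrow> y \<in> cube {a..b} \<Longrightarrow> 
      \<bar>F y - F x - G x \<bullet> (y - x)\<bar> \<le> K * (norm (y - x))\<^sup>2"
begin

lemma indep_coordinate:
  assumes [measurable]: "\<Psi> \<in> borel_measurable (Pi\<^sub>M (UNIV - {i}) (\<lambda>_. borel))"
  shows "indep_var borel (Y n i) borel (\<lambda>\<omega>. \<Psi> (restrict (\<lambda>j. Y n j \<omega>) (UNIV - {i})))"
proof -
  have "indep_var (Pi\<^sub>M {i} (\<lambda>_. borel)) (\<lambda>\<omega>. restrict (\<lambda>j. Y n j \<omega>) {i})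
      (Pi\<^sub>M (UNIV - {i}) (\<lambda>_. borel)) (\<lambda>\<omega>. restrict (\<lambda>j. Y n j \<omega>) (UNIV - {i}))"
    by (rule indep_var_restrict[OF Y_indep]) auto
  then have "indep_var borel ((\<lambda>f. f i) \<circ> (\<lambda>\<omega>. restrict (\<lambda>j. Y n j \<omega>) {i}))
      borel (\<Psi> \<circ> (\<lambda>\<omega>. restrict (\<lambda>j. Y n j \<omega>) (UNIV - {i})))"
    by (rule indep_var_compose) auto
  then show ?thesis by (simp add: comp_def)
qed

text \<open>
  Let \<open>W\<close> be the truncated next value, \<open>D\<close> the centred truncation of the copy \<open>i\<close>, and \<open>A\<close> the
  indicator that all other copies lie in the box. On this event let \<open>Q\<close> be the value of \<open>W\<close> with
  argument \<open>i\<close> replaced by the mean \<open>m\<close> of the truncation. Since \<open>W - Q\<close> has the sign of \<open>D\<close> and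
  at least \<open>\<kappa>\<close> times its size, the covariance of \<open>W\<close> and \<open>D A\<close> is at least \<open>\<kappa> v P(A)\<close>; the
  contribution of \<open>Q\<close> vanishes because \<open>Q\<close> and \<open>D\<close> are independent. The Cauchy--Schwarz inequality
  turns this into a bound for the variance of \<open>W\<close>.
\<close>

lemma clamped_variance_step:
  fixes p q \<kappa> :: real and i :: 'k
  assumes pq: "a \<le> p" "p \<le> q" "q \<le> b" and \<kappa>: "0 \<le> \<kappa>"
    and G: "\<And>x. x \<in> cube {p..q} \<Longrightarrow> \<kappa> \<le> G x $ i"
  shows "\<kappa>\<^sup>2 * variance (\<lambda>\<omega>. clamp_real p q (X n \<omega>)) * \<P>(\<omega> in M. \<forall>j. j \<noteq> i \<longrightarrow> Y n j \<omega> \<in> {p..q})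
    \<le> variance (\<lambda>\<omega>. clamp_real p q (X (Suc n) \<omega>))"
proof -
  define cl where "cl = clamp_real p q"
  have [measurable]: "cl \<in> borel_measurable borel" by (simp add: cl_def)
  have cl_bdd: "bounded_rv M (\<lambda>\<omega>. cl (Z \<omega>))" if [measurable]: "Z \<in> borel_measurable M" for Z
  proof -
    have "\<bar>cl x\<bar> \<le> \<bar>p\<bar> + \<bar>q\<bar>" for x using clamp_real_mem[OF pq(2), of x] by (auto simp: cl_def)
    then show ?thesis unfolding bounded_rv_def by (auto intro!: exI[of _ "\<bar>p\<bar> + \<bar>q\<bar>"])
  qed
  define m where "m = expectation (\<lambda>\<omega>. cl (X n \<omega>))"
  define v where "v = variance (\<lambda>\<omega>. cl (X n \<omega>))"
  have m: "m \<in> {p..q}"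
  proof -
    have "p \<le> m" "m \<le> q" unfolding m_def
      using clamp_real_mem[OF pq(2)] bounded_rv_integrable[OF cl_bdd[OF X_measurable]]
      by (auto intro!: integral_ge_const integral_le_const simp: cl_def)
    then show ?thesis by simp
  qed
  have cl_m: "cl m = m" unfolding cl_def by (rule clamp_real_id[OF m])
  define A where "A \<omega> = (if \<forall>j. j \<noteq> i \<longrightarrow> Y n j \<omega> \<in> {p..q} then 1 else 0 :: real)" for \<omega>
  define PA where "PA = \<P>(\<omega> in M. \<forall>j. j \<noteq> i \<longrightarrow> Y n j \<omega> \<in> {p..q})"
  have A_bdd: "bounded_rv M A" unfolding A_def by (rule bounded_rv_indicator_pred) measurable
  have A_sq: "(A \<omega>)\<^sup>2 = A \<omega>" for \<omega> by (simp add: A_def)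
  have EA: "expectation A = PA" unfolding A_def PA_def by (rule expectation_indicator_pred) measurable
  define D where "D \<omega> = cl (Y n i \<omega>) - m" for \<omega>
  have D_bdd: "bounded_rv M D" unfolding D_def by (intro bounded_rv_intros cl_bdd) measurable
  have ED: "expectation D = 0"
    unfolding D_def using bounded_rv_integrable[OF cl_bdd[OF Y_measurable]]
    by (simp add: prob_space expectation_Y[of cl] m_def)
  have ED2: "expectation (\<lambda>\<omega>. (D \<omega>)\<^sup>2) = v"
    unfolding D_def v_def m_def[symmetric] by (rule expectation_Y[of "\<lambda>x. (cl x - m)\<^sup>2"]) measurable
  \<comment> \<open>Nothing is known about \<open>F\<close> outside the cube; cutting it off there makes it measurable.\<close>
  define F0 where "F0 x = (if x \<in> cube {a..b} then F x else 0)" for x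
  have [measurable]: "F0 \<in> borel_measurable borel" unfolding F0_def
    by (intro borel_measurable_continuous_on_if F_cont) (auto simp: cube_eq_cbox)
  define \<Phi> where "\<Phi> f = (if \<forall>j\<in>UNIV - {i}. f j \<in> {p..q} then cl (F0 (\<chi> j. if j = i then m else f j)) else 0)" 
    for f :: "'k \<Rightarrow> real"
  define A0 where "A0 f = (if \<forall>j\<in>UNIV - {i}. f j \<in> {p..q} then 1 else 0 :: real)" for f :: "'k \<Rightarrow> real"
  let ?P = "Pi\<^sub>M (UNIV - {i}) (\<lambda>_. borel :: real measure)"
  have comp [measurable]: "(\<lambda>f. if j = i then m else f j) \<in> borel_measurable ?P" for j
    by (cases "j = i") auto
  have vec [measurable]: "(\<lambda>f. (\<chi> j. if j = i then m else f j)) \<in> borel_measurable ?P"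
    by (rule borel_measurable_vec_lambda) measurable
  have A0_meas [measurable]: "A0 \<in> borel_measurable ?P" unfolding A0_def by measurable
  have \<Phi>_meas [measurable]: "\<Phi> \<in> borel_measurable ?P"
    unfolding \<Phi>_def by measurable
  define Q where "Q \<omega> = \<Phi> (restrict (\<lambda>j. Y n j \<omega>) (UNIV - {i}))" for \<omega>
  have A_eq: "A \<omega> = A0 (restrict (\<lambda>j. Y n j \<omega>) (UNIV - {i}))" for \<omega>
    by (simp add: A_def A0_def)
  have indQ: "indep_var borel (Y n i) borel Q" unfolding Q_def[abs_def] by (rule indep_coordinate) measurable
  have indA: "indep_var borel (Y n i) borel A" unfolding A_eq[abs_def] by (rule indep_coordinate) measurable
  have Q_bdd: "bounded_rv M Q"
  proof -
    have "\<bar>Q \<omega>\<bar> \<le> \<bar>p\<bar> + \<bar>q\<bar>" for \<omega> 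
      using clamp_real_mem[OF pq(2)] by (auto simp: Q_def \<Phi>_def cl_def abs_le_iff) (smt (verit) atLeastAtMost_iff)+
    moreover have "Q \<in> borel_measurable M" using indQ by (rule indep_var_rv2)
    ultimately show ?thesis unfolding bounded_rv_def by auto
  qed
  have DZ: "expectation (\<lambda>\<omega>. (cl (Y n i \<omega>) - m) * Z \<omega>) = 0" 
    if ind: "indep_var borel (Y n i) borel Z" and Z: "bounded_rv M Z" for Z
  proof -
    have "expectation (\<lambda>\<omega>. (cl (Y n i \<omega>) - m) * Z \<omega>) = expectation (\<lambda>\<omega>. cl (Y n i \<omega>) - m) * expectation Z"
      by (rule expectation_indep_mult[OF ind Y_bounded_rv Z _ _ D_bdd[unfolded D_def[abs_def]] Z]) measurable
    also have "expectation (\<lambda>\<omega>. cl (Y n i \<omega>) - m) = 0" using ED unfolding D_def[abs_def] .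
    finally show ?thesis by simp
  qed
  have EDQ: "expectation (\<lambda>\<omega>. D \<omega> * Q \<omega>) = 0" unfolding D_def by (rule DZ[OF indQ Q_bdd])
  have EDA: "expectation (\<lambda>\<omega>. D \<omega> * A \<omega>) = 0" unfolding D_def by (rule DZ[OF indA A_bdd])
  have ED2A: "expectation (\<lambda>\<omega>. (D \<omega>)\<^sup>2 * A \<omega>) = v * PA"
  proof -
    have "expectation (\<lambda>\<omega>. (cl (Y n i \<omega>) - m)\<^sup>2 * A \<omega>) = expectation (\<lambda>\<omega>. (cl (Y n i \<omega>) - m)\<^sup>2) * expectation A"
      by (rule expectation_indep_mult[OF indA Y_bounded_rv A_bdd, of "\<lambda>x. (cl x - m)\<^sup>2" "\<lambda>x. x",
            OF _ _ bounded_rv_power[OF D_bdd, unfolded D_def] A_bdd]) measurable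
    then show ?thesis using ED2 EA unfolding D_def by simp
  qed
  define W where "W \<omega> = cl (X (Suc n) \<omega>)" for \<omega>
  have W_bdd: "bounded_rv M W" unfolding W_def by (rule cl_bdd) measurable
  define w where "w = expectation W"
  note int = bounded_rv_integrable bounded_rv_intros W_bdd D_bdd A_bdd Q_bdd
  have lower: "AE \<omega> in M. \<kappa> * ((D \<omega>)\<^sup>2 * A \<omega>) + D \<omega> * Q \<omega> \<le> W \<omega> * (D \<omega> * A \<omega>)"
    using X_step[of n] Y_cube[of n]
  proof eventually_elim
    case (elim \<omega>)
    show ?case
    proof (cases "\<forall>j. j \<noteq> i \<longrightarrow> Y n j \<omega> \<in> {p..q}")
      case False
      then show ?thesis by (auto simp: A_def Q_def \<Phi>_def)
    next
      case True
      define y where "y = (\<chi> j. Y n j \<omega>)"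
      define x where "x = Y n i \<omega>"
      have x: "x \<in> {a..b}" using elim(2) by (auto simp: cube_def x_def)
      have yx: "vec_upd i y x = (\<chi> j. Y n j \<omega>)" by (auto simp: vec_upd_def y_def x_def vec_eq_iff)
      have ym: "vec_upd i y m = (\<chi> j. if j = i then m else restrict (\<lambda>j. Y n j \<omega>) (UNIV - {i}) j)" 
        by (auto simp: vec_upd_def y_def vec_eq_iff)
      have yj: "y $ j \<in> {p..q}" if "j \<noteq> i" for j using True that by (simp add: y_def)
      have cub: "vec_upd i y m \<in> cube {a..b}" using m pq yj by (force simp: cube_def vec_upd_def)
      have W: "W \<omega> = cl (F (vec_upd i y x))" using elim(1) by (simp add: W_def yx)
      have Q: "Q \<omega> = cl (F (vec_upd i y m))"
        using True cub unfolding Q_def \<Phi>_def F0_def ym by auto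
      have D: "D \<omega> = cl x - m" by (simp add: D_def x_def)
      have A: "A \<omega> = 1" using True by (simp add: A_def)
      have key: "\<kappa> * (D \<omega>)\<^sup>2 \<le> (W \<omega> - Q \<omega>) * D \<omega>"
      proof (cases "m \<le> x")
        case True
        have "\<kappa> * (cl x - cl m) \<le> W \<omega> - Q \<omega>"
          unfolding W Q unfolding cl_def
          by (rule averaging_coordinate_expansion[OF avg F_deriv G pq \<kappa> yj]) (use m pq x True in auto)
        moreover have "0 \<le> D \<omega>" using clamp_real_mono[OF True, of p q] cl_m by (simp add: D cl_def)
        ultimately have "\<kappa> * (cl x - cl m) * D \<omega> \<le> (W \<omega> - Q \<omega>) * D \<omega>" by (rule mult_right_mono)
        then show ?thesis by (simp add: D cl_m power2_eq_square mult.assoc)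
      next
        case False
        have "\<kappa> * (cl m - cl x) \<le> Q \<omega> - W \<omega>"
          unfolding W Q unfolding cl_def
          by (rule averaging_coordinate_expansion[OF avg F_deriv G pq \<kappa> yj]) (use m pq x False in auto)
        moreover have "0 \<le> - D \<omega>" using False clamp_real_mono[of x m p q] cl_m by (simp add: D cl_def)
        ultimately have "\<kappa> * (cl m - cl x) * (- D \<omega>) \<le> (Q \<omega> - W \<omega>) * (- D \<omega>)" by (rule mult_right_mono)
        then show ?thesis by (simp add: D cl_m power2_eq_square algebra_simps)
      qed
      then show ?thesis by (simp add: A algebra_simps)
    qed
  qed
  have "\<kappa> * (v * PA) = expectation (\<lambda>\<omega>. \<kappa> * ((D \<omega>)\<^sup>2 * A \<omega>) + D \<omega> * Q \<omega>)"
    by (subst Bochner_Integration.integral_add, (intro int)+) (simp add: EDQ ED2A)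
  also have "\<dots> \<le> expectation (\<lambda>\<omega>. W \<omega> * (D \<omega> * A \<omega>))"
    by (rule bounded_rv_mono_AE[OF _ _ lower]) (intro int)+
  also have "\<dots> = expectation (\<lambda>\<omega>. (W \<omega> - w) * (D \<omega> * A \<omega>))"
    unfolding left_diff_distrib 
    by (subst Bochner_Integration.integral_diff, (intro int)+) (simp add: EDA)
  finally have cov: "\<kappa> * (v * PA) \<le> expectation (\<lambda>\<omega>. (W \<omega> - w) * (D \<omega> * A \<omega>))" .
  have v0: "0 \<le> v" and PA0: "0 \<le> PA" by (simp_all add: v_def PA_def)
  have "(\<kappa> * (v * PA))\<^sup>2 \<le> (expectation (\<lambda>\<omega>. (W \<omega> - w) * (D \<omega> * A \<omega>)))\<^sup>2"
    using cov \<kappa> v0 PA0 by (intro power_mono) auto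
  also have "\<dots> \<le> expectation (\<lambda>\<omega>. (W \<omega> - w)\<^sup>2) * expectation (\<lambda>\<omega>. (D \<omega> * A \<omega>)\<^sup>2)"
    by (rule expectation_Cauchy_Schwarz) (intro int)+
  also have "expectation (\<lambda>\<omega>. (D \<omega> * A \<omega>)\<^sup>2) = v * PA"
    by (simp add: power_mult_distrib A_sq ED2A)
  finally have "(v * PA) * (\<kappa>\<^sup>2 * (v * PA)) \<le> (v * PA) * expectation (\<lambda>\<omega>. (W \<omega> - w)\<^sup>2)"
    by (simp add: power2_eq_square mult_ac)
  moreover have "0 \<le> v * PA" using v0 PA0 by simp
  ultimately have "\<kappa>\<^sup>2 * (v * PA) \<le> expectation (\<lambda>\<omega>. (W \<omega> - w)\<^sup>2)"
    by (cases "v * PA = 0") (auto simp: mult_le_cancel_left)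
  then show ?thesis by (simp add: v_def PA_def w_def W_def[abs_def] cl_def mult.assoc)
qed

end

text \<open>
  According to which of \<open>\<bar>y\<bar>\<close> and \<open>t \<bar>x\<bar>\<close> is larger, one of the two terms alone suffices. Small
  \<open>t\<close> leaves the coefficient of \<open>x\<^sup>4\<close> close to \<open>1\<close>.
\<close>

lemma power4_add_le: "(x + y) ^ 4 \<le> (1 + t) ^ 4 * x ^ 4 + (1 + 1 / t) ^ 4 * y ^ 4" if t: "0 < t" for x y t :: real
proof (cases "\<bar>y\<bar> \<le> t * \<bar>x\<bar>")
  case True
  then have "\<bar>x + y\<bar> \<le> (1 + t) * \<bar>x\<bar>" by (simp add: distrib_right)
  then have "\<bar>x + y\<bar> ^ 4 \<le> ((1 + t) * \<bar>x\<bar>) ^ 4" by (intro power_mono) auto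
  then have "(x + y) ^ 4 \<le> (1 + t) ^ 4 * x ^ 4" by (simp add: power_mult_distrib)
  moreover have "0 \<le> (1 + 1 / t) ^ 4 * y ^ 4" using t by (intro mult_nonneg_nonneg) auto
  ultimately show ?thesis by linarith
next
  case False
  then have "\<bar>x\<bar> \<le> \<bar>y\<bar> / t" using t by (simp add: field_simps)
  then have "\<bar>x + y\<bar> \<le> (1 + 1 / t) * \<bar>y\<bar>" by (simp add: distrib_right)
  then have "\<bar>x + y\<bar> ^ 4 \<le> ((1 + 1 / t) * \<bar>y\<bar>) ^ 4" by (intro power_mono) auto
  then have "(x + y) ^ 4 \<le> (1 + 1 / t) ^ 4 * y ^ 4" by (simp add: power_mult_distrib)
  moreover have "0 \<le> (1 + t) ^ 4 * x ^ 4" using t by (intro mult_nonneg_nonneg) auto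
  ultimately show ?thesis by linarith
qed

lemma square_sum_le_card:
  fixes f :: "'k::finite \<Rightarrow> real"
  shows "(\<Sum>i\<in>UNIV. f i)\<^sup>2 \<le> real CARD('k) * (\<Sum>i\<in>UNIV. (f i)\<^sup>2)"
  using Cauchy_Schwarz_ineq_sum[of "\<lambda>_. 1" f UNIV] by simp

context smooth_averaging_sequence
begin

text \<open>
  This is the vector \<open>\<alpha>\<close> of the theorem, and it is called \<open>\<alpha>\<close> in the comments below.
\<close>

definition limit_grad :: "real ^ 'k" where "limit_grad = G (vec c)"

lemma vec_mean_cube: "vec (mean n) \<in> cube {a..b}" and vec_limit_cube: "vec c \<in> cube {a..b}"
  by (intro vec_mem_cube mean_range limit_range)+

lemma limit_grad_nonneg: "0 \<le> limit_grad $ i" and limit_grad_sum: "(\<Sum>i\<in>UNIV. limit_grad $ i) = 1"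
  using averaging_gradient[OF avg F_deriv[OF vec_limit_cube] ab limit_range] by (simp_all add: limit_grad_def)

definition grad :: "nat \<Rightarrow> real ^ 'k" where "grad n = G (vec (mean n))"

lemma grad_tendsto: "grad \<longlonglongrightarrow> limit_grad"
  unfolding grad_def[abs_def] limit_grad_def
proof (rule continuous_on_tendsto_compose[OF G_cont _ vec_limit_cube])
  show "(\<lambda>n. vec (mean n)) \<longlonglongrightarrow> (vec c :: real ^ 'k)"
    by (rule vec_tendstoI) (simp add: mean_tendsto)
qed (simp add: vec_mean_cube)

lemma copies_concentrate:
  assumes \<eta>: "\<eta> > 0"
  shows "(\<lambda>n. \<P>(\<omega> in M. \<forall>j. j \<noteq> i \<longrightarrow> Y n j \<omega> \<in> {max a (c - \<eta>)..min b (c + \<eta>)})) \<longlonglongrightarrow> 1"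
proof -
  define P where "P n = \<P>(\<omega> in M. \<forall>j. j \<noteq> i \<longrightarrow> Y n j \<omega> \<in> {max a (c - \<eta>)..min b (c + \<eta>)})" for n
  define Q where "Q n = \<P>(\<omega> in M. \<eta> < \<bar>X n \<omega> - c\<bar>)" for n
  have "1 - real CARD('k) * Q n \<le> P n" for n
  proof -
    have ind: "expectation (\<lambda>\<omega>. if \<eta> < \<bar>Y n j \<omega> - c\<bar> then 1 else 0) = Q n" for j
    proof -
      have "expectation (\<lambda>\<omega>. if \<eta> < \<bar>Y n j \<omega> - c\<bar> then 1 else 0 :: real) = expectation (\<lambda>\<omega>. if \<eta> < \<bar>X n \<omega> - c\<bar> then 1 else 0)"
        by (rule expectation_Y[of "\<lambda>x. if \<eta> < \<bar>x - c\<bar> then 1 else 0"]) measurable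
      also have "\<dots> = Q n" unfolding Q_def by (rule expectation_indicator_pred) measurable
      finally show ?thesis .
    qed
    have bdd: "bounded_rv M (\<lambda>\<omega>. if \<eta> < \<bar>Y n j \<omega> - c\<bar> then 1 else 0)" for j
      by (rule bounded_rv_indicator_pred) measurable
    have "1 - real CARD('k) * Q n = expectation (\<lambda>\<omega>. 1 - (\<Sum>j\<in>UNIV. if \<eta> < \<bar>Y n j \<omega> - c\<bar> then 1 else 0))"
      by (subst Bochner_Integration.integral_diff, (intro bounded_rv_integrable bounded_rv_intros bdd)+,
          subst Bochner_Integration.integral_sum, (intro bounded_rv_integrable bdd)) (simp add: prob_space ind)
    also have "\<dots> \<le> expectation (\<lambda>\<omega>. if \<forall>j. j \<noteq> i \<longrightarrow> Y n j \<omega> \<in> {max a (c - \<eta>)..min b (c + \<eta>)} then 1 else 0)"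
    proof (rule bounded_rv_mono_AE)
      show "AE \<omega> in M. 1 - (\<Sum>j\<in>UNIV. if \<eta> < \<bar>Y n j \<omega> - c\<bar> then 1 else 0) 
          \<le> (if \<forall>j. j \<noteq> i \<longrightarrow> Y n j \<omega> \<in> {max a (c - \<eta>)..min b (c + \<eta>)} then 1 else 0 :: real)"
        using Y_range[of n]
      proof eventually_elim
        case (elim \<omega>)
        have nn: "0 \<le> (\<Sum>j\<in>UNIV. if \<eta> < \<bar>Y n j \<omega> - c\<bar> then 1 else 0 :: real)" by (intro sum_nonneg) auto
        show ?case
        proof (cases "\<forall>j. j \<noteq> i \<longrightarrow> Y n j \<omega> \<in> {max a (c - \<eta>)..min b (c + \<eta>)}")
          case True then show ?thesis using nn by simp
        next
          case False
          then obtain j where "Y n j \<omega> \<notin> {max a (c - \<eta>)..min b (c + \<eta>)}" by blast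
          moreover have "Y n j \<omega> \<in> {a..b}" using elim by blast
          ultimately have "\<eta> < \<bar>Y n j \<omega> - c\<bar>" by auto
          then have "1 = (if \<eta> < \<bar>Y n j \<omega> - c\<bar> then 1 else 0 :: real)" by simp
          also have "\<dots> \<le> (\<Sum>j\<in>UNIV. if \<eta> < \<bar>Y n j \<omega> - c\<bar> then 1 else 0)"
            by (rule member_le_sum) auto
          finally show ?thesis using False by simp
        qed
      qed
    next
      show "bounded_rv M (\<lambda>\<omega>. if \<forall>j. j \<noteq> i \<longrightarrow> Y n j \<omega> \<in> {max a (c - \<eta>)..min b (c + \<eta>)} then 1 else 0)"
        by (rule bounded_rv_indicator_pred) measurable
    qed (intro bounded_rv_intros bdd)
    also have "\<dots> = P n" unfolding P_def by (rule expectation_indicator_pred) measurable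
    finally show ?thesis .
  qed
  moreover have "P n \<le> 1" for n by (simp add: P_def)
  moreover have "(\<lambda>n. 1 - real CARD('k) * Q n) \<longlonglongrightarrow> 1 - real CARD('k) * 0"
    unfolding Q_def by (intro tendsto_intros deviation_tail_vanishes \<eta>)
  ultimately have "P \<longlonglongrightarrow> 1"
    by (intro tendsto_sandwich[of "\<lambda>n. 1 - real CARD('k) * Q n" P sequentially "\<lambda>_. 1"]) auto
  then show ?thesis by (simp add: P_def[abs_def])
qed

text \<open>
  Some partial derivative at \<open>(c,\<dots>,c)\<close> is positive, hence bounded below by \<open>\<kappa>\<close> in a box around
  this point. The truncated variance is then multiplied by at least \<open>\<kappa>\<^sup>2/2\<close> in each late step. It
  is positive at some late time: otherwise the truncation is constant. Values within \<open>\<eta>/2\<close> of \<open>c\<close>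
  occur with positive probability and are not changed by truncation, so this constant is within
  \<open>\<eta>/2\<close> of \<open>c\<close>; no value of \<open>X\<close> outside the box is truncated to such a constant, and \<open>X\<close> itself
  would be constant.
\<close>

lemma variance_decays_at_most_geometrically:
  "\<exists>\<kappa>>0. \<exists>C>0. eventually (\<lambda>n. C * \<kappa> ^ n \<le> moment 2 n) sequentially"
proof -
  obtain i where i: "0 < limit_grad $ i"
    using limit_grad_sum limit_grad_nonneg by (metis less_eq_real_def sum.neutral zero_neq_one)
  define \<kappa> where "\<kappa> = limit_grad $ i / 2"
  have \<kappa>: "\<kappa> > 0" using i by (simp add: \<kappa>_def)
  obtain r where r: "r > 0" "\<And>x. x \<in> cube {a..b} \<Longrightarrow> dist x (vec c) < r \<Longrightarrow> dist (G x) limit_grad < \<kappa>"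
    using G_cont vec_limit_cube \<kappa> unfolding continuous_on_iff limit_grad_def by blast
  define k where "k = real CARD('k)"
  have k: "k > 0" by (simp add: k_def)
  define \<eta> where "\<eta> = r / (2 * k)"
  have \<eta>: "\<eta> > 0" using r k by (simp add: \<eta>_def)
  define p where "p = max a (c - \<eta>)"
  define q where "q = min b (c + \<eta>)"
  have pq: "a \<le> p" "p \<le> q" "q \<le> b" using limit_range ab \<eta> by (auto simp: p_def q_def)
  have G: "\<kappa> \<le> G x $ i" if x: "x \<in> cube {p..q}" for x
  proof -
    have xj: "x $ j \<in> {p..q}" for j using x by (simp add: cube_def)
    have "x $ j \<in> {a..b}" for j using xj[of j] pq by auto
    then have xab: "x \<in> cube {a..b}" by (simp add: cube_def)
    have "dist x (vec c) \<le> (\<Sum>j\<in>UNIV. \<bar>(x - vec c) $ j\<bar>)" unfolding dist_norm by (rule norm_le_l1_cart)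
    also have "\<dots> \<le> (\<Sum>j\<in>(UNIV :: 'k set). \<eta>)"
    proof (rule sum_mono)
      fix j show "\<bar>(x - vec c) $ j\<bar> \<le> \<eta>" using xj[of j] by (auto simp: p_def q_def)
    qed
    also have "\<dots> = r / 2" using k by (simp add: \<eta>_def k_def)
    also have "\<dots> < r" using r by simp
    finally have "dist (G x) limit_grad < \<kappa>" by (rule r(2)[OF xab])
    then have "\<bar>(G x - limit_grad) $ i\<bar> < \<kappa>" using component_le_norm_cart[of "G x - limit_grad" i] by (simp add: dist_norm)
    then have "\<bar>G x $ i - limit_grad $ i\<bar> < \<kappa>" by simp
    moreover have "limit_grad $ i = 2 * \<kappa>" by (simp add: \<kappa>_def)
    ultimately show ?thesis by linarith
  qed
  define v where "v n = variance (\<lambda>\<omega>. clamp_real p q (X n \<omega>))" for n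
  have cl_bdd: "bounded_rv M (\<lambda>\<omega>. clamp_real p q (X n \<omega>))" for n
  proof -
    have "\<bar>clamp_real p q x\<bar> \<le> \<bar>p\<bar> + \<bar>q\<bar>" for x using clamp_real_mem[OF pq(2), of x] by auto
    then show ?thesis unfolding bounded_rv_def by (auto intro!: exI[of _ "\<bar>p\<bar> + \<bar>q\<bar>"])
  qed
  have v_le: "v n \<le> moment 2 n" for n
  proof -
    have "v n \<le> expectation (\<lambda>\<omega>. (clamp_real p q (X n \<omega>) - clamp_real p q (mean n))\<^sup>2)"
      unfolding v_def by (rule variance_le_second_moment[OF cl_bdd])
    also have "\<dots> \<le> moment 2 n" unfolding moment_def
    proof (rule bounded_rv_mono_AE)
      show "AE \<omega> in M. (clamp_real p q (X n \<omega>) - clamp_real p q (mean n))\<^sup>2 \<le> (dev n \<omega>)\<^sup>2"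
        unfolding dev_def by (intro AE_I2) (simp only: abs_le_square_iff[symmetric] clamp_real_nonexpansive)
    qed (intro bounded_rv_intros cl_bdd dev_bounded_rv)+
    finally show ?thesis .
  qed
  define PA where "PA n = \<P>(\<omega> in M. \<forall>j. j \<noteq> i \<longrightarrow> Y n j \<omega> \<in> {p..q})" for n
  have "PA \<longlonglongrightarrow> 1" unfolding PA_def[abs_def] p_def q_def by (rule copies_concentrate[OF \<eta>])
  then have "eventually (\<lambda>n. 1 / 2 < PA n) sequentially" by (rule order_tendstoD) simp
  moreover have "eventually (\<lambda>n. \<P>(\<omega> in M. \<bar>X n \<omega> - c\<bar> > \<eta> / 2) < 1) sequentially"
    using deviation_tail_vanishes[of "\<eta> / 2"] \<eta> by (intro order_tendstoD) auto
  ultimately have "eventually (\<lambda>n. 1 / 2 < PA n \<and> \<P>(\<omega> in M. \<bar>X n \<omega> - c\<bar> > \<eta> / 2) < 1) sequentially"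
    by eventually_elim simp
  then obtain N where N: "\<And>n. n \<ge> N \<Longrightarrow> 1 / 2 < PA n" "\<P>(\<omega> in M. \<bar>X N \<omega> - c\<bar> > \<eta> / 2) < 1"
    unfolding eventually_sequentially by blast
  have step: "\<kappa>\<^sup>2 / 2 * v n \<le> v (Suc n)" if n: "n \<ge> N" for n
  proof -
    have "\<kappa>\<^sup>2 / 2 * v n = \<kappa>\<^sup>2 * v n * (1 / 2)" by simp
    also have "\<dots> \<le> \<kappa>\<^sup>2 * v n * PA n" using N(1)[OF n] by (intro mult_left_mono) (auto simp: v_def)
    also have "\<dots> \<le> v (Suc n)" unfolding v_def PA_def
      by (rule clamped_variance_step[OF pq _ G]) (use \<kappa> in auto)
    finally show ?thesis .
  qed
  have vN: "v N > 0"
  proof (rule ccontr)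
    assume "\<not> v N > 0"
    moreover have "0 \<le> v N" by (simp add: v_def)
    ultimately have "v N = 0" by linarith
    define m where "m = expectation (\<lambda>\<omega>. clamp_real p q (X N \<omega>))"
    have "AE \<omega> in M. (clamp_real p q (X N \<omega>) - m)\<^sup>2 = 0"
      using \<open>v N = 0\<close> unfolding v_def m_def[symmetric]
      by (subst (asm) integral_nonneg_eq_0_iff_AE) (auto intro!: bounded_rv_integrable bounded_rv_intros cl_bdd)
    then have m: "AE \<omega> in M. clamp_real p q (X N \<omega>) = m" by eventually_elim simp
    have "\<not> (AE \<omega> in M. \<bar>X N \<omega> - c\<bar> > \<eta> / 2)"
    proof
      assume "AE \<omega> in M. \<bar>X N \<omega> - c\<bar> > \<eta> / 2"
      then have "\<P>(\<omega> in M. \<bar>X N \<omega> - c\<bar> > \<eta> / 2) = 1" by (subst prob_Collect_eq_1) auto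
      with N(2) show False by simp
    qed
    have m_near: "m \<in> {c - \<eta> / 2..c + \<eta> / 2}"
    proof (rule ccontr)
      assume nm: "m \<notin> {c - \<eta> / 2..c + \<eta> / 2}"
      have "AE \<omega> in M. \<bar>X N \<omega> - c\<bar> > \<eta> / 2"
        using m X_range[of N]
      proof eventually_elim
        case (elim \<omega>)
        show ?case
        proof (rule ccontr)
          assume "\<not> \<bar>X N \<omega> - c\<bar> > \<eta> / 2"
          then have near: "c - \<eta> / 2 \<le> X N \<omega>" "X N \<omega> \<le> c + \<eta> / 2" by linarith+
          then have "c - \<eta> \<le> X N \<omega>" "X N \<omega> \<le> c + \<eta>" using \<eta> by linarith+
          then have "X N \<omega> \<in> {p..q}" "X N \<omega> \<in> {c - \<eta> / 2..c + \<eta> / 2}" 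
            using elim(2) near by (auto simp: p_def q_def)
          then show False using elim(1) nm clamp_real_id by metis
        qed
      qed
      with \<open>\<not> (AE \<omega> in M. \<bar>X N \<omega> - c\<bar> > \<eta> / 2)\<close> show False by blast
    qed
    have "AE \<omega> in M. X N \<omega> = m"
      using m X_range[of N] by eventually_elim (use \<eta> m_near in \<open>auto simp: clamp_real_def p_def q_def max_def min_def split: if_splits\<close>)
    with X_nonconst show False by blast
  qed
  have pos: "v (n + N) > 0" for n
  proof (induction n)
    case (Suc n)
    have "0 < \<kappa>\<^sup>2 / 2 * v (n + N)" using Suc \<kappa> by simp
    also have "\<dots> \<le> v (Suc (n + N))" by (rule step) simp
    finally show ?case by simp
  qed (use vN in simp)
  have "\<exists>C>0. \<forall>n. C * (\<kappa>\<^sup>2 / 4) ^ n \<le> v (n + N)"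
    by (rule geometric_recursion_lower[where r = "\<lambda>_. \<kappa>\<^sup>2 / 2" and \<rho> = "\<kappa>\<^sup>2 / 2"])
       (use pos step \<kappa> in \<open>auto intro!: always_eventually\<close>)
  then obtain C where C: "C > 0" "\<And>n. C * (\<kappa>\<^sup>2 / 4) ^ n \<le> v (n + N)" by blast
  have "eventually (\<lambda>n. C / (\<kappa>\<^sup>2 / 4) ^ N * (\<kappa>\<^sup>2 / 4) ^ n \<le> moment 2 n) sequentially"
    unfolding eventually_sequentially
  proof (intro exI[of _ N] allI impI)
    fix n assume "N \<le> n"
    then have "C / (\<kappa>\<^sup>2 / 4) ^ N * (\<kappa>\<^sup>2 / 4) ^ n = C * (\<kappa>\<^sup>2 / 4) ^ (n - N)" using \<kappa> by (simp add: power_diff)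
    also have "\<dots> \<le> v n" using C(2)[of "n - N"] \<open>N \<le> n\<close> by simp
    also have "\<dots> \<le> moment 2 n" by (rule v_le)
    finally show "C / (\<kappa>\<^sup>2 / 4) ^ N * (\<kappa>\<^sup>2 / 4) ^ n \<le> moment 2 n" .
  qed
  then show ?thesis using \<kappa> C(1) by (intro exI[of _ "\<kappa>\<^sup>2 / 4"] conjI exI[of _ "C / (\<kappa>\<^sup>2 / 4) ^ N"]) auto
qed

text \<open>
  Once the mean is within \<open>\<eta>/2\<close> of \<open>c\<close>, one of the two factors \<open>dev\<^sup>p\<close> of \<open>dev\<^sup>2\<^sup>p\<close> is at most
  \<open>\<eta>\<^sup>p\<close> on the event \<open>\<bar>X - c\<bar> \<le> \<eta>/2\<close>. The complement has probability below \<open>D (\<kappa>/2)\<^sup>n\<close>, which is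
  negligible against the lower bound \<open>C \<kappa>\<^sup>n\<close> of the moment.
\<close>

lemma higher_moment_negligible:
  assumes p: "even p" "p > 0" and lower: "\<kappa> > 0" "C > 0" "eventually (\<lambda>n. C * \<kappa> ^ n \<le> moment p n) sequentially"
  shows "(\<lambda>n. moment (2 * p) n / moment p n) \<longlonglongrightarrow> 0"
proof (rule LIMSEQ_I)
  fix \<epsilon> :: real assume \<epsilon>: "\<epsilon> > 0"
  define \<eta> where "\<eta> = min (1 / 2) (\<epsilon> / 3)"
  have \<eta>: "0 < \<eta>" "\<eta> \<le> 1" "\<eta> \<le> \<epsilon> / 3" using \<epsilon> by (auto simp: \<eta>_def)
  have \<eta>p: "\<eta> ^ p \<le> \<epsilon> / 3" using power_decreasing[of 1 p \<eta>] \<eta> p by simp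
  define L where "L = b - a"
  have L: "L > 0" using ab by (simp add: L_def)
  obtain D where D: "D > 0" "\<And>n. \<P>(\<omega> in M. \<eta> / 2 < \<bar>X n \<omega> - c\<bar>) \<le> D * (\<kappa> / 2) ^ n"
    using tail_geometric[of "\<eta> / 2" "\<kappa> / 2"] \<eta> lower by auto
  have "(\<lambda>n. L ^ (2 * p) * D * (1 / 2) ^ n) \<longlonglongrightarrow> L ^ (2 * p) * D * 0"
    by (intro tendsto_intros) auto
  then have "eventually (\<lambda>n. L ^ (2 * p) * D * (1 / 2) ^ n < \<epsilon> / 3 * C) sequentially"
    by (rule order_tendstoD) (use \<epsilon> lower in simp)
  moreover have "eventually (\<lambda>n. dist (mean n) c < \<eta> / 2) sequentially"
    using tendstoD[OF mean_tendsto, of "\<eta> / 2"] \<eta> by simp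
  ultimately have "eventually (\<lambda>n. norm (moment (2 * p) n / moment p n - 0) < \<epsilon>) sequentially"
    using lower(3)
  proof eventually_elim
    case (elim n)
    have pos: "0 < moment p n" using elim(3) lower by (smt (verit) mult_pos_pos zero_less_power)
    have bdd: "bounded_rv M (\<lambda>\<omega>. if \<eta> / 2 < \<bar>X n \<omega> - c\<bar> then 1 else 0)"
      by (rule bounded_rv_indicator_pred) measurable
    have "moment (2 * p) n \<le> expectation (\<lambda>\<omega>. \<eta> ^ p * dev n \<omega> ^ p + L ^ (2 * p) * (if \<eta> / 2 < \<bar>X n \<omega> - c\<bar> then 1 else 0))"
      unfolding moment_def
    proof (rule bounded_rv_mono_AE)
      show "AE \<omega> in M. dev n \<omega> ^ (2 * p) \<le> \<eta> ^ p * dev n \<omega> ^ p + L ^ (2 * p) * (if \<eta> / 2 < \<bar>X n \<omega> - c\<bar> then 1 else 0)"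
        using X_range[of n]
      proof eventually_elim
        case (elim \<omega>)
        have dp: "\<bar>dev n \<omega>\<bar> ^ p = dev n \<omega> ^ p" by (rule power_even_abs[OF p(1)])
        have d2p: "dev n \<omega> ^ (2 * p) = \<bar>dev n \<omega>\<bar> ^ p * \<bar>dev n \<omega>\<bar> ^ p"
          unfolding dp by (simp add: mult_2 power_add)
        show ?case
        proof (cases "\<eta> / 2 < \<bar>X n \<omega> - c\<bar>")
          case True
          have "\<bar>dev n \<omega>\<bar> \<le> L" using elim mean_range[of n] by (auto simp: dev_def L_def abs_le_iff)
          then have "\<bar>dev n \<omega>\<bar> ^ (2 * p) \<le> L ^ (2 * p)" by (intro power_mono) auto
          moreover have "\<bar>dev n \<omega>\<bar> ^ (2 * p) = dev n \<omega> ^ (2 * p)" by (rule power_even_abs) simp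
          moreover have "0 \<le> \<eta> ^ p * dev n \<omega> ^ p" using \<eta> unfolding dp[symmetric] by simp
          ultimately show ?thesis using True by simp
        next
          case False
          have "\<bar>dev n \<omega>\<bar> \<le> \<eta>" using False \<open>dist (mean n) c < \<eta> / 2\<close>
            unfolding dev_def dist_real_def by linarith
          then have "\<bar>dev n \<omega>\<bar> ^ p * \<bar>dev n \<omega>\<bar> ^ p \<le> \<eta> ^ p * \<bar>dev n \<omega>\<bar> ^ p"
            by (intro mult_right_mono power_mono) auto
          then show ?thesis using False by (simp add: d2p dp)
        qed
      qed
    qed (intro bounded_rv_intros dev_bounded_rv bdd)+
    also have "\<dots> = \<eta> ^ p * moment p n + L ^ (2 * p) * \<P>(\<omega> in M. \<eta> / 2 < \<bar>X n \<omega> - c\<bar>)"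
      unfolding moment_def
      by (subst Bochner_Integration.integral_add, (intro bounded_rv_integrable bounded_rv_intros dev_bounded_rv bdd)+)
         (simp add: expectation_indicator_pred)
    also have "\<dots> \<le> \<epsilon> / 3 * moment p n + L ^ (2 * p) * (D * (\<kappa> / 2) ^ n)"
      using \<eta>p pos D(2)[of n] L by (intro add_mono mult_right_mono mult_left_mono) auto
    also have "L ^ (2 * p) * (D * (\<kappa> / 2) ^ n) = L ^ (2 * p) * D * (1 / 2) ^ n * \<kappa> ^ n"
      by (simp add: power_divide)
    also have "\<dots> \<le> \<epsilon> / 3 * C * \<kappa> ^ n" using elim(1) lower by (intro mult_right_mono) auto
    also have "\<dots> \<le> \<epsilon> / 3 * moment p n" using elim(3) \<epsilon> by (simp add: mult.assoc mult_left_mono)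
    finally have "moment (2 * p) n \<le> 2 * \<epsilon> / 3 * moment p n" by simp
    also have "\<dots> < \<epsilon> * moment p n" using pos \<epsilon> by simp
    finally have "moment (2 * p) n / moment p n < \<epsilon>" using pos by (simp add: divide_less_eq)
    moreover have "0 \<le> moment (2 * p) n / moment p n" using pos moment_even_nonneg[of "2 * p" n] by simp
    ultimately show ?case by simp
  qed
  then show "\<exists>no. \<forall>n\<ge>no. norm (moment (2 * p) n / moment p n - 0) < \<epsilon>"
    by (simp add: eventually_sequentially)
qed

end

section \<open>The averaging case\<close>

context smooth_averaging_sequence
begin

text \<open>
  The difference of the centred next value and the centred linear part is the Taylor remainder
  minus its mean, hence again of second order in the deviations.
\<close>

definition remainder :: "nat \<Rightarrow> 'a \<Rightarrow> real" where
  "remainder n \<omega> = dev (Suc n) \<omega> - linear_part (grad n) n \<omega>"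

lemma remainder_bounded_rv: "bounded_rv M (remainder n)"
  unfolding remainder_def[abs_def] by (intro bounded_rv_intros dev_bounded_rv linear_part_bounded_rv)

lemma remainder_moments:
  defines "k \<equiv> real CARD('k)"
  shows "expectation (\<lambda>\<omega>. (remainder n \<omega>)\<^sup>2) \<le> K\<^sup>2 * k\<^sup>2 * moment 4 n"
    and "expectation (\<lambda>\<omega>. remainder n \<omega> ^ 4) \<le> 16 * K ^ 4 * k ^ 4 * moment 8 n"
proof -
  \<comment> \<open>Then \<open>R\<close> below is the Taylor remainder, and \<open>- t\<close> its mean.\<close>
  define t where "t = F (vec (mean n)) - mean (Suc n)"
  define R where "R \<omega> = remainder n \<omega> - t" for \<omega>
  have k: "k > 0" by (simp add: k_def)
  have R_bdd: "bounded_rv M R" unfolding R_def by (intro bounded_rv_intros remainder_bounded_rv)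
  note int = bounded_rv_integrable bounded_rv_intros R_bdd remainder_bounded_rv copy_dev_bounded_rv
  have Erem: "expectation (remainder n) = 0"
    unfolding remainder_def[abs_def]
    by (subst Bochner_Integration.integral_diff, (intro bounded_rv_integrable dev_bounded_rv linear_part_bounded_rv)+)
       (simp add: moment_1 linear_part_moments(1))
  have ER: "expectation R = - t" unfolding R_def
    by (subst Bochner_Integration.integral_diff, (intro int)+) (simp add: Erem prob_space)
  define N where "N \<omega> = (\<Sum>i\<in>UNIV. (copy_dev n i \<omega>)\<^sup>2)" for \<omega>
  have R_le: "AE \<omega> in M. \<bar>R \<omega>\<bar> \<le> K * N \<omega>"
    using X_step[of n] Y_cube[of n]
  proof eventually_elim
    case (elim \<omega>)
    define y where "y = (\<chi> i. Y n i \<omega>)"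
    have "norm (y - vec (mean n)) ^ 2 = N \<omega>"
      by (simp add: norm_sq_sum N_def copy_dev_def y_def)
    moreover have "grad n \<bullet> (y - vec (mean n)) = linear_part (grad n) n \<omega>"
      by (simp add: inner_vec_def linear_part_def copy_dev_def y_def)
    ultimately have "\<bar>F y - F (vec (mean n)) - linear_part (grad n) n \<omega>\<bar> \<le> K * N \<omega>"
      using F_taylor[OF vec_mean_cube[of n] elim(2)] unfolding y_def[symmetric] grad_def[symmetric] by simp
    moreover have "R \<omega> = F y - F (vec (mean n)) - linear_part (grad n) n \<omega>"
      using elim(1) by (simp add: R_def remainder_def t_def dev_def y_def)
    ultimately show ?case by simp
  qed
  have N_nonneg: "0 \<le> N \<omega>" for \<omega> by (simp add: N_def sum_nonneg)
  have N2: "(N \<omega>)\<^sup>2 \<le> k * (\<Sum>i\<in>UNIV. copy_dev n i \<omega> ^ 4)" for \<omega>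
    using square_sum_le_card[of "\<lambda>i. (copy_dev n i \<omega>)\<^sup>2"] by (simp add: N_def k_def flip: power_mult)
  have N4: "N \<omega> ^ 4 \<le> k ^ 3 * (\<Sum>i\<in>UNIV. copy_dev n i \<omega> ^ 8)" for \<omega>
  proof -
    have "N \<omega> ^ 4 = ((N \<omega>)\<^sup>2)\<^sup>2" by (simp flip: power_mult)
    also have "\<dots> \<le> (k * (\<Sum>i\<in>UNIV. copy_dev n i \<omega> ^ 4))\<^sup>2" using N2 by (intro power_mono) auto
    also have "\<dots> = k\<^sup>2 * (\<Sum>i\<in>UNIV. copy_dev n i \<omega> ^ 4)\<^sup>2" by (simp add: power_mult_distrib)
    also have "(\<Sum>i\<in>UNIV. copy_dev n i \<omega> ^ 4)\<^sup>2 \<le> k * (\<Sum>i\<in>UNIV. (copy_dev n i \<omega> ^ 4)\<^sup>2)"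
      unfolding k_def by (rule square_sum_le_card)
    also have "k\<^sup>2 * (k * (\<Sum>i\<in>UNIV. (copy_dev n i \<omega> ^ 4)\<^sup>2)) = k ^ 3 * (\<Sum>i\<in>UNIV. copy_dev n i \<omega> ^ 8)"
      by (simp add: power3_eq_cube power2_eq_square mult.assoc flip: power_mult power_add)
    finally show ?thesis using k by (simp add: mult_left_mono)
  qed
  have copies: "expectation (\<lambda>\<omega>. \<Sum>i\<in>UNIV. copy_dev n i \<omega> ^ p) = k * moment p n" for p
    by (subst Bochner_Integration.integral_sum, (intro int)+) (simp add: copy_dev_moment k_def)
  have R2: "expectation (\<lambda>\<omega>. (R \<omega>)\<^sup>2) \<le> K\<^sup>2 * k\<^sup>2 * moment 4 n"
  proof -
    have "expectation (\<lambda>\<omega>. (R \<omega>)\<^sup>2) \<le> expectation (\<lambda>\<omega>. K\<^sup>2 * k * (\<Sum>i\<in>UNIV. copy_dev n i \<omega> ^ 4))"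
    proof (rule bounded_rv_mono_AE)
      show "AE \<omega> in M. (R \<omega>)\<^sup>2 \<le> K\<^sup>2 * k * (\<Sum>i\<in>UNIV. copy_dev n i \<omega> ^ 4)"
        using R_le
      proof eventually_elim
        case (elim \<omega>)
        then have "\<bar>R \<omega>\<bar>\<^sup>2 \<le> (K * N \<omega>)\<^sup>2" by (intro power_mono) auto
        also have "\<dots> = K\<^sup>2 * (N \<omega>)\<^sup>2" by (simp add: power_mult_distrib)
        also have "\<dots> \<le> K\<^sup>2 * (k * (\<Sum>i\<in>UNIV. copy_dev n i \<omega> ^ 4))" by (intro mult_left_mono N2) auto
        finally show ?case by (simp add: mult.assoc)
      qed
    qed (intro int)+
    also have "\<dots> = K\<^sup>2 * k * (k * moment 4 n)" by (simp add: copies)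
    finally show ?thesis by (simp add: power2_eq_square mult_ac)
  qed
  have R4: "expectation (\<lambda>\<omega>. R \<omega> ^ 4) \<le> K ^ 4 * k ^ 4 * moment 8 n"
  proof -
    have "expectation (\<lambda>\<omega>. R \<omega> ^ 4) \<le> expectation (\<lambda>\<omega>. K ^ 4 * k ^ 3 * (\<Sum>i\<in>UNIV. copy_dev n i \<omega> ^ 8))"
    proof (rule bounded_rv_mono_AE)
      show "AE \<omega> in M. R \<omega> ^ 4 \<le> K ^ 4 * k ^ 3 * (\<Sum>i\<in>UNIV. copy_dev n i \<omega> ^ 8)"
        using R_le
      proof eventually_elim
        case (elim \<omega>)
        then have "\<bar>R \<omega>\<bar> ^ 4 \<le> (K * N \<omega>) ^ 4" by (intro power_mono) auto
        also have "\<dots> = K ^ 4 * N \<omega> ^ 4" by (simp add: power_mult_distrib)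
        also have "\<dots> \<le> K ^ 4 * (k ^ 3 * (\<Sum>i\<in>UNIV. copy_dev n i \<omega> ^ 8))" by (intro mult_left_mono N4) auto
        finally show ?case by (simp add: mult.assoc)
      qed
    qed (intro int)+
    also have "\<dots> = K ^ 4 * k ^ 3 * (k * moment 8 n)" by (simp add: copies)
    finally show ?thesis by (simp add: power4_eq_xxxx power3_eq_cube mult_ac)
  qed
  have "expectation (\<lambda>\<omega>. (remainder n \<omega>)\<^sup>2) = variance R"
    by (simp add: ER R_def)
  also have "\<dots> \<le> expectation (\<lambda>\<omega>. (R \<omega> - 0)\<^sup>2)" by (rule variance_le_second_moment[OF R_bdd])
  also have "\<dots> \<le> K\<^sup>2 * k\<^sup>2 * moment 4 n" using R2 by simp
  finally show "expectation (\<lambda>\<omega>. (remainder n \<omega>)\<^sup>2) \<le> K\<^sup>2 * k\<^sup>2 * moment 4 n" .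
  have "t ^ 4 = ((expectation R)\<^sup>2)\<^sup>2" by (simp add: ER flip: power_mult)
  also have "\<dots> \<le> (expectation (\<lambda>\<omega>. (R \<omega>)\<^sup>2))\<^sup>2"
    by (intro power_mono square_expectation_le R_bdd) auto
  also have "\<dots> \<le> expectation (\<lambda>\<omega>. ((R \<omega>)\<^sup>2)\<^sup>2)" by (intro square_expectation_le bounded_rv_intros R_bdd)
  also have "\<dots> = expectation (\<lambda>\<omega>. R \<omega> ^ 4)" by (simp flip: power_mult)
  finally have t4: "t ^ 4 \<le> expectation (\<lambda>\<omega>. R \<omega> ^ 4)" .
  have "expectation (\<lambda>\<omega>. remainder n \<omega> ^ 4) \<le> expectation (\<lambda>\<omega>. 8 * R \<omega> ^ 4 + 8 * t ^ 4)"
  proof (rule bounded_rv_mono_AE)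
    have "remainder n \<omega> ^ 4 \<le> 8 * R \<omega> ^ 4 + 8 * t ^ 4" for \<omega>
    proof -
      have sq: "(x + y)\<^sup>2 \<le> 2 * (x\<^sup>2 + y\<^sup>2)" for x y :: real
        using sum_squares_bound[of x y] by (simp add: power2_sum)
      have "remainder n \<omega> ^ 4 = ((R \<omega> + t)\<^sup>2)\<^sup>2" by (simp add: R_def flip: power_mult)
      also have "\<dots> \<le> (2 * ((R \<omega>)\<^sup>2 + t\<^sup>2))\<^sup>2" by (intro power_mono sq) auto
      also have "\<dots> = 4 * ((R \<omega>)\<^sup>2 + t\<^sup>2)\<^sup>2" by (simp only: power_mult_distrib) simp
      also have "\<dots> \<le> 4 * (2 * (((R \<omega>)\<^sup>2)\<^sup>2 + (t\<^sup>2)\<^sup>2))" by (intro mult_left_mono sq) auto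
      also have "\<dots> = 8 * R \<omega> ^ 4 + 8 * t ^ 4" by (simp flip: power_mult)
      finally show ?thesis .
    qed
    then show "AE \<omega> in M. remainder n \<omega> ^ 4 \<le> 8 * R \<omega> ^ 4 + 8 * t ^ 4" by simp
  qed (intro int)+
  also have "\<dots> = 8 * expectation (\<lambda>\<omega>. R \<omega> ^ 4) + 8 * t ^ 4"
    by (subst Bochner_Integration.integral_add, (intro int)+) (simp add: prob_space)
  also have "\<dots> \<le> 16 * (K ^ 4 * k ^ 4 * moment 8 n)" using t4 R4 by linarith
  finally show "expectation (\<lambda>\<omega>. remainder n \<omega> ^ 4) \<le> 16 * K ^ 4 * k ^ 4 * moment 8 n" by (simp add: mult.assoc)
qed

lemma dev_Suc: "dev (Suc n) \<omega> = linear_part (grad n) n \<omega> + remainder n \<omega>"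
  by (simp add: remainder_def)

lemma moment_4_negligible: "(\<lambda>n. moment 4 n / moment 2 n) \<longlonglongrightarrow> 0"
proof -
  obtain \<kappa> C where "\<kappa> > 0" "C > 0" "eventually (\<lambda>n. C * \<kappa> ^ n \<le> moment 2 n) sequentially"
    using variance_decays_at_most_geometrically by blast
  then show ?thesis using higher_moment_negligible[of 2 \<kappa> C] by simp
qed

lemma moment_8_negligible: "(\<lambda>n. moment 8 n / moment 4 n) \<longlonglongrightarrow> 0"
proof -
  obtain \<kappa> C where \<kappa>: "\<kappa> > 0" "C > 0" "eventually (\<lambda>n. C * \<kappa> ^ n \<le> moment 2 n) sequentially"
    using variance_decays_at_most_geometrically by blast
  have "eventually (\<lambda>n. C\<^sup>2 * (\<kappa>\<^sup>2) ^ n \<le> moment 4 n) sequentially"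
    using \<kappa>(3)
  proof eventually_elim
    case (elim n)
    have "C\<^sup>2 * (\<kappa>\<^sup>2) ^ n = (C * \<kappa> ^ n)\<^sup>2" by (simp add: power_mult_distrib mult.commute flip: power_mult)
    also have "\<dots> \<le> (moment 2 n)\<^sup>2" using elim \<kappa> by (intro power_mono) auto
    also have "\<dots> \<le> moment 4 n" by (rule moment_2_sq_le)
    finally show ?case .
  qed
  then show ?thesis using higher_moment_negligible[of 4 "\<kappa>\<^sup>2" "C\<^sup>2"] \<kappa> by simp
qed

lemma norm_grad_tendsto: "(\<lambda>n. norm (grad n)) \<longlonglongrightarrow> norm limit_grad"
  by (rule tendsto_norm[OF grad_tendsto])

text \<open>
  The linear part contributes \<open>\<bar>grad n\<bar>\<^sup>2\<close>. The remainder has second moment of the order of the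
  fourth moment, which is negligible against the variance, and the mixed term is at most twice the
  geometric mean of the two contributions.
\<close>

lemma variance_ratio_tendsto: "(\<lambda>n. moment 2 (Suc n) / moment 2 n) \<longlonglongrightarrow> (norm limit_grad)\<^sup>2"
proof -
  define q where "q n = expectation (\<lambda>\<omega>. (remainder n \<omega>)\<^sup>2) / moment 2 n" for n
  define k where "k = real CARD('k)"
  have q0: "0 \<le> q n" for n using variance_pos[of n] by (simp add: q_def)
  have q_lim: "q \<longlonglongrightarrow> 0"
  proof (rule tendsto_sandwich[OF _ _ tendsto_const])
    show "\<forall>\<^sub>F n in sequentially. q n \<le> K\<^sup>2 * k\<^sup>2 * (moment 4 n / moment 2 n)"
      using remainder_moments(1) variance_pos 
      by (intro always_eventually allI) (simp add: q_def k_def divide_right_mono less_imp_le)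
    show "(\<lambda>n. K\<^sup>2 * k\<^sup>2 * (moment 4 n / moment 2 n)) \<longlonglongrightarrow> 0"
      using tendsto_mult[OF tendsto_const moment_4_negligible, of "K\<^sup>2 * k\<^sup>2"] by simp
  qed (use q0 in simp)
  define D where "D n = 2 * (norm (grad n) * sqrt (q n)) + q n" for n
  have close: "norm (moment 2 (Suc n) / moment 2 n - (norm (grad n))\<^sup>2) \<le> D n" for n
  proof -
    note pos = variance_pos[of n]
    note int = bounded_rv_integrable bounded_rv_intros remainder_bounded_rv linear_part_bounded_rv
    define r where "r = expectation (\<lambda>\<omega>. linear_part (grad n) n \<omega> * remainder n \<omega>)"
    have "moment 2 (Suc n) = expectation (\<lambda>\<omega>. (linear_part (grad n) n \<omega>)\<^sup>2 
        + 2 * (linear_part (grad n) n \<omega> * remainder n \<omega>) + (remainder n \<omega>)\<^sup>2)"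
      unfolding moment_def by (intro Bochner_Integration.integral_cong) (simp_all add: dev_Suc power2_sum)
    also have "\<dots> = (norm (grad n))\<^sup>2 * moment 2 n + 2 * r + q n * moment 2 n"
      unfolding r_def using pos
      by (subst Bochner_Integration.integral_add, (intro int)+)+ (simp add: linear_part_moments(2) q_def)
    finally have eq: "moment 2 (Suc n) / moment 2 n - (norm (grad n))\<^sup>2 = 2 * (r / moment 2 n) + q n"
      using pos by (simp add: field_simps)
    have "r\<^sup>2 \<le> (norm (grad n))\<^sup>2 * moment 2 n * (q n * moment 2 n)"
      using expectation_Cauchy_Schwarz[OF linear_part_bounded_rv remainder_bounded_rv, of "grad n" n n] pos
      by (simp add: r_def linear_part_moments(2) q_def)
    also have "\<dots> = (norm (grad n) * sqrt (q n) * moment 2 n)\<^sup>2"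
      using q0[of n] by (simp add: power_mult_distrib power2_eq_square)
    finally have "\<bar>r\<bar> \<le> \<bar>norm (grad n) * sqrt (q n) * moment 2 n\<bar>" by (simp only: abs_le_square_iff)
    then have "\<bar>r\<bar> \<le> norm (grad n) * sqrt (q n) * moment 2 n" using pos q0[of n] by (simp add: abs_mult)
    then have "\<bar>r / moment 2 n\<bar> \<le> norm (grad n) * sqrt (q n)" using pos by (simp add: abs_divide divide_le_eq)
    then show ?thesis unfolding eq D_def real_norm_def using q0[of n] by linarith
  qed
  have "D \<longlonglongrightarrow> 2 * (norm limit_grad * sqrt 0) + 0"
    unfolding D_def[abs_def] by (intro tendsto_intros norm_grad_tendsto q_lim)
  then have "D \<longlonglongrightarrow> 0" by simp
  then have "(\<lambda>n. moment 2 (Suc n) / moment 2 n - (norm (grad n))\<^sup>2) \<longlonglongrightarrow> 0"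
    by (rule Lim_null_comparison[rotated]) (use close in simp)
  from tendsto_add[OF this tendsto_power[OF norm_grad_tendsto, of 2]] show ?thesis by simp
qed

lemma variance_lower_rate:
  assumes "0 < t" "t < (norm limit_grad)\<^sup>2"
  shows "\<exists>C>0. \<forall>n. C * t ^ n \<le> moment 2 n"
proof (rule geometric_recursion_lower[OF variance_pos _ variance_ratio_tendsto assms])
  show "\<forall>\<^sub>F n in sequentially. moment 2 (Suc n) / moment 2 n * moment 2 n \<le> moment 2 (Suc n)"
    using variance_pos by (intro always_eventually allI) (simp add: less_imp_neq[symmetric])
qed

lemma variance_upper_rate:
  assumes "(norm limit_grad)\<^sup>2 < s"
  shows "\<exists>C>0. \<forall>n. moment 2 n \<le> C * s ^ n"
proof (rule geometric_recursion_upper[OF _ _ variance_ratio_tendsto assms, where K = 0 and q = 0])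
  show "\<forall>\<^sub>F n in sequentially. moment 2 (Suc n) \<le> moment 2 (Suc n) / moment 2 n * moment 2 n + 0 * 0 ^ n"
    using variance_pos by (intro always_eventually allI) (simp add: less_imp_neq[symmetric])
  show "0 < s" using assms by (meson le_less_trans zero_le_power2)
qed (use variance_pos less_imp_le in auto)

text \<open>
  The fourth moment is multiplied by at most about \<open>\<bar>\<alpha>\<bar>\<^sup>4\<close>, up to the forcing term \<open>3 \<bar>\<alpha>\<bar>\<^sup>4 \<sigma>\<^sup>4\<close>.
  The latter is itself of order nearly \<open>\<bar>\<alpha>\<bar>\<^sup>4\<^sup>n\<close> by the rate for the variance, and the remainder
  enters through the eighth moment, which is negligible.
\<close>

lemma fourth_moment_rate:
  assumes s: "norm limit_grad ^ 4 < s"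
  shows "\<exists>C>0. \<forall>n. moment 4 n \<le> C * s ^ n"
proof -
  define k where "k = real CARD('k)"
  define l where "l = norm limit_grad"
  have l: "0 \<le> l" by (simp add: l_def)
  have "((\<lambda>t. (1 + t) ^ 4 * l ^ 4) \<longlongrightarrow> (1 + 0) ^ 4 * l ^ 4) (at_right 0)" by (intro tendsto_intros)
  then have "eventually (\<lambda>t. (1 + t) ^ 4 * l ^ 4 < s) (at_right 0)"
    by (rule order_tendstoD) (use s in \<open>simp add: l_def\<close>)
  then have small: "eventually (\<lambda>t. (1 + t) ^ 4 * l ^ 4 < s \<and> 0 < t) (at_right 0)"
    using eventually_at_right_less by eventually_elim simp
  obtain t :: real where t: "(1 + t) ^ 4 * l ^ 4 < s" "0 < t"
    using eventually_happens'[OF trivial_limit_at_right_real small] by auto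
  define E where "E = (1 + 1 / t) ^ 4 * (16 * K ^ 4 * k ^ 4)"
  have E: "E \<ge> 0" using t K by (simp add: E_def k_def)
  define q where "q = (l ^ 4 + s) / 2"
  have q: "l ^ 4 < q" "q < s" using s by (auto simp: q_def l_def)
  have q0: "0 < q" using q(1) zero_le_power[OF l, of 4] by linarith
  have "l\<^sup>2 < sqrt q"
  proof (rule power2_less_imp_less)
    show "(l\<^sup>2)\<^sup>2 < (sqrt q)\<^sup>2" using q q0 by (simp flip: power_mult)
  qed (use q0 in simp)
  then obtain C where C: "C > 0" "\<And>n. moment 2 n \<le> C * sqrt q ^ n"
    using variance_upper_rate[of "sqrt q"] by (auto simp: l_def)
  have m2: "(moment 2 n)\<^sup>2 \<le> C\<^sup>2 * q ^ n" for n
  proof -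
    have "(moment 2 n)\<^sup>2 \<le> (C * sqrt q ^ n)\<^sup>2" using C(2) variance_pos[of n] by (intro power_mono) auto
    also have "\<dots> = C\<^sup>2 * (sqrt q ^ 2) ^ n" by (simp add: power_mult_distrib mult.commute flip: power_mult)
    finally show ?thesis using q0 by simp
  qed
  have "Bseq (\<lambda>n. norm (grad n) ^ 4)" 
    using tendsto_power[OF norm_grad_tendsto, of 4] by (intro convergent_imp_Bseq convergentI)
  then obtain B where B: "B > 0" "\<And>n. norm (grad n) ^ 4 \<le> B" by (auto simp: Bseq_def)
  have m4_pos: "0 < moment 4 n" for n
    using moment_2_sq_le[of n] variance_pos[of n] by (smt (verit) zero_less_power)
  show ?thesis
  proof (rule geometric_recursion_upper[where 
        r = "\<lambda>n. (1 + t) ^ 4 * norm (grad n) ^ 4 + E * (moment 8 n / moment 4 n)" and 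
        K = "(1 + t) ^ 4 * B * 3 * C\<^sup>2" and q = q])
    show "(\<lambda>n. (1 + t) ^ 4 * norm (grad n) ^ 4 + E * (moment 8 n / moment 4 n)) \<longlonglongrightarrow> (1 + t) ^ 4 * l ^ 4 + E * 0"
      unfolding l_def by (intro tendsto_intros norm_grad_tendsto moment_8_negligible)
    show "\<forall>\<^sub>F n in sequentially. moment 4 (Suc n) 
        \<le> ((1 + t) ^ 4 * norm (grad n) ^ 4 + E * (moment 8 n / moment 4 n)) * moment 4 n + (1 + t) ^ 4 * B * 3 * C\<^sup>2 * q ^ n"
    proof (intro always_eventually allI)
      fix n
      note int = bounded_rv_integrable bounded_rv_intros remainder_bounded_rv linear_part_bounded_rv dev_bounded_rv
      have "moment 4 (Suc n) \<le> expectation (\<lambda>\<omega>. (1 + t) ^ 4 * linear_part (grad n) n \<omega> ^ 4 + (1 + 1 / t) ^ 4 * remainder n \<omega> ^ 4)"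
        unfolding moment_def
      proof (rule bounded_rv_mono_AE)
        show "AE \<omega> in M. dev (Suc n) \<omega> ^ 4 \<le> (1 + t) ^ 4 * linear_part (grad n) n \<omega> ^ 4 + (1 + 1 / t) ^ 4 * remainder n \<omega> ^ 4"
          unfolding dev_Suc by (intro AE_I2 power4_add_le t)
      qed (intro int)+
      also have "\<dots> = (1 + t) ^ 4 * expectation (\<lambda>\<omega>. linear_part (grad n) n \<omega> ^ 4) + (1 + 1 / t) ^ 4 * expectation (\<lambda>\<omega>. remainder n \<omega> ^ 4)"
        by (subst Bochner_Integration.integral_add, (intro int)+) simp
      also have "\<dots> \<le> (1 + t) ^ 4 * (norm (grad n) ^ 4 * (moment 4 n + 3 * (moment 2 n)\<^sup>2)) 
          + (1 + 1 / t) ^ 4 * (16 * K ^ 4 * k ^ 4 * moment 8 n)"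
        using linear_part_moments(3) remainder_moments(2) t unfolding k_def
        by (intro add_mono mult_left_mono) auto
      also have "\<dots> = (1 + t) ^ 4 * norm (grad n) ^ 4 * moment 4 n + E * moment 8 n 
          + (1 + t) ^ 4 * (norm (grad n) ^ 4 * (3 * (moment 2 n)\<^sup>2))"
        by (simp add: E_def algebra_simps)
      also have "\<dots> \<le> (1 + t) ^ 4 * norm (grad n) ^ 4 * moment 4 n + E * moment 8 n 
          + (1 + t) ^ 4 * (B * (3 * (C\<^sup>2 * q ^ n)))"
        using B m2 t by (intro add_left_mono mult_left_mono mult_mono) auto
      also have "\<dots> = ((1 + t) ^ 4 * norm (grad n) ^ 4 + E * (moment 8 n / moment 4 n)) * moment 4 n + (1 + t) ^ 4 * B * 3 * C\<^sup>2 * q ^ n"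
        using m4_pos[of n] by (simp add: distrib_right mult.assoc)
      finally show "moment 4 (Suc n) 
        \<le> ((1 + t) ^ 4 * norm (grad n) ^ 4 + E * (moment 8 n / moment 4 n)) * moment 4 n + (1 + t) ^ 4 * B * 3 * C\<^sup>2 * q ^ n" .
    qed
  qed (use m4_pos less_imp_le t q q0 in auto)
qed

text \<open>
  The bound is multiplied by \<open>\<Sum>\<bar>grad n\<^sub>i\<bar>\<^sup>3\<close> in each step, with an additional error of the order
  of the fourth moment. This error decays at the rate \<open>\<bar>\<alpha>\<bar>\<^sup>4\<close> up to slack, and \<open>\<bar>\<alpha>\<bar>\<^sup>4\<close> does not
  exceed \<open>\<Sum>\<bar>\<alpha>\<^sub>i\<bar>\<^sup>3\<close>.
\<close>

lemma stein_rate: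
  obtains d where "\<And>n. stein_bounded (distr M borel (dev n)) (d n)"
    "\<And>s. (\<Sum>i\<in>UNIV. \<bar>limit_grad $ i\<bar> ^ 3) < s \<Longrightarrow> \<exists>C>0. \<forall>n. d n \<le> C * s ^ n"
proof -
  define k where "k = real CARD('k)"
  define A where "A n = K\<^sup>2 * k\<^sup>2 * moment 4 n + moment 4 (Suc n) + norm (grad n) ^ 4 * (4 * moment 4 n)" for n
  define rho where "rho n = (\<Sum>i\<in>UNIV. \<bar>grad n $ i\<bar> ^ 3)" for n
  have m4: "0 \<le> moment 4 n" for n by (rule moment_even_nonneg) simp
  have A0: "0 \<le> A n" for n using m4 by (simp add: A_def)
  obtain d0 where d0: "d0 \<ge> 0" "stein_bounded (distr M borel (dev 0)) d0"
    using stein_bounded_exists[OF dev_bounded_rv moment_1] by blast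
  define d where "d = rec_nat d0 (\<lambda>n x. rho n * x + 10 * A n)"
  have d_0: "d 0 = d0" and d_Suc: "d (Suc n) = rho n * d n + 10 * A n" for n by (simp_all add: d_def)
  have rho0: "0 \<le> rho n" for n by (simp add: rho_def sum_nonneg)
  have d_nonneg: "0 \<le> d n" for n by (induction n) (simp_all add: d_0 d_Suc d0 rho0 A0)
  have "stein_bounded (distr M borel (dev n)) (d n)" for n
  proof (induction n)
    case 0 then show ?case using d0 by (simp add: d_0)
  next
    case (Suc n)
    have lin: "stein_bounded (distr M borel (linear_part (grad n) n)) (rho n * d n)"
      unfolding rho_def by (rule stein_bounded_linear_part[OF Suc])
    show ?case unfolding d_Suc
    proof (rule stein_bounded_perturbation[OF linear_part_bounded_rv linear_part_moments(1) dev_bounded_rv moment_1 lin])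
      have nn: "0 \<le> norm (grad n) ^ 4 * (4 * moment 4 n)" "0 \<le> K\<^sup>2 * k\<^sup>2 * moment 4 n" using m4 by simp_all
      show "expectation (\<lambda>\<omega>. (dev (Suc n) \<omega> - linear_part (grad n) n \<omega>)\<^sup>2) \<le> A n"
        using remainder_moments(1)[of n] nn m4[of "Suc n"] unfolding A_def remainder_def k_def by linarith
      show "expectation (\<lambda>\<omega>. dev (Suc n) \<omega> ^ 4) \<le> A n"
        using nn unfolding A_def moment_def[of 4 "Suc n"] by linarith
      have "norm (grad n) ^ 4 * (moment 4 n + 3 * (moment 2 n)\<^sup>2) \<le> norm (grad n) ^ 4 * (4 * moment 4 n)"
        using moment_2_sq_le[of n] by (intro mult_left_mono) auto
      then show "expectation (\<lambda>\<omega>. linear_part (grad n) n \<omega> ^ 4) \<le> A n"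
        using linear_part_moments(3)[of "grad n" n] nn m4[of "Suc n"] unfolding A_def by linarith
    qed
  qed
  moreover have "\<exists>C>0. \<forall>n. d n \<le> C * s ^ n" if s: "(\<Sum>i\<in>UNIV. \<bar>limit_grad $ i\<bar> ^ 3) < s" for s
  proof -
    \<comment> \<open>Strictly between the limit of the multipliers and \<open>s\<close>; fourth moments are of order \<open>q\<^sup>n\<close>, as \<open>\<bar>\<alpha>\<bar>\<^sup>4 < q\<close>.\<close>
    define q where "q = ((\<Sum>i\<in>UNIV. \<bar>limit_grad $ i\<bar> ^ 3) + s) / 2"
    have "norm limit_grad ^ 4 \<le> (\<Sum>i\<in>UNIV. \<bar>limit_grad $ i\<bar> ^ 3)"
      by (rule norm_power4_le_sum_cubes) (simp add: limit_grad_nonneg limit_grad_sum)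
    then have q: "norm limit_grad ^ 4 < q" "q < s" using s by (auto simp: q_def)
    have q0: "0 < q" using q(1) by (rule le_less_trans[rotated]) simp
    obtain C where C: "C > 0" "\<And>n. moment 4 n \<le> C * q ^ n" using fourth_moment_rate[OF q(1)] by blast
    have "Bseq (\<lambda>n. norm (grad n) ^ 4)" 
      using tendsto_power[OF norm_grad_tendsto, of 4] by (intro convergent_imp_Bseq convergentI)
    then obtain B where B: "B > 0" "\<And>n. norm (grad n) ^ 4 \<le> B" by (auto simp: Bseq_def)
    have A_le: "A n \<le> (K\<^sup>2 * k\<^sup>2 + q + 4 * B) * C * q ^ n" for n
    proof -
      have "A n \<le> K\<^sup>2 * k\<^sup>2 * (C * q ^ n) + C * q ^ Suc n + B * (4 * (C * q ^ n))"
        unfolding A_def using B C(2)[of n] C(2)[of "Suc n"] m4[of n] by (intro add_mono mult_left_mono mult_mono) auto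
      also have "\<dots> = (K\<^sup>2 * k\<^sup>2 + q + 4 * B) * C * q ^ n" by (simp add: algebra_simps)
      finally show ?thesis .
    qed
    show ?thesis
    proof (rule geometric_recursion_upper[where r = rho and K = "10 * ((K\<^sup>2 * k\<^sup>2 + q + 4 * B) * C)" and q = q])
      show "rho \<longlonglongrightarrow> (\<Sum>i\<in>UNIV. \<bar>limit_grad $ i\<bar> ^ 3)"
        unfolding rho_def[abs_def] by (intro tendsto_intros grad_tendsto)
      show "\<forall>\<^sub>F n in sequentially. d (Suc n) \<le> rho n * d n + 10 * ((K\<^sup>2 * k\<^sup>2 + q + 4 * B) * C) * q ^ n"
        using A_le by (intro always_eventually allI) (simp add: d_Suc mult.assoc)
    qed (use s q q0 d_nonneg in auto)
  qed
  ultimately show thesis by (rule that)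
qed

end

section \<open>The scaled case and the normal approximation\<close>

context hierarchical_sequence
begin

text \<open>
  The means tend to \<open>c\<close>. By convergence in mean the vector of copies tends to the diagonal point,
  and the Lipschitz bound there makes the means of the values of \<open>F\<close> tend to \<open>F(c,\<dots>,c)\<close>.
\<close>

lemma limit_is_fixed_point:
  assumes L: "\<And>y. y \<in> cube {a..b} \<Longrightarrow> \<bar>F y - F (vec c)\<bar> \<le> L * norm (y - vec c)" and L0: "0 \<le> L"
  shows "F (vec c) = c"
proof -
  define k where "k = real CARD('k)"
  have close: "norm (mean (Suc n) - F (vec c)) \<le> L * k * expectation (\<lambda>\<omega>. \<bar>X n \<omega> - c\<bar>)" for n
  proof -
    note int = bounded_rv_integrable bounded_rv_intros X_bounded_rv Y_bounded_rv
    have "mean (Suc n) - F (vec c) = expectation (\<lambda>\<omega>. X (Suc n) \<omega> - F (vec c))"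
      unfolding mean_def by (subst Bochner_Integration.integral_diff, (intro int)+) (simp add: prob_space)
    also have "\<bar>\<dots>\<bar> \<le> expectation (\<lambda>\<omega>. \<bar>X (Suc n) \<omega> - F (vec c)\<bar>)" by (rule integral_abs_bound)
    also have "\<dots> \<le> expectation (\<lambda>\<omega>. L * (\<Sum>i\<in>UNIV. \<bar>Y n i \<omega> - c\<bar>))"
    proof (rule bounded_rv_mono_AE)
      show "AE \<omega> in M. \<bar>X (Suc n) \<omega> - F (vec c)\<bar> \<le> L * (\<Sum>i\<in>UNIV. \<bar>Y n i \<omega> - c\<bar>)"
        using X_step[of n] Y_cube[of n]
      proof eventually_elim
        case (elim \<omega>)
        have "\<bar>X (Suc n) \<omega> - F (vec c)\<bar> \<le> L * norm ((\<chi> i. Y n i \<omega>) - vec c)"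
          using L[OF elim(2)] elim(1) by simp
        also have "\<dots> \<le> L * (\<Sum>i\<in>UNIV. \<bar>((\<chi> i. Y n i \<omega>) - vec c) $ i\<bar>)"
          by (intro mult_left_mono norm_le_l1_cart L0)
        finally show ?case by simp
      qed
    qed (intro int)+
    also have "\<dots> = L * (\<Sum>i\<in>UNIV. expectation (\<lambda>\<omega>. \<bar>Y n i \<omega> - c\<bar>))"
      by (subst integral_mult_right_zero, subst Bochner_Integration.integral_sum, (intro int)) simp
    also have "(\<Sum>i\<in>UNIV. expectation (\<lambda>\<omega>. \<bar>Y n i \<omega> - c\<bar>)) = k * expectation (\<lambda>\<omega>. \<bar>X n \<omega> - c\<bar>)"
      using expectation_Y[of "\<lambda>x. \<bar>x - c\<bar>"] by (simp add: k_def)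
    finally show ?thesis by (simp add: mult.assoc)
  qed
  have "(\<lambda>n. L * k * expectation (\<lambda>\<omega>. \<bar>X n \<omega> - c\<bar>)) \<longlonglongrightarrow> 0"
    using tendsto_mult[OF tendsto_const mean_abs_dev_vanishes, of "L * k"] by simp
  then have "(\<lambda>n. mean (Suc n) - F (vec c)) \<longlonglongrightarrow> 0"
    by (rule Lim_null_comparison[rotated]) (use close in simp)
  moreover have "(\<lambda>n. mean (Suc n) - F (vec c)) \<longlonglongrightarrow> c - F (vec c)"
    by (intro tendsto_intros LIMSEQ_Suc mean_tendsto)
  ultimately show ?thesis using LIMSEQ_unique by fastforce
qed

text \<open>
  For linear \<open>F\<close> the deviations satisfy the linear recursion exactly, so the variance and the
  discrepancy bound are exact geometric sequences.
\<close>

lemma linear_wasserstein_rate: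
  assumes lin: "\<And>x. x \<in> cube {a..b} \<Longrightarrow> F x = \<alpha> \<bullet> x"
    and \<alpha>: "\<alpha> \<noteq> 0" and \<gamma>: "contraction_rate \<alpha> < \<gamma>"
  shows "\<exists>C::real. \<forall>n. wasserstein_dist (distr M borel (standardized M (X n))) std_normal_distribution \<le> ereal (C * \<gamma> ^ n)"
proof -
  have step: "AE \<omega> in M. dev (Suc n) \<omega> = linear_part \<alpha> n \<omega>" for n
  proof -
    define t where "t = (\<Sum>i\<in>UNIV. \<alpha> $ i * mean n)"
    have X_lin: "AE \<omega> in M. X (Suc n) \<omega> = linear_part \<alpha> n \<omega> + t"
      using X_step[of n] Y_cube[of n]
    proof eventually_elim
      case (elim \<omega>)
      then show ?case
        by (simp add: lin inner_vec_def linear_part_def copy_dev_def t_def right_diff_distrib sum_subtractf)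
    qed
    then have "mean (Suc n) = expectation (\<lambda>\<omega>. linear_part \<alpha> n \<omega> + t)"
      unfolding mean_def by (intro integral_cong_AE) auto
    also have "\<dots> = t"
      by (subst Bochner_Integration.integral_add, (intro bounded_rv_integrable bounded_rv_intros linear_part_bounded_rv)+)
         (simp add: prob_space linear_part_moments(1))
    finally have mean_t: "mean (Suc n) = t" .
    show ?thesis using X_lin by eventually_elim (simp add: dev_def mean_t)
  qed
  have var: "moment 2 n = ((norm \<alpha>)\<^sup>2) ^ n * moment 2 0" for n
  proof (induction n)
    case (Suc n)
    have "moment 2 (Suc n) = expectation (\<lambda>\<omega>. (linear_part \<alpha> n \<omega>)\<^sup>2)"
      unfolding moment_def by (rule integral_cong_AE) (use step[of n] in auto)
    then show ?case using Suc by (simp add: linear_part_moments(2))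
  qed simp
  have pos0: "0 < moment 2 0" using X0_nonconst variance_pos_iff by blast
  define A where "A = (\<Sum>i\<in>UNIV. \<bar>\<alpha> $ i\<bar> ^ 3)"
  have A: "0 \<le> A" by (simp add: A_def sum_nonneg)
  obtain d0 where d0: "d0 \<ge> 0" "stein_bounded (distr M borel (dev 0)) d0"
    using stein_bounded_exists[OF dev_bounded_rv moment_1] by blast
  have stein: "stein_bounded (distr M borel (dev n)) (A ^ n * d0)" for n
  proof (induction n)
    case (Suc n)
    have "distr M borel (dev (Suc n)) = distr M borel (linear_part \<alpha> n)"
      by (rule distr_cong_AE) (use step[of n] in auto)
    then show ?case using stein_bounded_linear_part[OF Suc, of \<alpha>] by (simp add: A_def mult.assoc)
  qed (use d0 in simp)
  show ?thesis
  proof (rule wasserstein_rate[OF _ stein _ _ \<alpha> \<gamma>])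
    show "0 < moment 2 n" for n using pos0 \<alpha> by (subst var) simp
    show "\<exists>C>0. \<forall>n. A ^ n * d0 \<le> C * s ^ n" if "(\<Sum>i\<in>UNIV. \<bar>\<alpha> $ i\<bar> ^ 3) < s" for s
    proof (intro exI[of _ "d0 + 1"] conjI allI)
      fix n
      have "A ^ n * d0 \<le> s ^ n * (d0 + 1)"
        using that A d0 by (intro mult_mono power_mono) (auto simp: A_def)
      then show "A ^ n * d0 \<le> (d0 + 1) * s ^ n" by (simp add: mult.commute)
    qed (use d0 in simp)
    show "\<exists>C>0. \<forall>n. C * t ^ n \<le> moment 2 n" if "0 < t" "t < (norm \<alpha>)\<^sup>2" for t
    proof (intro exI[of _ "moment 2 0"] conjI allI pos0)
      fix n
      have "t ^ n * moment 2 0 \<le> ((norm \<alpha>)\<^sup>2) ^ n * moment 2 0"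
        using that pos0 by (intro mult_right_mono power_mono) auto
      then show "moment 2 0 * t ^ n \<le> moment 2 n" using var[of n] by (simp add: mult.commute)
    qed
  qed
qed

end

text \<open>
  For \<open>x\<close> in the cube \<open>F(t x) / t = F(x)\<close> is constant in \<open>0 < t \<le> 1\<close>, and its limit as \<open>t\<close> tends
  to \<open>0\<close> is the directional derivative.
\<close>

lemma homogeneous_differentiable_at_zero_linear:
  fixes F :: "real ^ 'k \<Rightarrow> real"
  assumes hom: "homogeneous {a..b} F" and zero: "0 \<in> {a..b}"
    and deriv: "(F has_derivative (\<lambda>h. \<alpha> \<bullet> h)) (at (vec 0) within cube {a..b})"
    and x: "x \<in> cube {a..b}"
  shows "F x = \<alpha> \<bullet> x"
proof -
  have seg: "t *\<^sub>R x \<in> cube {a..b}" if t: "t \<in> {0..1}" for t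
  proof -
    have "t * x $ i \<in> {a..b}" for i
    proof -
      have "x $ i \<in> {a..b}" using x by (simp add: cube_def)
      from convexD_alt[OF convex_real_interval(5) zero this, of t] t show ?thesis by simp
    qed
    then show ?thesis by (simp add: cube_def)
  qed
  have F_t: "F (t *\<^sub>R x) = t * F x" if "t \<in> {0..1}" for t
    using hom x seg[OF that] unfolding homogeneous_def by blast
  have F0: "F 0 = 0" using F_t[of 0] by simp
  have v0: "vec 0 = (0 :: real ^ 'k)" by (simp add: vec_eq_iff)
  have nt: "at 0 within {0..1::real} \<noteq> bot" using at_within_cube_nontrivial[of 0 1 0] by simp
  have "((\<lambda>t. (F (vec 0 + t *\<^sub>R x) - F (vec 0)) / t) \<longlongrightarrow> \<alpha> \<bullet> x) (at 0 within {0..1})"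
    by (rule directional_derivative_cube[OF deriv]) (simp add: v0 seg)
  moreover have "\<forall>\<^sub>F t in at 0 within {0..1}. (F (vec 0 + t *\<^sub>R x) - F (vec 0)) / t = F x"
    unfolding eventually_at_filter by (rule always_eventually) (auto simp: v0 F0 F_t)
  then have "((\<lambda>t. (F (vec 0 + t *\<^sub>R x) - F (vec 0)) / t) \<longlongrightarrow> F x) (at 0 within {0..1})"
    by (rule tendsto_eventually)
  ultimately show ?thesis using tendsto_unique[OF nt] by blast
qed

theorem theorem1p1:
  fixes M :: "'a measure"
    and F :: "real ^ 'k \<Rightarrow> real"
    and X :: "nat \<Rightarrow> 'a \<Rightarrow> real"
    and Y :: "nat \<Rightarrow> 'k \<Rightarrow> 'a \<Rightarrow> real"
    and a b c :: real
    and \<alpha> :: "real ^ 'k"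
  assumes "CARD('k) \<ge> 2"
    and "a < b"
    and "prob_space M"
    and "\<And>n. X n \<in> borel_measurable M"
    and "\<not> (\<exists>x. AE \<omega> in M. X 0 \<omega> = x)"
    and "\<P>(\<omega> in M. X 0 \<omega> \<in> {a..b}) = 1"
    and "F \<in> cube {a..b} \<rightarrow> {a..b}"
    and "twice_continuously_differentiable_on F (cube {a..b})"
    and "\<And>n. prob_space.indep_vars M (\<lambda>_. borel) (Y n) UNIV"
    and "\<And>n i. distr M borel (Y n i) = distr M borel (X n)"
    and "\<And>n. AE \<omega> in M. X (Suc n) \<omega> = F (\<chi> i. Y n i \<omega>)"
    and "averaging {a..b} F \<or> (scaled_averaging {a..b} F \<and> homogeneous {a..b} F)"
    and "converges_in_probability M X c"
    and "(F has_derivative (\<lambda>h. \<alpha> \<bullet> h)) (at (vec c) within cube {a..b})"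
    and "\<not> (\<exists>t i. \<alpha> = t *\<^sub>R axis i 1)"
  shows "(\<forall>\<gamma>. contraction_rate \<alpha> < \<gamma> \<and> \<gamma> < 1 \<longrightarrow>
            (\<exists>C::real. \<forall>n. wasserstein_dist (distr M borel (standardized M (X n)))
                               std_normal_distribution \<le> ereal (C * \<gamma> ^ n)))
       \<and> 0 < contraction_rate \<alpha> \<and> contraction_rate \<alpha> < 1
       \<and> (\<forall>\<beta> :: real ^ 'k. \<beta> \<noteq> 0 \<longrightarrow> 1 / sqrt (real CARD('k)) \<le> contraction_rate \<beta>)
       \<and> (contraction_rate \<alpha> = 1 / sqrt (real CARD('k)) \<longleftrightarrow> (\<forall>i j. \<alpha> $ i = \<alpha> $ j))"
proof -
  interpret prob_space M by fact
  let ?rate = "\<lambda>\<gamma>. \<exists>C::real. \<forall>n. wasserstein_dist (distr M borel (standardized M (X n))) std_normal_distribution \<le> ereal (C * \<gamma> ^ n)"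
  have \<alpha>: "\<alpha> \<noteq> 0" using assms(15)[simplified, rule_format, of 0] by auto
  obtain G K where K: "K \<ge> 0" and G: "continuous_on (cube {a..b}) G"
    and F_deriv: "\<And>x. x \<in> cube {a..b} \<Longrightarrow> (F has_derivative (\<lambda>h. G x \<bullet> h)) (at x within cube {a..b})"
    and F_taylor: "\<And>x y. x \<in> cube {a..b} \<Longrightarrow> y \<in> cube {a..b} \<Longrightarrow> 
        \<bar>F y - F x - G x \<bullet> (y - x)\<bar> \<le> K * (norm (y - x))\<^sup>2"
    by (rule twice_differentiable_taylor[OF assms(8)]) (auto simp: cube_eq_cbox)
  have F_cont: "continuous_on (cube {a..b}) F" by (rule has_derivative_continuous_on[OF F_deriv])
  interpret H: hierarchical_sequence M F X Y a b c
  proof unfold_locales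
    show "AE \<omega> in M. X 0 \<omega> \<in> {a..b}"
      using assms(6) assms(4)[of 0] by (subst (asm) prob_Collect_eq_1) auto
    show "F x \<in> {a..b}" if "x \<in> cube {a..b}" for x using assms(7) that by blast
  qed (use assms F_cont in auto)
  note vec_c = vec_mem_cube[OF H.limit_range]
  have smooth: "?rate \<gamma>"
    if avg: "averaging {a..b} F" and \<gamma>: "contraction_rate \<alpha> < \<gamma>" for \<gamma>
  proof -
    interpret S: smooth_averaging_sequence M F X Y a b c G K
      by unfold_locales (use assms(1) avg K G F_deriv F_taylor in auto)
    have \<alpha>_eq: "S.limit_grad = \<alpha>"
      unfolding S.limit_grad_def
      by (rule gradient_unique_cube[OF F_deriv[OF vec_c] assms(14) assms(2) H.limit_range])
    obtain d where d: "\<And>n. stein_bounded (distr M borel (H.dev n)) (d n)"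
      "\<And>s. (\<Sum>i\<in>UNIV. \<bar>\<alpha> $ i\<bar> ^ 3) < s \<Longrightarrow> \<exists>C>0. \<forall>n. d n \<le> C * s ^ n"
      using S.stein_rate unfolding \<alpha>_eq by blast
    show ?thesis
      by (rule H.wasserstein_rate[OF S.variance_pos d S.variance_lower_rate[unfolded \<alpha>_eq] \<alpha> \<gamma>])
  qed
  have "\<exists>s\<noteq>0. (\<forall>i. 0 \<le> \<alpha> $ i / s) \<and> (\<forall>\<gamma>. contraction_rate \<alpha> < \<gamma> \<longrightarrow> ?rate \<gamma>)"
    using assms(12)
  proof
    assume avg: "averaging {a..b} F"
    have "0 \<le> \<alpha> $ i" for i by (rule averaging_gradient(1)[OF avg assms(14) assms(2) H.limit_range])
    then show ?thesis using smooth[OF avg] by (intro exI[of _ 1]) auto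
  next
    assume "scaled_averaging {a..b} F \<and> homogeneous {a..b} F"
    then have hom: "homogeneous {a..b} F" and s0: "F (vec 1) \<noteq> 0" 
      and avg: "averaging {a..b} (\<lambda>x. F x / F (vec 1))" by (auto simp: scaled_averaging_def)
    define s where "s = F (vec 1)"
    have "((\<lambda>x. F x / s) has_derivative (\<lambda>h. (\<alpha> \<bullet> h) / s)) (at (vec c) within cube {a..b})"
      unfolding divide_inverse by (rule has_derivative_mult_left[OF assms(14)])
    also have "(\<lambda>h. (\<alpha> \<bullet> h) / s) = (\<lambda>h. ((1 / s) *\<^sub>R \<alpha>) \<bullet> h)" by auto
    finally have "0 \<le> ((1 / s) *\<^sub>R \<alpha>) $ i" for i
      by (rule averaging_gradient(1)[OF avg[folded s_def] _ assms(2) H.limit_range])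
    then have sign: "0 \<le> \<alpha> $ i / s" for i by simp
    have "F (vec c) / s = c" using averaging_vec[OF avg H.limit_range] by (simp add: s_def)
    then have Fc: "F (vec c) = s * c" using s0 by (simp add: s_def field_simps)
    have "F (vec c) = c"
    proof (rule H.limit_is_fixed_point)
      define L where "L = norm (G (vec c)) + K * (real CARD('k) * (b - a))"
      show "0 \<le> L" using K assms(2) by (simp add: L_def)
      fix y :: "real ^ 'k" assume y: "y \<in> cube {a..b}"
      have "norm (y - vec c) \<le> (\<Sum>i\<in>UNIV. \<bar>(y - vec c) $ i\<bar>)" by (rule norm_le_l1_cart)
      also have "\<dots> \<le> (\<Sum>i\<in>(UNIV :: 'k set). b - a)"
      proof (rule sum_mono)
        fix i
        have "y $ i \<in> {a..b}" using y by (simp add: cube_def)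
        then show "\<bar>(y - vec c) $ i\<bar> \<le> b - a" using H.limit_range by auto
      qed
      finally have ny: "norm (y - vec c) \<le> real CARD('k) * (b - a)" by simp
      have "\<bar>F y - F (vec c)\<bar> \<le> \<bar>G (vec c) \<bullet> (y - vec c)\<bar> + K * (norm (y - vec c))\<^sup>2"
        using F_taylor[OF vec_c y] by linarith
      also have "\<dots> \<le> norm (G (vec c)) * norm (y - vec c) + K * (real CARD('k) * (b - a) * norm (y - vec c))"
        unfolding power2_eq_square using K ny 
        by (intro add_mono Cauchy_Schwarz_ineq2 mult_left_mono mult_right_mono) auto
      also have "\<dots> = L * norm (y - vec c)" by (simp add: L_def algebra_simps)
      finally show "\<bar>F y - F (vec c)\<bar> \<le> L * norm (y - vec c)" .
    qed
    with Fc have "(s - 1) * c = 0" by (simp add: algebra_simps)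
    then consider "s = 1" | "c = 0" by auto
    then have "\<forall>\<gamma>. contraction_rate \<alpha> < \<gamma> \<longrightarrow> ?rate \<gamma>"
    proof cases
      case 1
      then have "averaging {a..b} F" using avg by (simp add: s_def)
      then show ?thesis using smooth by blast
    next
      case 2
      have "F x = \<alpha> \<bullet> x" if "x \<in> cube {a..b}" for x
        by (rule homogeneous_differentiable_at_zero_linear[OF hom _ _ that])
           (use H.limit_range assms(14) 2 in auto)
      then show ?thesis using H.linear_wasserstein_rate[OF _ \<alpha>] by blast
    qed
    then show ?thesis using sign s0 by (intro exI[of _ s]) (auto simp: s_def)
  qed
  then obtain s where s: "s \<noteq> 0" "\<And>i. 0 \<le> \<alpha> $ i / s" and rate: "\<forall>\<gamma>. contraction_rate \<alpha> < \<gamma> \<longrightarrow> ?rate \<gamma>"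
    by blast
  \<comment> \<open>All components have the sign of the scale, so equality of absolute values is equality.\<close>
  have "\<alpha> $ i = s * \<bar>\<alpha> $ i\<bar> / \<bar>s\<bar>" for i
  proof -
    have "\<alpha> $ i / s = \<bar>\<alpha> $ i\<bar> / \<bar>s\<bar>" using s(2)[of i] by (metis abs_divide abs_of_nonneg)
    then show ?thesis using s(1) by (simp add: field_simps)
  qed
  then have "(\<forall>i j. \<bar>\<alpha> $ i\<bar> = \<bar>\<alpha> $ j\<bar>) \<longleftrightarrow> (\<forall>i j. \<alpha> $ i = \<alpha> $ j)" by metis
  then show ?thesis
    using rate contraction_rate_pos[OF \<alpha>] contraction_rate_less_one[OF assms(15)] 
      contraction_rate_lower contraction_rate_eq_iff[OF \<alpha>] by blast
qed

end
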